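(* Let $\mathcal M$ be a three-fold strict monoidal category. Then the three-fold reduced bar construction $\overline W\mathcal M$, together with the natural transformations $\omega$, is a lax functor from $(\Delta^{op})^3$ to $Cat$; that is, for all arrows $e_1,e_2,e_3$ of $(\Delta^{op})^3$ such that $e_3\circ e_2\circ e_1$ is defined, the following equality of natural transformations $\overline W\mathcal M(e_3)\circ\overline W\mathcal M(e_2)\circ\overline W\mathcal M(e_1)\to\overline W\mathcal M(e_3\circ e_2\circ e_1)$ holds: $$\omega_{e_3\circ e_2,\,e_1}\circ\big(\omega_{e_3,e_2}\,\overline W\mathcal M(e_1)\big)=\omega_{e_3,\,e_2\circ e_1}\circ\big(\overline W\mathcal M(e_3)\,\omega_{e_2,e_1}\big).$$
   Context: **Three-fold strict monoidal category.** A category $\mathcal M$ with three strict monoidal structures $(\otimes_k,I_k)$, $1\le k\le 3$, and, for all $1\le k<l\le 3$, arrows $\kappa_{k,l}:I_k\to I_l$, $\beta_{k,l}:I_k\to I_k\otimes_l I_k$, $\tau_{k,l}:I_l\otimes_k I_l\to I_l$ and a natural transformation $\iota^{k,l}_{A,B,C,D}:(A\otimes_l B)\otimes_k(C\otimes_l D)\to(A\otimes_k C)\otimes_l(B\otimes_k D)$, such that (a) for all $k<l$, omitting the indices $k,l$ on $\kappa,\beta,\tau,\iota$: (1) $\iota_{A,D,B\otimes_kC,E\otimes_kF}\circ(\mathbf 1\otimes_k\iota_{B,E,C,F})=\iota_{A\otimes_kB,D\otimes_kE,C,F}\circ(\iota_{A,D,B,E}\otimes_k\mathbf 1)$; (2)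 $\iota_{A,B,I_k,I_k}\circ(\mathbf 1\otimes_k\beta)=\mathbf 1$; (3) $\iota_{I_k,I_k,A,B}\circ(\beta\otimes_k\mathbf 1)=\mathbf 1$; (4) $\tau\circ(\mathbf 1\otimes_k\tau)=\tau\circ(\tau\otimes_k\mathbf 1)$; (5) $\tau\circ(\mathbf 1\otimes_k\kappa)=\mathbf 1$; (6) $\tau\circ(\kappa\otimes_k\mathbf 1)=\mathbf 1$; (7) $(\mathbf 1\otimes_l\iota_{B,C,E,F})\circ\iota_{A,B\otimes_lC,D,E\otimes_lF}=(\iota_{A,B,D,E}\otimes_l\mathbf 1)\circ\iota_{A\otimes_lB,C,D\otimes_lE,F}$; (8) $(\mathbf 1\otimes_l\tau)\circ\iota_{A,I_l,B,I_l}=\mathbf 1$; (9) $(\tau\otimes_l\mathbf 1)\circ\iota_{I_l,A,I_l,B}=\mathbf 1$; (10) $(\mathbf 1\otimes_l\beta)\circ\beta=(\beta\otimes_l\mathbf 1)\circ\beta$; (11) $(\mathbf 1\otimes_l\kappa)\circ\beta=\mathbf 1$; (12) $(\kappa\otimes_l\mathbf 1)\circ\beta=\mathbf 1$; and (b) writing $\kappa,\kappa',\kappa''$ for $\kappa_{1,2},\kappa_{2,3},\kappa_{1,3}$ and similarly for $\beta,\tau,\iota$ (unspecified components of $\iota$ are the evident ones): (13) $\kappa'\circ\kappa=\kappa''$; (14) $\beta'\circ\kappa=(\kappa\otimes_3\kappa)\circ\beta''$; (15) $\tau'\circ(\kappa''\otimes_2\kappa'')\circ\beta=\kappa''$; (16)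 $\iota'\circ(\beta''\otimes_2\beta'')\circ\beta=(\beta\otimes_3\beta)\circ\beta''$; (17) $\kappa'\circ\tau=\tau''\circ(\kappa'\otimes_1\kappa')$; (18) $\beta'\circ\tau=(\tau\otimes_3\tau)\circ\iota''\circ(\beta'\otimes_1\beta')$; (19) $\tau'\circ(\tau''\otimes_2\tau'')\circ\iota=\tau''\circ(\tau'\otimes_1\tau')$; (20) $\iota'\circ(\iota''\otimes_2\iota'')\circ\iota=(\iota\otimes_3\iota)\circ\iota''\circ(\iota'\otimes_1\iota')$, as arrows from $((A\otimes_3B)\otimes_2(C\otimes_3D))\otimes_1((E\otimes_3F)\otimes_2(G\otimes_3H))$ to $((A\otimes_1E)\otimes_2(C\otimes_1G))\otimes_3((B\otimes_1F)\otimes_2(D\otimes_1H))$. **The category $\Delta^{op}$.** $\Delta$ is the simplicial category of nonempty finite ordinals, with objects written $0,1,2,\dots$ (geometric dimension). In $\Delta^{op}$, $d^n_i:n\to n-1$ ($n\ge1$, $0\le i\le n$) and $s^n_i:n-1\to n$ ($n\ge1$, $0\le i\le n-1$) are the opposites of the standard coface and codegeneracy maps. The arrows $\mathbf 1_n,d^n_i,s^n_i$ are called basic. Every arrow $f$ has a unique representation $f^{\rm nf}$ (its normal form) of the form $\mathbf 1$ or $s_{l_1}\circ\dots\circ s_{l_k}\circ d_{j_1}\circ\dots\circ d_{j_m}$ (superscripts omitted) with $k+m\ge1$, $l_1>\dots>l_k$ and $j_1\ge\dots\ge j_m$. **Reduced bar construction.** For a strict monoidal category $(\mathcal C,\otimes,I)$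 it is the functor $\overline W\mathcal C:\Delta^{op}\to Cat$ with $\overline W\mathcal C(n)=\mathcal C^n$; $\overline W\mathcal C(d^n_0)$ and $\overline W\mathcal C(d^n_n)$ delete the first, respectively last, coordinate; for $1\le i\le n-1$, $\overline W\mathcal C(d^n_i)(A_1,\dots,A_n)=(A_1,\dots,A_i\otimes A_{i+1},\dots,A_n)$; and $\overline W\mathcal C(s^n_j)(A_1,\dots,A_{n-1})=(A_1,\dots,A_j,I,A_{j+1},\dots,A_{n-1})$. $\overline W\mathcal M_i^p$ denotes the reduced bar construction of $\mathcal M^p$ with the componentwise structure given by $\otimes_i,I_i$ (its value at $n$ is $\mathcal M^{n\cdot p}=(\mathcal M^p)^n$, i.e. $n$ blocks of length $p$), and $\overline W\mathcal M_i=\overline W\mathcal M^1_i$. For a functor $F$, $(F)^o$ is its $o$-fold product with itself. The three-fold reduced bar construction is $\overline W\mathcal M(n,m,p)=\mathcal M^{n\cdot m\cdot p}$ on objects of $(\Delta^{op})^3$ and $\overline W\mathcal M(f,g,h)=(\overline W\mathcal M_3(h))^{n_tm_t}\circ(\overline W\mathcal M_2^{p_s}(g))^{n_t}\circ\overline W\mathcal M_1^{m_sp_s}(f)$ for $f:n_s\to n_t$, $g:m_s\to m_t$, $h:p_s\to p_t$. It preserves identities. **Shuffles.** A sequence $\Phi$ of colour $k$ is $(f_r,k)\dots(f_1,k)$ with $f_i$ basic and $f_r\circ\dots\circ f_1$ defined; $\circ\Phi$ denotes the word $f_r\circ\dots\circ f_1$. Identity members may be freely inserted or deleted (so a sequence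 may have no non-identity members, but it always has a definite source and target). Let $\Theta$ be a shuffle of sequences $\Phi,\Gamma,\mathrm H$ of colours $1,2,3$. For a member $(f,k)$ of $\Theta$ and a colour $l\neq k$, let $t_l$ be the target of the closest member of colour $l$ to its right (if there is none, the source of the composite of the sequence of colour $l$). The inner power of $(f,k)$ is $\prod_{k<l\le3}t_l$ and its outer power is $\prod_{1\le l<k}t_l$ (empty products are 1). The functor $\overline W\mathcal M_\Theta$ is the composite, in the order of $\Theta$ (rightmost applied first), of the functors $(\overline W\mathcal M_k^{i}(f))^{o}$ for the members $(f,k)$ with inner power $i$ and outer power $o$. One has $\overline W\mathcal M_{\mathrm H\Gamma\Phi}=\overline W\mathcal M(f,g,h)$ when $f,g,h$ are the composites of $\Phi,\Gamma,\mathrm H$. **The transformations $\chi$.** For basic $f:n\to n'$, $g:m\to m'$, $1\le k<l\le3$, $u,v,w\ge0$, $$\chi^{k,l}_{u,v,w}(f,g):(\overline W\mathcal M_k^{vm'w}(f))^u\circ(\overline W\mathcal M_l^w(g))^{unv}\to(\overline W\mathcal M_l^w(g))^{un'v}\circ(\overline W\mathcal M_k^{vmw}(f))^u$$ is described coordinatewise, with the coordinates of $\mathcal M^{un'vm'w}$ indexed lexicographically by $(x,r,y,q,z)$, $1\le x\le u$, $1\le r\le n'$, $1\le y\le v$, $1\le q\le m'$, $1\le z\le w$. It is the identity except when $f$ is $s^{n+1}_j$ or $d^n_j$ with $1\le j\le n-1$, and $g$ is $s^{m+1}_i$ or $d^m_i$ with $1\le i\le m-1$. In these cases all coordinates are identities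 except those with $r=j+1$ (if $f=s^{n+1}_j$) or $r=j$ (if $f=d^n_j$) and $q=i+1$ (if $g=s^{m+1}_i$) or $q=i$ (if $g=d^m_i$), where the arrow is: $\kappa_{k,l}$ for $(f,g)=(s,s)$; $\tau_{k,l}$ for $(d,s)$; $\beta_{k,l}$ for $(s,d)$; and, for $(d,d)$, $\iota^{k,l}$ at $(A_{x,j,y,i,z},A_{x,j,y,i+1,z},A_{x,j+1,y,i,z},A_{x,j+1,y,i+1,z})$. Put $\chi^{1,2}_w=\chi^{1,2}_{1,1,w}$, $\chi^{2,3}_u=\chi^{2,3}_{u,1,1}$, $\chi^{1,3}_v=\chi^{1,3}_{1,v,1}$. **Normalizing paths, $\varphi_\Theta$ and $\omega$.** A normalizing path starting with $\Theta$ is a list $\Theta_0,\dots,\Theta_j$ ($j\ge0$) of shuffles of $\Phi,\Gamma,\mathrm H$ with $\Theta_0=\Theta$, $\Theta_j=\mathrm H\Gamma\Phi$ and, for each $0\le i\le j-1$, $\Theta_i=\Pi(f,k)(g,l)\Lambda$ and $\Theta_{i+1}=\Pi(g,l)(f,k)\Lambda$ for some $k<l$ and non-identity members $(f,k),(g,l)$. Put $\varphi_i=\overline W\mathcal M_\Pi\;\chi^{k,l}_{q}(f,g)\;\overline W\mathcal M_\Lambda:\overline W\mathcal M_{\Theta_i}\to\overline W\mathcal M_{\Theta_{i+1}}$ (whiskering), where $\overline W\mathcal M_\Pi,\overline W\mathcal M_\Lambda$ are the parts of the composite $\overline W\mathcal M_{\Theta_i}$ coming from $\Pi,\Lambda$,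 and $q$ is the target of the leftmost member of $\Lambda$ of the third colour (the one different from $k,l$), after adding an identity if needed. Let $\varphi(\Theta_0,\dots,\Theta_j)=\varphi_{j-1}\circ\dots\circ\varphi_0$ (the identity if $j=0$); this is independent of the normalizing path starting with $\Theta$ and is denoted $\varphi_\Theta:\overline W\mathcal M_\Theta\to\overline W\mathcal M_{\mathrm H\Gamma\Phi}$. For a composable pair $e_1=(f_1,g_1,h_1)$, $e_2=(f_2,g_2,h_2)$ of arrows of $(\Delta^{op})^3$, let $\Phi_i,\Gamma_i,\mathrm H_i$ be the sequences of colours $1,2,3$ with $\circ\Phi_i$, $\circ\Gamma_i$, $\circ\mathrm H_i$ equal to $f_i^{\rm nf},g_i^{\rm nf},h_i^{\rm nf}$, and define $\omega_{e_2,e_1}=\varphi_{\mathrm H_2\Gamma_2\Phi_2\mathrm H_1\Gamma_1\Phi_1}:\overline W\mathcal M(e_2)\circ\overline W\mathcal M(e_1)\to\overline W\mathcal M(e_2\circ e_1)$. *)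

theory Defs
  imports Main "HOL-Library.FuncSet"
begin

section \<open>Categories, functors, natural transformations\<close>

record ('o, 'a) cat =
  Obj :: "'o set"
  Arr :: "'a set"
  Dom :: "'a \<Rightarrow> 'o"
  Cod :: "'a \<Rightarrow> 'o"
  Ide :: "'o \<Rightarrow> 'a"
  Cmp :: "'a \<Rightarrow> 'a \<Rightarrow> 'a"  \<comment> \<open>\<open>Cmp C g f\<close> is \<open>g\<close> after \<open>f\<close>; meaningful only if \<open>Dom C g = Cod C f\<close>\<close>

locale category =
  fixes C :: "('o, 'a, 'z) cat_scheme"
  assumes Dom_Obj: "f \<in> Arr C \<Longrightarrow> Dom C f \<in> Obj C"
    and Cod_Obj: "f \<in> Arr C \<Longrightarrow> Cod C f \<in> Obj C"
    and Ide_Arr: "x \<in> Obj C \<Longrightarrow> Ide C x \<in> Arr C"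
    and Dom_Ide: "x \<in> Obj C \<Longrightarrow> Dom C (Ide C x) = x"
    and Cod_Ide: "x \<in> Obj C \<Longrightarrow> Cod C (Ide C x) = x"
    and Cmp_Arr: "\<lbrakk>f \<in> Arr C; g \<in> Arr C; Dom C g = Cod C f\<rbrakk> \<Longrightarrow> Cmp C g f \<in> Arr C"
    and Dom_Cmp: "\<lbrakk>f \<in> Arr C; g \<in> Arr C; Dom C g = Cod C f\<rbrakk> \<Longrightarrow> Dom C (Cmp C g f) = Dom C f"
    and Cod_Cmp: "\<lbrakk>f \<in> Arr C; g \<in> Arr C; Dom C g = Cod C f\<rbrakk> \<Longrightarrow> Cod C (Cmp C g f) = Cod C g"
    and Cmp_Ide_right: "f \<in> Arr C \<Longrightarrow> Cmp C f (Ide C (Dom C f)) = f"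
    and Cmp_Ide_left: "f \<in> Arr C \<Longrightarrow> Cmp C (Ide C (Cod C f)) f = f"
    and Cmp_assoc: "\<lbrakk>f \<in> Arr C; g \<in> Arr C; h \<in> Arr C; Dom C g = Cod C f; Dom C h = Cod C g\<rbrakk>
      \<Longrightarrow> Cmp C h (Cmp C g f) = Cmp C (Cmp C h g) f"

locale cat_functor = C: category C + D: category D
  for C :: "('o, 'a, 'y) cat_scheme" and D :: "('p, 'b, 'z) cat_scheme" +
  fixes Fo :: "'o \<Rightarrow> 'p" and Fa :: "'a \<Rightarrow> 'b"
  assumes Fo_Obj: "x \<in> Obj C \<Longrightarrow> Fo x \<in> Obj D"
    and Fa_Arr: "f \<in> Arr C \<Longrightarrow> Fa f \<in> Arr D"
    and Fa_Dom: "f \<in> Arr C \<Longrightarrow> Dom D (Fa f) = Fo (Dom C f)"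
    and Fa_Cod: "f \<in> Arr C \<Longrightarrow> Cod D (Fa f) = Fo (Cod C f)"
    and Fa_Ide: "x \<in> Obj C \<Longrightarrow> Fa (Ide C x) = Ide D (Fo x)"
    and Fa_Cmp: "\<lbrakk>f \<in> Arr C; g \<in> Arr C; Dom C g = Cod C f\<rbrakk>
      \<Longrightarrow> Fa (Cmp C g f) = Cmp D (Fa g) (Fa f)"

locale nat_transformation =
  F: cat_functor C D Fo Fa + G: cat_functor C D Go Ga
  for C :: "('o, 'a, 'y) cat_scheme" and D :: "('p, 'b, 'z) cat_scheme"
    and Fo Fa Go Ga +
  fixes \<eta> :: "'o \<Rightarrow> 'b"
  assumes eta_Arr: "x \<in> Obj C \<Longrightarrow> \<eta> x \<in> Arr D"
    and eta_Dom: "x \<in> Obj C \<Longrightarrow> Dom D (\<eta> x) = Fo x"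
    and eta_Cod: "x \<in> Obj C \<Longrightarrow> Cod D (\<eta> x) = Go x"
    and naturality: "f \<in> Arr C \<Longrightarrow>
      Cmp D (\<eta> (Cod C f)) (Fa f) = Cmp D (Ga f) (\<eta> (Dom C f))"

definition prod_cat ::
  "('o, 'a, 'y) cat_scheme \<Rightarrow> ('p, 'b, 'z) cat_scheme \<Rightarrow> ('o \<times> 'p, 'a \<times> 'b) cat" where
  "prod_cat C D = \<lparr>Obj = Obj C \<times> Obj D, Arr = Arr C \<times> Arr D,
     Dom = map_prod (Dom C) (Dom D), Cod = map_prod (Cod C) (Cod D),
     Ide = map_prod (Ide C) (Ide D),
     Cmp = (\<lambda>(g, g') (f, f'). (Cmp C g f, Cmp D g' f'))\<rparr>"

definition pow_cat :: "('o, 'a, 'z) cat_scheme \<Rightarrow> nat \<Rightarrow> ('o list, 'a list) cat" where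
  "pow_cat C n = \<lparr>Obj = {xs. length xs = n \<and> set xs \<subseteq> Obj C},
     Arr = {fs. length fs = n \<and> set fs \<subseteq> Arr C},
     Dom = map (Dom C), Cod = map (Cod C), Ide = map (Ide C), Cmp = map2 (Cmp C)\<rparr>"

text \<open>
  A lax functor from a category \<open>J\<close> to \<open>Cat\<close> that preserves identities on the nose, so that
  the unit constraints are identities. \<open>FO\<close> is the action on objects, \<open>Fo e\<close> and \<open>Fa e\<close>
  are the object and arrow parts of the functor assigned to \<open>e\<close>, and \<open>\<omega> e\<^sub>2 e\<^sub>1\<close> is the
  comparison transformation from \<open>F e\<^sub>2 \<circ> F e\<^sub>1\<close> to \<open>F (e\<^sub>2 \<circ> e\<^sub>1)\<close>.
\<close>

locale lax_functor = J: category J for J :: "('j, 'e, 'y) cat_scheme" +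
  fixes FO :: "'j \<Rightarrow> ('o, 'a) cat"
    and Fo :: "'e \<Rightarrow> 'o \<Rightarrow> 'o" and Fa :: "'e \<Rightarrow> 'a \<Rightarrow> 'a"
    and \<omega> :: "'e \<Rightarrow> 'e \<Rightarrow> 'o \<Rightarrow> 'a"
  assumes F_functor: "e \<in> Arr J \<Longrightarrow> cat_functor (FO (Dom J e)) (FO (Cod J e)) (Fo e) (Fa e)"
    and Fo_Ide: "\<lbrakk>x \<in> Obj J; A \<in> Obj (FO x)\<rbrakk> \<Longrightarrow> Fo (Ide J x) A = A"
    and Fa_Ide: "\<lbrakk>x \<in> Obj J; f \<in> Arr (FO x)\<rbrakk> \<Longrightarrow> Fa (Ide J x) f = f"
    and \<omega>_nat: "\<lbrakk>e\<^sub>1 \<in> Arr J; e\<^sub>2 \<in> Arr J; Dom J e\<^sub>2 = Cod J e\<^sub>1\<rbrakk> \<Longrightarrow>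
      nat_transformation (FO (Dom J e\<^sub>1)) (FO (Cod J e\<^sub>2))
        (Fo e\<^sub>2 \<circ> Fo e\<^sub>1) (Fa e\<^sub>2 \<circ> Fa e\<^sub>1)
        (Fo (Cmp J e\<^sub>2 e\<^sub>1)) (Fa (Cmp J e\<^sub>2 e\<^sub>1)) (\<omega> e\<^sub>2 e\<^sub>1)"
    and \<omega>_unit_right: "\<lbrakk>e \<in> Arr J; A \<in> Obj (FO (Dom J e))\<rbrakk> \<Longrightarrow>
      \<omega> e (Ide J (Dom J e)) A = Ide (FO (Cod J e)) (Fo e A)"
    and \<omega>_unit_left: "\<lbrakk>e \<in> Arr J; A \<in> Obj (FO (Dom J e))\<rbrakk> \<Longrightarrow>
      \<omega> (Ide J (Cod J e)) e A = Ide (FO (Cod J e)) (Fo e A)"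
    and \<omega>_assoc: "\<lbrakk>e\<^sub>1 \<in> Arr J; e\<^sub>2 \<in> Arr J; e\<^sub>3 \<in> Arr J;
        Dom J e\<^sub>2 = Cod J e\<^sub>1; Dom J e\<^sub>3 = Cod J e\<^sub>2; A \<in> Obj (FO (Dom J e\<^sub>1))\<rbrakk> \<Longrightarrow>
      Cmp (FO (Cod J e\<^sub>3)) (\<omega> (Cmp J e\<^sub>3 e\<^sub>2) e\<^sub>1 A) (\<omega> e\<^sub>3 e\<^sub>2 (Fo e\<^sub>1 A)) =
      Cmp (FO (Cod J e\<^sub>3)) (\<omega> e\<^sub>3 (Cmp J e\<^sub>2 e\<^sub>1) A) (Fa e\<^sub>3 (\<omega> e\<^sub>2 e\<^sub>1 A))"


section \<open>Three-fold strict monoidal categories\<close>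

locale strict_monoidal_category = category C for C :: "('o, 'a, 'z) cat_scheme" +
  fixes to :: "'o \<Rightarrow> 'o \<Rightarrow> 'o" and ta :: "'a \<Rightarrow> 'a \<Rightarrow> 'a" and I :: 'o
  assumes to_Obj: "\<lbrakk>A \<in> Obj C; B \<in> Obj C\<rbrakk> \<Longrightarrow> to A B \<in> Obj C"
    and ta_Arr: "\<lbrakk>f \<in> Arr C; g \<in> Arr C\<rbrakk> \<Longrightarrow> ta f g \<in> Arr C"
    and ta_Dom: "\<lbrakk>f \<in> Arr C; g \<in> Arr C\<rbrakk> \<Longrightarrow> Dom C (ta f g) = to (Dom C f) (Dom C g)"
    and ta_Cod: "\<lbrakk>f \<in> Arr C; g \<in> Arr C\<rbrakk> \<Longrightarrow> Cod C (ta f g) = to (Cod C f) (Cod C g)"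
    and ta_Ide: "\<lbrakk>A \<in> Obj C; B \<in> Obj C\<rbrakk> \<Longrightarrow> ta (Ide C A) (Ide C B) = Ide C (to A B)"
    and ta_Cmp: "\<lbrakk>f \<in> Arr C; f' \<in> Arr C; g \<in> Arr C; g' \<in> Arr C;
        Dom C f' = Cod C f; Dom C g' = Cod C g\<rbrakk> \<Longrightarrow>
      ta (Cmp C f' f) (Cmp C g' g) = Cmp C (ta f' g') (ta f g)"
    and I_Obj: "I \<in> Obj C"
    and to_assoc: "\<lbrakk>A \<in> Obj C; B \<in> Obj C; D \<in> Obj C\<rbrakk> \<Longrightarrow> to (to A B) D = to A (to B D)"
    and to_unit_left: "A \<in> Obj C \<Longrightarrow> to I A = A"
    and to_unit_right: "A \<in> Obj C \<Longrightarrow> to A I = A"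
    and ta_assoc: "\<lbrakk>f \<in> Arr C; g \<in> Arr C; h \<in> Arr C\<rbrakk> \<Longrightarrow> ta (ta f g) h = ta f (ta g h)"
    and ta_unit_left: "f \<in> Arr C \<Longrightarrow> ta (Ide C I) f = f"
    and ta_unit_right: "f \<in> Arr C \<Longrightarrow> ta f (Ide C I) = f"

text \<open>
  The first argument of type \<^typ>\<open>nat\<close> is the index \<open>k\<close> of the structure, the second, where
  present, is \<open>l\<close>; only \<open>1 \<le> k \<le> 3\<close>, respectively \<open>1 \<le> k < l \<le> 3\<close>, matter.
\<close>

record ('o, 'a) threefold = "('o, 'a) cat" +
  TensO :: "nat \<Rightarrow> 'o \<Rightarrow> 'o \<Rightarrow> 'o"
  TensA :: "nat \<Rightarrow> 'a \<Rightarrow> 'a \<Rightarrow> 'a"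
  Unit :: "nat \<Rightarrow> 'o"
  Kappa :: "nat \<Rightarrow> nat \<Rightarrow> 'a"
  Beta :: "nat \<Rightarrow> nat \<Rightarrow> 'a"
  Tau :: "nat \<Rightarrow> nat \<Rightarrow> 'a"
  Iota :: "nat \<Rightarrow> nat \<Rightarrow> 'o \<Rightarrow> 'o \<Rightarrow> 'o \<Rightarrow> 'o \<Rightarrow> 'a"

locale threefold_data =
  fixes M :: "('o, 'a, 'z) threefold_scheme"
begin

abbreviation ob where "ob \<equiv> Obj M"
abbreviation hom where "hom A B \<equiv> {f \<in> Arr M. Dom M f = A \<and> Cod M f = B}"
abbreviation cmp (infixr "\<cdot>" 55) where "g \<cdot> f \<equiv> Cmp M g f"
abbreviation ide ("\<one>") where "\<one> \<equiv> Ide M"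
abbreviation tensO ("_ \<odot>\<^bsub>_\<^esub> _" [71, 0, 71] 70) where "A \<odot>\<^bsub>k\<^esub> B \<equiv> TensO M k A B"
abbreviation tensA ("_ \<otimes>\<^bsub>_\<^esub> _" [71, 0, 71] 70) where "f \<otimes>\<^bsub>k\<^esub> g \<equiv> TensA M k f g"
abbreviation I where "I \<equiv> Unit M"
abbreviation \<kappa> where "\<kappa> \<equiv> Kappa M"
abbreviation \<beta> where "\<beta> \<equiv> Beta M"
abbreviation \<tau> where "\<tau> \<equiv> Tau M"
abbreviation \<iota> where "\<iota> \<equiv> Iota M"

end

locale threefold_strict_monoidal_category = threefold_data M + category M
  for M :: "('o, 'a, 'z) threefold_scheme" +
  assumes strict_monoidal:
      "\<lbrakk>1 \<le> k; k \<le> 3\<rbrakk> \<Longrightarrow> strict_monoidal_category M (TensO M k) (TensA M k) (Unit M k)"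
    and kappa_hom: "\<lbrakk>1 \<le> k; k < l; l \<le> 3\<rbrakk> \<Longrightarrow> \<kappa> k l \<in> hom (I k) (I l)"
    and beta_hom: "\<lbrakk>1 \<le> k; k < l; l \<le> 3\<rbrakk> \<Longrightarrow> \<beta> k l \<in> hom (I k) (I k \<odot>\<^bsub>l\<^esub> I k)"
    and tau_hom: "\<lbrakk>1 \<le> k; k < l; l \<le> 3\<rbrakk> \<Longrightarrow> \<tau> k l \<in> hom (I l \<odot>\<^bsub>k\<^esub> I l) (I l)"
    and iota_hom: "\<lbrakk>1 \<le> k; k < l; l \<le> 3; A \<in> ob; B \<in> ob; C \<in> ob; D \<in> ob\<rbrakk> \<Longrightarrow>
      \<iota> k l A B C D \<in> hom ((A \<odot>\<^bsub>l\<^esub> B) \<odot>\<^bsub>k\<^esub> (C \<odot>\<^bsub>l\<^esub> D)) ((A \<odot>\<^bsub>k\<^esub> C) \<odot>\<^bsub>l\<^esub> (B \<odot>\<^bsub>k\<^esub> D))"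
    and iota_natural: "\<lbrakk>1 \<le> k; k < l; l \<le> 3;
        f \<in> hom A A'; g \<in> hom B B'; h \<in> hom C C'; j \<in> hom D D'\<rbrakk> \<Longrightarrow>
      \<iota> k l A' B' C' D' \<cdot> ((f \<otimes>\<^bsub>l\<^esub> g) \<otimes>\<^bsub>k\<^esub> (h \<otimes>\<^bsub>l\<^esub> j)) =
      ((f \<otimes>\<^bsub>k\<^esub> h) \<otimes>\<^bsub>l\<^esub> (g \<otimes>\<^bsub>k\<^esub> j)) \<cdot> \<iota> k l A B C D"
    \<comment> \<open>conditions on each pair \<open>k < l\<close>\<close>
    and ax1: "\<lbrakk>1 \<le> k; k < l; l \<le> 3;
        A \<in> ob; B \<in> ob; C \<in> ob; D \<in> ob; E \<in> ob; F \<in> ob\<rbrakk> \<Longrightarrow>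
      \<iota> k l A D (B \<odot>\<^bsub>k\<^esub> C) (E \<odot>\<^bsub>k\<^esub> F) \<cdot> (\<one> (A \<odot>\<^bsub>l\<^esub> D) \<otimes>\<^bsub>k\<^esub> \<iota> k l B E C F) =
      \<iota> k l (A \<odot>\<^bsub>k\<^esub> B) (D \<odot>\<^bsub>k\<^esub> E) C F \<cdot> (\<iota> k l A D B E \<otimes>\<^bsub>k\<^esub> \<one> (C \<odot>\<^bsub>l\<^esub> F))"
    and ax2: "\<lbrakk>1 \<le> k; k < l; l \<le> 3; A \<in> ob; B \<in> ob\<rbrakk> \<Longrightarrow>
      \<iota> k l A B (I k) (I k) \<cdot> (\<one> (A \<odot>\<^bsub>l\<^esub> B) \<otimes>\<^bsub>k\<^esub> \<beta> k l) = \<one> (A \<odot>\<^bsub>l\<^esub> B)"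
    and ax3: "\<lbrakk>1 \<le> k; k < l; l \<le> 3; A \<in> ob; B \<in> ob\<rbrakk> \<Longrightarrow>
      \<iota> k l (I k) (I k) A B \<cdot> (\<beta> k l \<otimes>\<^bsub>k\<^esub> \<one> (A \<odot>\<^bsub>l\<^esub> B)) = \<one> (A \<odot>\<^bsub>l\<^esub> B)"
    and ax4: "\<lbrakk>1 \<le> k; k < l; l \<le> 3\<rbrakk> \<Longrightarrow>
      \<tau> k l \<cdot> (\<one> (I l) \<otimes>\<^bsub>k\<^esub> \<tau> k l) = \<tau> k l \<cdot> (\<tau> k l \<otimes>\<^bsub>k\<^esub> \<one> (I l))"
    and ax5: "\<lbrakk>1 \<le> k; k < l; l \<le> 3\<rbrakk> \<Longrightarrow> \<tau> k l \<cdot> (\<one> (I l) \<otimes>\<^bsub>k\<^esub> \<kappa> k l) = \<one> (I l)"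
    and ax6: "\<lbrakk>1 \<le> k; k < l; l \<le> 3\<rbrakk> \<Longrightarrow> \<tau> k l \<cdot> (\<kappa> k l \<otimes>\<^bsub>k\<^esub> \<one> (I l)) = \<one> (I l)"
    and ax7: "\<lbrakk>1 \<le> k; k < l; l \<le> 3;
        A \<in> ob; B \<in> ob; C \<in> ob; D \<in> ob; E \<in> ob; F \<in> ob\<rbrakk> \<Longrightarrow>
      (\<one> (A \<odot>\<^bsub>k\<^esub> D) \<otimes>\<^bsub>l\<^esub> \<iota> k l B C E F) \<cdot> \<iota> k l A (B \<odot>\<^bsub>l\<^esub> C) D (E \<odot>\<^bsub>l\<^esub> F) =
      (\<iota> k l A B D E \<otimes>\<^bsub>l\<^esub> \<one> (C \<odot>\<^bsub>k\<^esub> F)) \<cdot> \<iota> k l (A \<odot>\<^bsub>l\<^esub> B) C (D \<odot>\<^bsub>l\<^esub> E) F"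
    and ax8: "\<lbrakk>1 \<le> k; k < l; l \<le> 3; A \<in> ob; B \<in> ob\<rbrakk> \<Longrightarrow>
      (\<one> (A \<odot>\<^bsub>k\<^esub> B) \<otimes>\<^bsub>l\<^esub> \<tau> k l) \<cdot> \<iota> k l A (I l) B (I l) = \<one> (A \<odot>\<^bsub>k\<^esub> B)"
    and ax9: "\<lbrakk>1 \<le> k; k < l; l \<le> 3; A \<in> ob; B \<in> ob\<rbrakk> \<Longrightarrow>
      (\<tau> k l \<otimes>\<^bsub>l\<^esub> \<one> (A \<odot>\<^bsub>k\<^esub> B)) \<cdot> \<iota> k l (I l) A (I l) B = \<one> (A \<odot>\<^bsub>k\<^esub> B)"
    and ax10: "\<lbrakk>1 \<le> k; k < l; l \<le> 3\<rbrakk> \<Longrightarrow>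
      (\<one> (I k) \<otimes>\<^bsub>l\<^esub> \<beta> k l) \<cdot> \<beta> k l = (\<beta> k l \<otimes>\<^bsub>l\<^esub> \<one> (I k)) \<cdot> \<beta> k l"
    and ax11: "\<lbrakk>1 \<le> k; k < l; l \<le> 3\<rbrakk> \<Longrightarrow> (\<one> (I k) \<otimes>\<^bsub>l\<^esub> \<kappa> k l) \<cdot> \<beta> k l = \<one> (I k)"
    and ax12: "\<lbrakk>1 \<le> k; k < l; l \<le> 3\<rbrakk> \<Longrightarrow> (\<kappa> k l \<otimes>\<^bsub>l\<^esub> \<one> (I k)) \<cdot> \<beta> k l = \<one> (I k)"
    \<comment> \<open>conditions relating the three pairs\<close>
    and ax13: "\<kappa> 2 3 \<cdot> \<kappa> 1 2 = \<kappa> 1 3"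
    and ax14: "\<beta> 2 3 \<cdot> \<kappa> 1 2 = (\<kappa> 1 2 \<otimes>\<^bsub>3\<^esub> \<kappa> 1 2) \<cdot> \<beta> 1 3"
    and ax15: "\<tau> 2 3 \<cdot> (\<kappa> 1 3 \<otimes>\<^bsub>2\<^esub> \<kappa> 1 3) \<cdot> \<beta> 1 2 = \<kappa> 1 3"
    and ax16: "\<iota> 2 3 (I 1) (I 1) (I 1) (I 1) \<cdot> (\<beta> 1 3 \<otimes>\<^bsub>2\<^esub> \<beta> 1 3) \<cdot> \<beta> 1 2 =
      (\<beta> 1 2 \<otimes>\<^bsub>3\<^esub> \<beta> 1 2) \<cdot> \<beta> 1 3"
    and ax17: "\<kappa> 2 3 \<cdot> \<tau> 1 2 = \<tau> 1 3 \<cdot> (\<kappa> 2 3 \<otimes>\<^bsub>1\<^esub> \<kappa> 2 3)"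
    and ax18: "\<beta> 2 3 \<cdot> \<tau> 1 2 =
      (\<tau> 1 2 \<otimes>\<^bsub>3\<^esub> \<tau> 1 2) \<cdot> \<iota> 1 3 (I 2) (I 2) (I 2) (I 2) \<cdot> (\<beta> 2 3 \<otimes>\<^bsub>1\<^esub> \<beta> 2 3)"
    and ax19: "\<tau> 2 3 \<cdot> (\<tau> 1 3 \<otimes>\<^bsub>2\<^esub> \<tau> 1 3) \<cdot> \<iota> 1 2 (I 3) (I 3) (I 3) (I 3) =
      \<tau> 1 3 \<cdot> (\<tau> 2 3 \<otimes>\<^bsub>1\<^esub> \<tau> 2 3)"
    and ax20: "\<lbrakk>A \<in> ob; B \<in> ob; C \<in> ob; D \<in> ob; E \<in> ob; F \<in> ob; G \<in> ob; H \<in> ob\<rbrakk> \<Longrightarrow>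
      \<iota> 2 3 (A \<odot>\<^bsub>1\<^esub> E) (B \<odot>\<^bsub>1\<^esub> F) (C \<odot>\<^bsub>1\<^esub> G) (D \<odot>\<^bsub>1\<^esub> H)
        \<cdot> (\<iota> 1 3 A B E F \<otimes>\<^bsub>2\<^esub> \<iota> 1 3 C D G H)
        \<cdot> \<iota> 1 2 (A \<odot>\<^bsub>3\<^esub> B) (C \<odot>\<^bsub>3\<^esub> D) (E \<odot>\<^bsub>3\<^esub> F) (G \<odot>\<^bsub>3\<^esub> H) =
      (\<iota> 1 2 A C E G \<otimes>\<^bsub>3\<^esub> \<iota> 1 2 B D F H)
        \<cdot> \<iota> 1 3 (A \<odot>\<^bsub>2\<^esub> C) (B \<odot>\<^bsub>2\<^esub> D) (E \<odot>\<^bsub>2\<^esub> G) (F \<odot>\<^bsub>2\<^esub> H)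
        \<cdot> (\<iota> 2 3 A B C D \<otimes>\<^bsub>1\<^esub> \<iota> 2 3 E F G H)"


section \<open>The opposite of the simplicial category\<close>

text \<open>
  The object \<open>n\<close> is the ordinal \<open>{..n}\<close>. An arrow \<open>n \<rightarrow> m\<close> of \<open>\<Delta>\<^sup>o\<^sup>p\<close> is a monotone map
  \<open>{..m} \<rightarrow> {..n}\<close>, kept with its source and target and made extensional.
\<close>

datatype dop = Dop (dsrc: nat) (dtgt: nat) (dmap: "nat \<Rightarrow> nat")

definition delta_op :: "(nat, dop) cat" where
  "delta_op = \<lparr>Obj = UNIV,
     Arr = {f. dmap f \<in> {..dtgt f} \<rightarrow>\<^sub>E {..dsrc f} \<and> mono_on {..dtgt f} (dmap f)},
     Dom = dsrc, Cod = dtgt,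
     Ide = (\<lambda>n. Dop n n (\<lambda>x\<in>{..n}. x)),
     Cmp = (\<lambda>g f. Dop (dsrc f) (dtgt g) (compose {..dtgt g} (dmap f) (dmap g)))\<rparr>"

definition delta_op3 :: "(nat \<times> nat \<times> nat, dop \<times> dop \<times> dop) cat" where
  "delta_op3 = prod_cat delta_op (prod_cat delta_op delta_op)"

text \<open>
  Names of the basic arrows: \<open>Id1 n\<close> is \<open>\<one>\<^sub>n\<close>, \<open>Fc n i\<close> is \<open>d\<^sup>n\<^sub>i : n \<rightarrow> n - 1\<close> and
  \<open>Dg n i\<close> is \<open>s\<^sup>n\<^sub>i : n - 1 \<rightarrow> n\<close>. Distinct valid names denote distinct arrows.
\<close>

datatype basic = Id1 nat | Fc nat nat | Dg nat nat

fun valid_basic :: "basic \<Rightarrow> bool" where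
  "valid_basic (Id1 n) \<longleftrightarrow> True"
| "valid_basic (Fc n i) \<longleftrightarrow> 1 \<le> n \<and> i \<le> n"
| "valid_basic (Dg n i) \<longleftrightarrow> 1 \<le> n \<and> i \<le> n - 1"

fun bsrc :: "basic \<Rightarrow> nat" where
  "bsrc (Id1 n) = n"
| "bsrc (Fc n i) = n"
| "bsrc (Dg n i) = n - 1"

fun btgt :: "basic \<Rightarrow> nat" where
  "btgt (Id1 n) = n"
| "btgt (Fc n i) = n - 1"
| "btgt (Dg n i) = n"

fun barr :: "basic \<Rightarrow> dop" where
  "barr (Id1 n) = Ide delta_op n"
| "barr (Fc n i) = Dop n (n - 1) (\<lambda>x\<in>{..n - 1}. if x < i then x else x + 1)"
| "barr (Dg n i) = Dop (n - 1) n (\<lambda>x\<in>{..n}. if x \<le> i then x else x - 1)"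

text \<open>Words are nonempty lists, written as composites: the head is applied last.\<close>

fun is_word :: "basic list \<Rightarrow> bool" where
  "is_word [] \<longleftrightarrow> False"
| "is_word [b] \<longleftrightarrow> valid_basic b"
| "is_word (c # b # w) \<longleftrightarrow> valid_basic c \<and> bsrc c = btgt b \<and> is_word (b # w)"

definition word_arr :: "basic list \<Rightarrow> dop" where
  "word_arr w = foldr (\<lambda>b f. Cmp delta_op (barr b) f) (butlast w) (barr (last w))"

definition is_nf :: "basic list \<Rightarrow> bool" where
  "is_nf w \<longleftrightarrow> (\<exists>n. w = [Id1 n]) \<or>
     is_word w \<and>
     (\<exists>ss ds. w = map (case_prod Dg) ss @ map (case_prod Fc) ds \<and>
        sorted_wrt (>) (map snd ss) \<and> sorted_wrt (\<ge>) (map snd ds))"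

definition nf :: "dop \<Rightarrow> basic list" where
  "nf f = (THE w. is_nf w \<and> word_arr w = f)"


section \<open>The reduced bar construction\<close>

text \<open>
  The functors below act in the same way on objects and on arrows, so they are defined for any
  type of coordinates with a binary operation \<open>t\<close> and a unit \<open>e\<close>; the object part uses
  the tensor of objects and \<open>I\<close>, the arrow part the tensor of arrows and \<open>\<one>\<^sub>I\<close>.
\<close>

fun wbar :: "('x \<Rightarrow> 'x \<Rightarrow> 'x) \<Rightarrow> 'x \<Rightarrow> basic \<Rightarrow> 'x list \<Rightarrow> 'x list" where
  "wbar t e (Id1 n) xs = xs"
| "wbar t e (Fc n i) xs =
     (if i = 0 then tl xs
      else if i = n then butlast xs
      else take (i - 1) xs @ [t (xs ! (i - 1)) (xs ! i)] @ drop (i + 1) xs)"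
| "wbar t e (Dg n j) xs = take j xs @ [e] @ drop j xs"

text \<open>
  \<open>wbar_pow t e p w\<close> is the value of the reduced bar construction of the \<open>p\<close>-th power at
  the composite of the word \<open>w\<close>, and \<open>wbar_pows t e p r w\<close> its \<open>r\<close>-fold product with itself.
  Iterated powers are flattened: an element of \<open>(M\<^sup>p)\<^sup>n\<close> is a list of length \<open>n * p\<close>.
\<close>

definition blocks :: "nat \<Rightarrow> nat \<Rightarrow> 'x list \<Rightarrow> 'x list list" where
  "blocks n p xs = map (\<lambda>i. take p (drop (i * p) xs)) [0..<n]"

definition wbar_pow ::
  "('x \<Rightarrow> 'x \<Rightarrow> 'x) \<Rightarrow> 'x \<Rightarrow> nat \<Rightarrow> basic list \<Rightarrow> 'x list \<Rightarrow> 'x list" where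
  "wbar_pow t e p w xs =
     concat (foldr (wbar (map2 t) (replicate p e)) w (blocks (bsrc (last w)) p xs))"

definition wbar_pows ::
  "('x \<Rightarrow> 'x \<Rightarrow> 'x) \<Rightarrow> 'x \<Rightarrow> nat \<Rightarrow> nat \<Rightarrow> basic list \<Rightarrow> 'x list \<Rightarrow> 'x list" where
  "wbar_pows t e p r w xs = concat (map (wbar_pow t e p w) (blocks r (bsrc (last w) * p) xs))"

fun wbar3 ::
  "(nat \<Rightarrow> 'x \<Rightarrow> 'x \<Rightarrow> 'x) \<Rightarrow> (nat \<Rightarrow> 'x) \<Rightarrow> dop \<times> dop \<times> dop \<Rightarrow> 'x list \<Rightarrow> 'x list" where
  "wbar3 t e (f, g, h) =
     wbar_pows (t 3) (e 3) 1 (dtgt f * dtgt g) (nf h)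
     \<circ> wbar_pows (t 2) (e 2) (dsrc h) (dtgt f) (nf g)
     \<circ> wbar_pow (t 1) (e 1) (dsrc g * dsrc h) (nf f)"

definition W_cat ::
  "('o, 'a, 'z) threefold_scheme \<Rightarrow> nat \<times> nat \<times> nat \<Rightarrow> ('o list, 'a list) cat" where
  "W_cat M = (\<lambda>(n, m, p). pow_cat M (n * m * p))"

definition W_obj ::
  "('o, 'a, 'z) threefold_scheme \<Rightarrow> dop \<times> dop \<times> dop \<Rightarrow> 'o list \<Rightarrow> 'o list" where
  "W_obj M = wbar3 (TensO M) (Unit M)"

definition W_arr ::
  "('o, 'a, 'z) threefold_scheme \<Rightarrow> dop \<times> dop \<times> dop \<Rightarrow> 'a list \<Rightarrow> 'a list" where
  "W_arr M = wbar3 (TensA M) (\<lambda>k. Ide M (Unit M k))"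


section \<open>Shuffles\<close>

text \<open>
  Since identity members may be freely inserted and deleted, a shuffle is represented by the list
  of its non-identity members (the head is applied last) together with the sources \<open>src l\<close> of
  its sequences of colour \<open>l\<close>, which the list no longer determines. Then \<open>target_at src \<Lambda> l\<close> is
  the target of the leftmost member of colour \<open>l\<close> in \<open>\<Lambda>\<close>, or \<open>src l\<close> if there is none.
\<close>

type_synonym shuffle = "(basic \<times> nat) list"

fun target_at :: "(nat \<Rightarrow> nat) \<Rightarrow> shuffle \<Rightarrow> nat \<Rightarrow> nat" where
  "target_at src [] l = src l"
| "target_at src ((b, k) # \<Lambda>) l = (if k = l then btgt b else target_at src \<Lambda> l)"

fun wbar_shuffle ::
  "(nat \<Rightarrow> 'x \<Rightarrow> 'x \<Rightarrow> 'x) \<Rightarrow> (nat \<Rightarrow> 'x) \<Rightarrow> (nat \<Rightarrow> nat) \<Rightarrow> shuffle \<Rightarrow> 'x list \<Rightarrow> 'x list" where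
  "wbar_shuffle t e src [] xs = xs"
| "wbar_shuffle t e src ((b, k) # \<Lambda>) xs =
     wbar_pows (t k) (e k) (\<Prod>l\<in>{k<..3}. target_at src \<Lambda> l) (\<Prod>l\<in>{1..<k}. target_at src \<Lambda> l) [b]
       (wbar_shuffle t e src \<Lambda> xs)"

definition WS_obj ::
  "('o, 'a, 'z) threefold_scheme \<Rightarrow> (nat \<Rightarrow> nat) \<Rightarrow> shuffle \<Rightarrow> 'o list \<Rightarrow> 'o list" where
  "WS_obj M = wbar_shuffle (TensO M) (Unit M)"

definition WS_arr ::
  "('o, 'a, 'z) threefold_scheme \<Rightarrow> (nat \<Rightarrow> nat) \<Rightarrow> shuffle \<Rightarrow> 'a list \<Rightarrow> 'a list" where
  "WS_arr M = wbar_shuffle (TensA M) (\<lambda>k. Ide M (Unit M k))"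


section \<open>The transformations\<close>

text \<open>
  The coordinate at which a basic arrow creates a unit or a tensor product, if any. The bounds
  \<open>1 \<le> j \<le> n - 1\<close> concern faces only; every degeneracy creates a unit.
\<close>

fun pivot :: "basic \<Rightarrow> nat option" where
  "pivot (Id1 n) = None"
| "pivot (Fc n j) = (if 1 \<le> j \<and> j \<le> n - 1 then Some j else None)"
| "pivot (Dg n j) = Some (j + 1)"

text \<open>
  The list position (from 0) of the coordinate \<open>(x, r, y, q, z)\<close> (from 1), where
  \<open>r \<le> n\<close>, \<open>y \<le> v\<close>, \<open>q \<le> m\<close>, \<open>z \<le> w\<close>, in lexicographic order.
\<close>

definition position ::
  "nat \<Rightarrow> nat \<Rightarrow> nat \<Rightarrow> nat \<Rightarrow> nat \<Rightarrow> nat \<Rightarrow> nat \<Rightarrow> nat \<Rightarrow> nat \<Rightarrow> nat" where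
  "position n v m w x r y q z = ((((x - 1) * n + (r - 1)) * v + (y - 1)) * m + (q - 1)) * w + (z - 1)"

definition is_Dg :: "basic \<Rightarrow> bool" where
  "is_Dg b \<longleftrightarrow> (\<exists>n j. b = Dg n j)"

definition chi ::
  "('o, 'a, 'z) threefold_scheme \<Rightarrow> nat \<Rightarrow> nat \<Rightarrow> nat \<Rightarrow> nat \<Rightarrow> nat \<Rightarrow> basic \<Rightarrow> basic
    \<Rightarrow> 'o list \<Rightarrow> 'a list" where
  "chi M k l u v w f g As =
    (let n = bsrc f; n' = btgt f; m = bsrc g; m' = btgt g;
         A = (\<lambda>x r y q z. As ! position n v m w x r y q z);
         S = wbar_pows (TensO M k) (Unit M k) (v * m' * w) u [f]
               (wbar_pows (TensO M l) (Unit M l) w (u * n * v) [g] As)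
     in [ if pivot f = Some r \<and> pivot g = Some q
          then (if is_Dg f
                then (if is_Dg g then Kappa M k l else Beta M k l)
                else (if is_Dg g then Tau M k l
                      else Iota M k l (A x r y q z) (A x r y (q + 1) z)
                             (A x (r + 1) y q z) (A x (r + 1) y (q + 1) z)))
          else Ide M (S ! position n' v m' w x r y q z).
          x \<leftarrow> [1..<u + 1], r \<leftarrow> [1..<n' + 1], y \<leftarrow> [1..<v + 1], q \<leftarrow> [1..<m' + 1],
          z \<leftarrow> [1..<w + 1] ])"

text \<open>\<open>chi1 M k l q\<close> puts \<open>q\<close> in the position belonging to the third colour.\<close>

definition chi1 ::
  "('o, 'a, 'z) threefold_scheme \<Rightarrow> nat \<Rightarrow> nat \<Rightarrow> nat \<Rightarrow> basic \<Rightarrow> basic \<Rightarrow> 'o list \<Rightarrow> 'a list" where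
  "chi1 M k l q =
    (if (k, l) = (1, 2) then chi M k l 1 1 q
     else if (k, l) = (2, 3) then chi M k l q 1 1
     else chi M k l 1 q 1)"

definition swap_step :: "shuffle \<Rightarrow> shuffle \<Rightarrow> bool" where
  "swap_step \<Theta> \<Theta>' \<longleftrightarrow> (\<exists>\<Xi> f k g l \<Lambda>. k < l \<and>
     \<Theta> = \<Xi> @ [(f, k), (g, l)] @ \<Lambda> \<and> \<Theta>' = \<Xi> @ [(g, l), (f, k)] @ \<Lambda>)"

definition sorted_shuffle :: "shuffle \<Rightarrow> shuffle" where
  "sorted_shuffle \<Theta> = filter (\<lambda>(b, k). k = 3) \<Theta> @ filter (\<lambda>(b, k). k = 2) \<Theta>
     @ filter (\<lambda>(b, k). k = 1) \<Theta>"

text \<open>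
  A swap preserves the subsequence of each colour, so all entries of such a list are shuffles of
  the same three sequences.
\<close>

definition normalizing_path :: "shuffle \<Rightarrow> shuffle list \<Rightarrow> bool" where
  "normalizing_path \<Theta> P \<longleftrightarrow> P \<noteq> [] \<and> hd P = \<Theta> \<and> last P = sorted_shuffle \<Theta> \<and>
     (\<forall>i < length P - 1. swap_step (P ! i) (P ! Suc i))"

text \<open>
  The members swapped in a step have different colours, so the step takes place at the leftmost
  position where the two shuffles differ.
\<close>

definition phi_step ::
  "('o, 'a, 'z) threefold_scheme \<Rightarrow> (nat \<Rightarrow> nat) \<Rightarrow> shuffle \<Rightarrow> shuffle \<Rightarrow> 'o list \<Rightarrow> 'a list" where
  "phi_step M src \<Theta> \<Theta>' A =
    (let i = (LEAST i. \<Theta> ! i \<noteq> \<Theta>' ! i);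
         \<Xi> = take i \<Theta>; (f, k) = \<Theta> ! i; (g, l) = \<Theta> ! Suc i; \<Lambda> = drop (i + 2) \<Theta>
     in WS_arr M (target_at src ((f, k) # (g, l) # \<Lambda>)) \<Xi>
          (chi1 M k l (target_at src \<Lambda> (6 - k - l)) f g (WS_obj M src \<Lambda> A)))"

fun phi_path ::
  "('o, 'a, 'z) threefold_scheme \<Rightarrow> (nat \<Rightarrow> nat) \<Rightarrow> shuffle list \<Rightarrow> 'o list \<Rightarrow> 'a list" where
  "phi_path M src [] A = []"  \<comment> \<open>irrelevant: paths are nonempty\<close>
| "phi_path M src [\<Theta>] A = map (Ide M) (WS_obj M src \<Theta> A)"
| "phi_path M src (\<Theta> # \<Theta>' # P) A =
     map2 (Cmp M) (phi_path M src (\<Theta>' # P) A) (phi_step M src \<Theta> \<Theta>' A)"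

text \<open>The value does not depend on the normalizing path, so an arbitrary one is chosen.\<close>

definition phi ::
  "('o, 'a, 'z) threefold_scheme \<Rightarrow> (nat \<Rightarrow> nat) \<Rightarrow> shuffle \<Rightarrow> 'o list \<Rightarrow> 'a list" where
  "phi M src \<Theta> = phi_path M src (SOME P. normalizing_path \<Theta> P)"

definition nf_seq :: "nat \<Rightarrow> dop \<Rightarrow> shuffle" where
  "nf_seq k f = map (\<lambda>b. (b, k)) (filter (\<lambda>b. \<forall>n. b \<noteq> Id1 n) (nf f))"

fun nf_shuffle :: "dop \<times> dop \<times> dop \<Rightarrow> shuffle" where
  "nf_shuffle (f, g, h) = nf_seq 3 h @ nf_seq 2 g @ nf_seq 1 f"

fun sources :: "dop \<times> dop \<times> dop \<Rightarrow> nat \<Rightarrow> nat" where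
  "sources (f, g, h) l = (if l = 1 then dsrc f else if l = 2 then dsrc g else dsrc h)"

definition omega ::
  "('o, 'a, 'z) threefold_scheme \<Rightarrow> dop \<times> dop \<times> dop \<Rightarrow> dop \<times> dop \<times> dop \<Rightarrow> 'o list \<Rightarrow> 'a list" where
  "omega M e\<^sub>2 e\<^sub>1 = phi M (sources e\<^sub>1) (nf_shuffle e\<^sub>2 @ nf_shuffle e\<^sub>1)"

end

theory Submission
  imports Defs
begin

text \<open>
  An arrow \<open>n \<rightarrow> m\<close> of \<open>\<Delta>\<^sup>o\<^sup>p\<close>, read as a monotone map, cuts a sequence of length \<open>n\<close> into \<open>m\<close> consecutive
  blocks, and the reduced bar construction tensors each block. The structure maps of \<open>M\<close> extend to
  interchange maps from a \<open>k\<close>-product of \<open>l\<close>-products of a finite matrix of objects to the \<open>l\<close>-product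
  of the \<open>k\<close>-products. Conditions (1)--(12) make them compatible with concatenation in both
  directions, and (13)--(20), which are the \<open>2 \<times> 2 \<times> 2\<close> choices of a nullary or binary product in each
  direction, give the Yang--Baxter equation for three-dimensional matrices by induction. Applied to
  blocks, the interchange maps are distributive laws between three strict actions of the monoid of
  monotone maps; these combine into a lax functor whose comparison maps do not refer to words.

  A lax functor assigns to every sequence of composable arrows a canonical map from the composite of
  the values to the value of the composite. For the sequence of basic arrows of a shuffle, lax
  associativity shows that a swap splits off exactly one whiskered \<open>\<chi>\<close>, and for a sorted shuffle the
  canonical map is an identity. So every normalizing path composes to the canonical map, and for two
  normal forms that map is the comparison map.
\<close>

section \<open>Iterated tensor products and their interchange\<close>

text \<open>Two features of the definitions resist a direct calculation. The composite of two normal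
  forms is rarely a normal form, so \<open>omega\<close> at a composite arrow and
  \<open>omega\<close> at its factors belong to unrelated words; and \<open>phi\<close> uses an
  arbitrary path. Both lose their weight once each list of letters has a map that depends on its
  bracketing only up to lax associativity: then a word matters only through its product in a monoid.
  For this product to live in a monoid the sizes have to go. A monotone map is continued by a
  translation above its target, a list becomes a total array, and the sizes survive only in the
  relation \<open>lists_array\<close>. The three actions are combined one after the other. Two
  strict actions with a distributive law combine to an action that is only lax, so the construction
  has to accept a lax action in its first place; Yang--Baxter is the condition for applying it
  again. Since the combined action applies colour 1 first and colour 3 last, colours in descending
  order need no interchange.\<close>

definition tfold :: "('x \<Rightarrow> 'x \<Rightarrow> 'x) \<Rightarrow> 'x \<Rightarrow> 'i list \<Rightarrow> ('i \<Rightarrow> 'x) \<Rightarrow> 'x" where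
  "tfold t e J A = foldr (\<lambda>i. t (A i)) J e"

lemma tfold_Nil [simp]: "tfold t e [] A = e"
  and tfold_Cons [simp]: "tfold t e (j # J) A = t (A j) (tfold t e J A)"
  by (simp_all add: tfold_def)

text \<open>Relative to a carrier because it is used for very different monoids: objects and arrows
  of a strict monoidal category, lists of a fixed length under the coordinatewise operation, and
  monotone maps under composition.\<close>

locale monoid_on =
  fixes S :: "'x set" and t :: "'x \<Rightarrow> 'x \<Rightarrow> 'x" and e :: 'x
  assumes closed: "\<lbrakk>x \<in> S; y \<in> S\<rbrakk> \<Longrightarrow> t x y \<in> S"
    and unit_closed: "e \<in> S"
    and assoc: "\<lbrakk>x \<in> S; y \<in> S; z \<in> S\<rbrakk> \<Longrightarrow> t (t x y) z = t x (t y z)"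
    and left_unit: "x \<in> S \<Longrightarrow> t e x = x"
    and right_unit: "x \<in> S \<Longrightarrow> t x e = x"
begin

lemma tfold_closed: "(\<And>j. j \<in> set J \<Longrightarrow> A j \<in> S) \<Longrightarrow> tfold t e J A \<in> S"
  by (induction J) (auto simp: closed unit_closed)

lemma tfold_append:
  "(\<And>j. j \<in> set (J @ K) \<Longrightarrow> A j \<in> S) \<Longrightarrow> tfold t e (J @ K) A = t (tfold t e J A) (tfold t e K A)"
  by (induction J) (auto simp: left_unit assoc tfold_closed)

lemma tfold_concat:
  "(\<And>i j. \<lbrakk>i \<in> set J; j \<in> set (F i)\<rbrakk> \<Longrightarrow> A j \<in> S) \<Longrightarrow>
    tfold t e (concat (map F J)) A = tfold t e J (\<lambda>i. tfold t e (F i) A)"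
proof (induction J)
  case (Cons i J)
  have "A j \<in> S" if "j \<in> set (F i @ concat (map F J))" for j
    using that Cons.prems[of _ j] by auto
  then have "tfold t e (F i @ concat (map F J)) A =
      t (tfold t e (F i) A) (tfold t e (concat (map F J)) A)"
    by (rule tfold_append)
  moreover have "tfold t e (concat (map F J)) A = tfold t e J (\<lambda>i. tfold t e (F i) A)"
    using Cons.prems by (intro Cons.IH) (metis list.set_intros(2))
  ultimately show ?case
    by simp
qed simp

end

lemma tfold_cong:
  "(\<And>j. j \<in> set J \<Longrightarrow> A j = B j) \<Longrightarrow> tfold t e J A = tfold t e J B"
  by (induction J) auto

context category
begin

abbreviation after (infixr "\<cdot>" 55) where "g \<cdot> f \<equiv> Cmp C g f"
abbreviation identity ("\<one>") where "\<one> \<equiv> Ide C"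

declare Dom_Obj [simp] Cod_Obj [simp] Ide_Arr [simp] Dom_Ide [simp] Cod_Ide [simp]
  Cmp_Arr [simp] Dom_Cmp [simp] Cod_Cmp [simp]

lemma Cmp_Ide_right' [simp]: "\<lbrakk>f \<in> Arr C; Dom C f = A\<rbrakk> \<Longrightarrow> Cmp C f (Ide C A) = f"
  using Cmp_Ide_right by blast

lemma Cmp_Ide_left' [simp]: "\<lbrakk>f \<in> Arr C; Cod C f = A\<rbrakk> \<Longrightarrow> Cmp C (Ide C A) f = f"
  using Cmp_Ide_left by blast

lemma Cmp_assoc' [simp]:
  "\<lbrakk>f \<in> Arr C; g \<in> Arr C; h \<in> Arr C; Dom C g = Cod C f; Dom C h = Cod C g\<rbrakk>
    \<Longrightarrow> Cmp C (Cmp C h g) f = Cmp C h (Cmp C g f)"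
  using Cmp_assoc by metis

text \<open>Lets an equation between composites be used at the head of a longer composite.\<close>

lemma Cmp_extend:
  "\<lbrakk>Cmp C h g = Cmp C h' g'; f \<in> Arr C; g \<in> Arr C; h \<in> Arr C; Dom C g = Cod C f; Dom C h = Cod C g;
    g' \<in> Arr C; h' \<in> Arr C; Cod C f = Dom C g'; Dom C h' = Cod C g'\<rbrakk>
    \<Longrightarrow> Cmp C h (Cmp C g f) = Cmp C h' (Cmp C g' f)"
  using Cmp_assoc by metis

end

context strict_monoidal_category
begin

declare to_Obj [simp] ta_Arr [simp] ta_Dom [simp] ta_Cod [simp] ta_Ide [simp] I_Obj [simp]
  to_assoc [simp] to_unit_left [simp] to_unit_right [simp] ta_assoc [simp]
  ta_unit_left [simp] ta_unit_right [simp]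

sublocale objects: monoid_on "Obj C" to I
  by unfold_locales auto

sublocale arrows: monoid_on "Arr C" ta "Ide C I"
  by unfold_locales auto

abbreviation TO :: "'i list \<Rightarrow> ('i \<Rightarrow> 'o) \<Rightarrow> 'o" where "TO \<equiv> tfold to I"
abbreviation TA :: "'i list \<Rightarrow> ('i \<Rightarrow> 'a) \<Rightarrow> 'a" where "TA \<equiv> tfold ta (Ide C I)"

lemma interchange [simp]:
  "\<lbrakk>f \<in> Arr C; f' \<in> Arr C; g \<in> Arr C; g' \<in> Arr C; Dom C f' = Cod C f; Dom C g' = Cod C g\<rbrakk>
    \<Longrightarrow> Cmp C (ta f' g') (ta f g) = ta (Cmp C f' f) (Cmp C g' g)"
  by (simp add: ta_Cmp)

text \<open>Composites are kept nested to the right, so an equation between binary composites is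
  also needed in front of a further factor \<open>x\<close>.\<close>

lemma interchange_extend [simp]:
  "\<lbrakk>f \<in> Arr C; f' \<in> Arr C; g \<in> Arr C; g' \<in> Arr C; Dom C f' = Cod C f; Dom C g' = Cod C g;
    x \<in> Arr C; Cod C x = to (Dom C f) (Dom C g)\<rbrakk>
    \<Longrightarrow> Cmp C (ta f' g') (Cmp C (ta f g) x) = Cmp C (ta (Cmp C f' f) (Cmp C g' g)) x"
  by (subst Cmp_assoc) (simp_all del: Cmp_assoc')

lemma TO_Obj [simp]: "(\<And>j. A j \<in> Obj C) \<Longrightarrow> TO J A \<in> Obj C"
  by (simp add: objects.tfold_closed)

lemma TA_Arr [simp]: "(\<And>j. f j \<in> Arr C) \<Longrightarrow> TA J f \<in> Arr C"
  by (simp add: arrows.tfold_closed)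

lemma TA_Dom [simp]: "(\<And>j. f j \<in> Arr C) \<Longrightarrow> Dom C (TA J f) = TO J (\<lambda>j. Dom C (f j))"
  by (induction J) auto

lemma TA_Cod [simp]: "(\<And>j. f j \<in> Arr C) \<Longrightarrow> Cod C (TA J f) = TO J (\<lambda>j. Cod C (f j))"
  by (induction J) auto

lemma TA_Ide [simp]: "(\<And>j. A j \<in> Obj C) \<Longrightarrow> TA J (\<lambda>j. Ide C (A j)) = Ide C (TO J A)"
  by (induction J) auto

lemma TA_Cmp [simp]:
  "\<lbrakk>\<And>j. f j \<in> Arr C; \<And>j. g j \<in> Arr C; \<And>j. Dom C (g j) = Cod C (f j)\<rbrakk>
    \<Longrightarrow> Cmp C (TA J g) (TA J f) = TA J (\<lambda>j. Cmp C (g j) (f j))"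
  by (induction J) auto

lemma TA_Cmp_extend [simp]:
  "\<lbrakk>\<And>j. f j \<in> Arr C; \<And>j. g j \<in> Arr C; \<And>j. Dom C (g j) = Cod C (f j);
    x \<in> Arr C; Cod C x = TO J (\<lambda>j. Dom C (f j))\<rbrakk>
    \<Longrightarrow> Cmp C (TA J g) (Cmp C (TA J f) x) = Cmp C (TA J (\<lambda>j. Cmp C (g j) (f j))) x"
  by (subst Cmp_assoc) (simp_all del: Cmp_assoc')

end

text \<open>The conditions on one pair k < l, freed from the indices: \<open>\<odot>\<close> is the
  k-product and \<open>\<boxdot>\<close> the l-product.\<close>

locale twofold =
  K: strict_monoidal_category C tO tA Ik + L: strict_monoidal_category C sO sA Il
  for C :: "('o, 'a, 'z) cat_scheme"
    and tO (infixr "\<odot>" 70) and tA (infixr "\<otimes>" 70) and Ik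
    and sO (infixr "\<boxdot>" 70) and sA (infixr "\<boxtimes>" 70) and Il +
  fixes \<kappa> \<beta> \<tau> :: 'a and \<iota> :: "'o \<Rightarrow> 'o \<Rightarrow> 'o \<Rightarrow> 'o \<Rightarrow> 'a"
  assumes kappa [simp]: "\<kappa> \<in> Arr C" "Dom C \<kappa> = Ik" "Cod C \<kappa> = Il"
    and beta [simp]: "\<beta> \<in> Arr C" "Dom C \<beta> = Ik" "Cod C \<beta> = Ik \<boxdot> Ik"
    and tau [simp]: "\<tau> \<in> Arr C" "Dom C \<tau> = Il \<odot> Il" "Cod C \<tau> = Il"
    and iota_Arr [simp]: "\<lbrakk>P \<in> Obj C; Q \<in> Obj C; R \<in> Obj C; S \<in> Obj C\<rbrakk> \<Longrightarrow> \<iota> P Q R S \<in> Arr C"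
    and iota_Dom [simp]: "\<lbrakk>P \<in> Obj C; Q \<in> Obj C; R \<in> Obj C; S \<in> Obj C\<rbrakk> \<Longrightarrow>
      Dom C (\<iota> P Q R S) = (P \<boxdot> Q) \<odot> (R \<boxdot> S)"
    and iota_Cod [simp]: "\<lbrakk>P \<in> Obj C; Q \<in> Obj C; R \<in> Obj C; S \<in> Obj C\<rbrakk> \<Longrightarrow>
      Cod C (\<iota> P Q R S) = (P \<odot> R) \<boxdot> (Q \<odot> S)"
    and iota_natural: "\<lbrakk>f \<in> Arr C; g \<in> Arr C; h \<in> Arr C; j \<in> Arr C\<rbrakk> \<Longrightarrow>
      Cmp C (\<iota> (Cod C f) (Cod C g) (Cod C h) (Cod C j)) ((f \<boxtimes> g) \<otimes> (h \<boxtimes> j)) =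
      Cmp C ((f \<otimes> h) \<boxtimes> (g \<otimes> j)) (\<iota> (Dom C f) (Dom C g) (Dom C h) (Dom C j))"
    and a1: "\<lbrakk>P \<in> Obj C; Q \<in> Obj C; R \<in> Obj C; S \<in> Obj C; E \<in> Obj C; F \<in> Obj C\<rbrakk> \<Longrightarrow>
      Cmp C (\<iota> P S (Q \<odot> R) (E \<odot> F)) (Ide C (P \<boxdot> S) \<otimes> \<iota> Q E R F) =
      Cmp C (\<iota> (P \<odot> Q) (S \<odot> E) R F) (\<iota> P S Q E \<otimes> Ide C (R \<boxdot> F))"
    and a2: "\<lbrakk>P \<in> Obj C; Q \<in> Obj C\<rbrakk> \<Longrightarrow>
      Cmp C (\<iota> P Q Ik Ik) (Ide C (P \<boxdot> Q) \<otimes> \<beta>) = Ide C (P \<boxdot> Q)"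
    and a3: "\<lbrakk>P \<in> Obj C; Q \<in> Obj C\<rbrakk> \<Longrightarrow>
      Cmp C (\<iota> Ik Ik P Q) (\<beta> \<otimes> Ide C (P \<boxdot> Q)) = Ide C (P \<boxdot> Q)"
    and a4: "Cmp C \<tau> (Ide C Il \<otimes> \<tau>) = Cmp C \<tau> (\<tau> \<otimes> Ide C Il)"
    and a5: "Cmp C \<tau> (Ide C Il \<otimes> \<kappa>) = Ide C Il"
    and a6: "Cmp C \<tau> (\<kappa> \<otimes> Ide C Il) = Ide C Il"
    and a7: "\<lbrakk>P \<in> Obj C; Q \<in> Obj C; R \<in> Obj C; S \<in> Obj C; E \<in> Obj C; F \<in> Obj C\<rbrakk> \<Longrightarrow>
      Cmp C (Ide C (P \<odot> S) \<boxtimes> \<iota> Q R E F) (\<iota> P (Q \<boxdot> R) S (E \<boxdot> F)) =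
      Cmp C (\<iota> P Q S E \<boxtimes> Ide C (R \<odot> F)) (\<iota> (P \<boxdot> Q) R (S \<boxdot> E) F)"
    and a8: "\<lbrakk>P \<in> Obj C; Q \<in> Obj C\<rbrakk> \<Longrightarrow>
      Cmp C (Ide C (P \<odot> Q) \<boxtimes> \<tau>) (\<iota> P Il Q Il) = Ide C (P \<odot> Q)"
    and a9: "\<lbrakk>P \<in> Obj C; Q \<in> Obj C\<rbrakk> \<Longrightarrow>
      Cmp C (\<tau> \<boxtimes> Ide C (P \<odot> Q)) (\<iota> Il P Il Q) = Ide C (P \<odot> Q)"
    and a10: "Cmp C (Ide C Ik \<boxtimes> \<beta>) \<beta> = Cmp C (\<beta> \<boxtimes> Ide C Ik) \<beta>"
    and a11: "Cmp C (Ide C Ik \<boxtimes> \<kappa>) \<beta> = Ide C Ik"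
    and a12: "Cmp C (\<kappa> \<boxtimes> Ide C Ik) \<beta> = Ide C Ik"
begin

text \<open>The codomains are variables tied by equations, so that the rule still matches where
  \<open>Cod C f\<close> has been evaluated.\<close>

lemma iota_nat:
  "\<lbrakk>f \<in> Arr C; g \<in> Arr C; h \<in> Arr C; j \<in> Arr C;
    Cod C f = P; Cod C g = Q; Cod C h = R; Cod C j = S\<rbrakk> \<Longrightarrow>
    \<iota> P Q R S \<cdot> ((f \<boxtimes> g) \<otimes> (h \<boxtimes> j)) =
    ((f \<otimes> h) \<boxtimes> (g \<otimes> j)) \<cdot> \<iota> (Dom C f) (Dom C g) (Dom C h) (Dom C j)"
  using iota_natural by blast

lemma iota_nat_extend:
  "\<lbrakk>f \<in> Arr C; g \<in> Arr C; h \<in> Arr C; j \<in> Arr C;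
    Cod C f = P; Cod C g = Q; Cod C h = R; Cod C j = S;
    x \<in> Arr C; Cod C x = (Dom C f \<boxdot> Dom C g) \<odot> (Dom C h \<boxdot> Dom C j)\<rbrakk> \<Longrightarrow>
    \<iota> P Q R S \<cdot> ((f \<boxtimes> g) \<otimes> (h \<boxtimes> j)) \<cdot> x =
    ((f \<otimes> h) \<boxtimes> (g \<otimes> j)) \<cdot> \<iota> (Dom C f) (Dom C g) (Dom C h) (Dom C j) \<cdot> x"
  by (rule K.Cmp_extend[OF iota_nat]) auto

text \<open>\<open>\<tau>\<close> is the interchange without columns, since an empty l-product is
  \<open>Il\<close>; every further column costs one \<open>\<iota>\<close>. In the same way
  \<open>row0\<close> starts from \<open>\<kappa>\<close> and uses one \<open>\<beta>\<close> per
  column.\<close>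

fun row2 :: "'i list \<Rightarrow> ('i \<Rightarrow> 'o) \<Rightarrow> ('i \<Rightarrow> 'o) \<Rightarrow> 'a" where
  "row2 [] P Q = \<tau>"
| "row2 (j # J) P Q = (\<one> (P j \<odot> Q j) \<boxtimes> row2 J P Q) \<cdot> \<iota> (P j) (L.TO J P) (Q j) (L.TO J Q)"

fun row0 :: "'i list \<Rightarrow> 'a" where
  "row0 [] = \<kappa>"
| "row0 (j # J) = (\<one> Ik \<boxtimes> row0 J) \<cdot> \<beta>"

lemma row2_typ [simp]:
  assumes [simp]: "\<And>j. P j \<in> Obj C" "\<And>j. Q j \<in> Obj C"
  shows "row2 J P Q \<in> Arr C" "Dom C (row2 J P Q) = L.TO J P \<odot> L.TO J Q"
    "Cod C (row2 J P Q) = L.TO J (\<lambda>j. P j \<odot> Q j)"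
  by (induction J) auto

lemma row0_typ [simp]:
  shows "row0 J \<in> Arr C" "Dom C (row0 J) = Ik" "Cod C (row0 J) = L.TO J (\<lambda>j. Ik)"
  by (induction J) auto

lemma row2_natural:
  assumes [simp]: "\<And>j. f j \<in> Arr C" "\<And>j. g j \<in> Arr C"
    "\<And>j. Dom C (f j) = P j" "\<And>j. Dom C (g j) = Q j"
    "\<And>j. Cod C (f j) = P' j" "\<And>j. Cod C (g j) = Q' j"
  shows "row2 J P' Q' \<cdot> (L.TA J f \<otimes> L.TA J g) = L.TA J (\<lambda>j. f j \<otimes> g j) \<cdot> row2 J P Q"
proof -
  have [simp]: "P j \<in> Obj C" "Q j \<in> Obj C" "P' j \<in> Obj C" "Q' j \<in> Obj C" for j
    using assms K.Dom_Obj K.Cod_Obj by metis+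
  show ?thesis
  proof (induction J)
    case (Cons j J)
    have "row2 (j # J) P' Q' \<cdot> (L.TA (j # J) f \<otimes> L.TA (j # J) g) =
      (\<one> (P' j \<odot> Q' j) \<boxtimes> row2 J P' Q') \<cdot> ((f j \<otimes> g j) \<boxtimes> (L.TA J f \<otimes> L.TA J g))
        \<cdot> \<iota> (P j) (L.TO J P) (Q j) (L.TO J Q)"
      by (simp add: iota_nat)
    also have "\<dots> = ((f j \<otimes> g j) \<boxtimes> (L.TA J (\<lambda>j. f j \<otimes> g j) \<cdot> row2 J P Q))
        \<cdot> \<iota> (P j) (L.TO J P) (Q j) (L.TO J Q)"
      by (simp add: Cons)
    finally show ?case by simp
  qed simp
qed

text \<open>With the two unit laws below, this makes the l-product over \<open>J\<close> a lax
  monoidal functor for the k-product, with constraints \<open>row2\<close> and \<open>row0\<close>.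
  Without columns it is \<open>a4\<close>; for a further column, naturality of
  \<open>\<iota>\<close> brings its two occurrences together and \<open>a1\<close> exchanges
  them.\<close>

lemma row2_assoc:
  assumes [simp]: "\<And>j. P j \<in> Obj C" "\<And>j. Q j \<in> Obj C" "\<And>j. R j \<in> Obj C"
  shows "row2 J P (\<lambda>j. Q j \<odot> R j) \<cdot> (\<one> (L.TO J P) \<otimes> row2 J Q R) =
    row2 J (\<lambda>j. P j \<odot> Q j) R \<cdot> (row2 J P Q \<otimes> \<one> (L.TO J R))"
proof (induction J)
  case Nil
  show ?case by (simp add: a4)
next
  case (Cons j J)
  let ?p = "L.TO J P" and ?q = "L.TO J Q" and ?r = "L.TO J R"
  let ?I = "\<one> (P j \<odot> Q j \<odot> R j)"
  have "row2 (j # J) P (\<lambda>j. Q j \<odot> R j) \<cdot> (\<one> (L.TO (j # J) P) \<otimes> row2 (j # J) Q R) =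
    (?I \<boxtimes> row2 J P (\<lambda>j. Q j \<odot> R j)) \<cdot> \<iota> (P j) ?p (Q j \<odot> R j) (L.TO J (\<lambda>j. Q j \<odot> R j))
      \<cdot> ((\<one> (P j) \<boxtimes> \<one> ?p) \<otimes> (\<one> (Q j \<odot> R j) \<boxtimes> row2 J Q R)) \<cdot> (\<one> (P j \<boxdot> ?p) \<otimes> \<iota> (Q j) ?q (R j) ?r)"
    by simp
  also have "\<dots> = (?I \<boxtimes> (row2 J P (\<lambda>j. Q j \<odot> R j) \<cdot> (\<one> ?p \<otimes> row2 J Q R)))
      \<cdot> \<iota> (P j) ?p (Q j \<odot> R j) (?q \<odot> ?r) \<cdot> (\<one> (P j \<boxdot> ?p) \<otimes> \<iota> (Q j) ?q (R j) ?r)"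
    by (subst iota_nat_extend) simp_all
  also have "\<dots> = (?I \<boxtimes> (row2 J (\<lambda>j. P j \<odot> Q j) R \<cdot> (row2 J P Q \<otimes> \<one> ?r)))
      \<cdot> \<iota> (P j \<odot> Q j) (?p \<odot> ?q) (R j) ?r \<cdot> (\<iota> (P j) ?p (Q j) ?q \<otimes> \<one> (R j \<boxdot> ?r))"
    by (simp only: Cons a1 assms L.TO_Obj)
  also have "\<dots> = (?I \<boxtimes> row2 J (\<lambda>j. P j \<odot> Q j) R) \<cdot>
      \<iota> (P j \<odot> Q j) (L.TO J (\<lambda>j. P j \<odot> Q j)) (R j) ?r
      \<cdot> ((\<one> (P j \<odot> Q j) \<boxtimes> row2 J P Q) \<otimes> (\<one> (R j) \<boxtimes> \<one> ?r)) \<cdot> (\<iota> (P j) ?p (Q j) ?q \<otimes> \<one> (R j \<boxdot> ?r))"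
    by (subst iota_nat_extend) simp_all
  also have "\<dots> = row2 (j # J) (\<lambda>j. P j \<odot> Q j) R \<cdot> (row2 (j # J) P Q \<otimes> \<one> (L.TO (j # J) R))"
    by simp
  finally show ?case .
qed

text \<open>\<open>a6\<close> without columns and \<open>a3\<close> for each column; the mirror
  image uses \<open>a5\<close> and \<open>a2\<close>.\<close>

lemma row2_left_unit:
  assumes [simp]: "\<And>j. Q j \<in> Obj C"
  shows "row2 J (\<lambda>j. Ik) Q \<cdot> (row0 J \<otimes> \<one> (L.TO J Q)) = \<one> (L.TO J Q)"
proof (induction J)
  case Nil
  show ?case by (simp add: a6)
next
  case (Cons j J)
  have "row2 (j # J) (\<lambda>j. Ik) Q \<cdot> (row0 (j # J) \<otimes> \<one> (L.TO (j # J) Q)) =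
    (\<one> (Q j) \<boxtimes> row2 J (\<lambda>j. Ik) Q) \<cdot> \<iota> Ik (L.TO J (\<lambda>j. Ik)) (Q j) (L.TO J Q)
      \<cdot> ((\<one> Ik \<boxtimes> row0 J) \<otimes> (\<one> (Q j) \<boxtimes> \<one> (L.TO J Q))) \<cdot> (\<beta> \<otimes> \<one> (Q j \<boxdot> L.TO J Q))"
    by simp
  also have "\<dots> = (\<one> (Q j) \<boxtimes> (row2 J (\<lambda>j. Ik) Q \<cdot> (row0 J \<otimes> \<one> (L.TO J Q))))
      \<cdot> \<iota> Ik Ik (Q j) (L.TO J Q) \<cdot> (\<beta> \<otimes> \<one> (Q j \<boxdot> L.TO J Q))"
    by (subst iota_nat_extend) simp_all
  finally show ?case by (simp add: Cons a3)
qed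

lemma row2_right_unit:
  assumes [simp]: "\<And>j. Q j \<in> Obj C"
  shows "row2 J Q (\<lambda>j. Ik) \<cdot> (\<one> (L.TO J Q) \<otimes> row0 J) = \<one> (L.TO J Q)"
proof (induction J)
  case Nil
  show ?case by (simp add: a5)
next
  case (Cons j J)
  have "row2 (j # J) Q (\<lambda>j. Ik) \<cdot> (\<one> (L.TO (j # J) Q) \<otimes> row0 (j # J)) =
    (\<one> (Q j) \<boxtimes> row2 J Q (\<lambda>j. Ik)) \<cdot> \<iota> (Q j) (L.TO J Q) Ik (L.TO J (\<lambda>j. Ik))
      \<cdot> ((\<one> (Q j) \<boxtimes> \<one> (L.TO J Q)) \<otimes> (\<one> Ik \<boxtimes> row0 J)) \<cdot> (\<one> (Q j \<boxdot> L.TO J Q) \<otimes> \<beta>)"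
    by simp
  also have "\<dots> = (\<one> (Q j) \<boxtimes> (row2 J Q (\<lambda>j. Ik) \<cdot> (\<one> (L.TO J Q) \<otimes> row0 J)))
      \<cdot> \<iota> (Q j) (L.TO J Q) Ik Ik \<cdot> (\<one> (Q j \<boxdot> L.TO J Q) \<otimes> \<beta>)"
    by (subst iota_nat_extend) simp_all
  finally show ?case by (simp add: Cons a2)
qed

lemma row2_single:
  assumes [simp]: "\<And>j. P j \<in> Obj C" "\<And>j. Q j \<in> Obj C"
  shows "row2 [j] P Q = \<one> (P j \<odot> Q j)"
  by (simp add: a8)

lemma row0_single: "row0 [j] = \<one> Ik"
  by (simp add: a11)

text \<open>Compatibility in the direction of the columns: \<open>a9\<close> starts the induction
  and \<open>a7\<close> continues it. For \<open>row0\<close> these roles are played by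
  \<open>a12\<close> and \<open>a10\<close>.\<close>

lemma row2_append:
  assumes [simp]: "\<And>j. P j \<in> Obj C" "\<And>j. Q j \<in> Obj C"
  shows "row2 (J @ K) P Q =
    (row2 J P Q \<boxtimes> row2 K P Q) \<cdot> \<iota> (L.TO J P) (L.TO K P) (L.TO J Q) (L.TO K Q)"
proof (induction J)
  case Nil
  \<comment> \<open>The factor \<open>\<tau>\<close> is split off so that \<open>a9\<close> cancels
    it against \<open>\<iota>\<close>.\<close>
  have "(\<tau> \<boxtimes> row2 K P Q) \<cdot> \<iota> Il (L.TO K P) Il (L.TO K Q) =
    (\<one> Il \<boxtimes> row2 K P Q) \<cdot> (\<tau> \<boxtimes> \<one> (L.TO K P \<odot> L.TO K Q)) \<cdot> \<iota> Il (L.TO K P) Il (L.TO K Q)"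
    by (simp del: L.ta_unit_left)
  then show ?case by (simp add: a9 del: L.interchange_extend)
next
  case (Cons j J)
  let ?p = "L.TO J P" and ?q = "L.TO J Q" and ?p' = "L.TO K P" and ?q' = "L.TO K Q"
  have "row2 ((j # J) @ K) P Q = (\<one> (P j \<odot> Q j) \<boxtimes> (row2 J P Q \<boxtimes> row2 K P Q))
      \<cdot> (\<one> (P j \<odot> Q j) \<boxtimes> \<iota> ?p ?p' ?q ?q') \<cdot> \<iota> (P j) (?p \<boxdot> ?p') (Q j) (?q \<boxdot> ?q')"
    by (simp add: Cons L.objects.tfold_append)
  also have "\<dots> = ((\<one> (P j \<odot> Q j) \<boxtimes> row2 J P Q) \<boxtimes> row2 K P Q)
      \<cdot> (\<iota> (P j) ?p (Q j) ?q \<boxtimes> \<one> (?p' \<odot> ?q')) \<cdot> \<iota> (P j \<boxdot> ?p) ?p' (Q j \<boxdot> ?q) ?q'"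
    by (subst a7) (simp_all del: L.interchange L.interchange_extend)
  also have "\<dots> = (row2 (j # J) P Q \<boxtimes> row2 K P Q) \<cdot> \<iota> (P j \<boxdot> ?p) ?p' (Q j \<boxdot> ?q) ?q'"
    by (subst L.interchange_extend) simp_all
  finally show ?case by simp
qed

lemma row0_append: "row0 (J @ K) = (row0 J \<boxtimes> row0 K) \<cdot> \<beta>"
proof (induction J)
  case Nil
  have "(\<kappa> \<boxtimes> row0 K) \<cdot> \<beta> = (\<one> Il \<boxtimes> row0 K) \<cdot> (\<kappa> \<boxtimes> \<one> Ik) \<cdot> \<beta>"
    by (simp del: L.ta_unit_left)
  then show ?case by (simp add: a12 del: L.interchange_extend)
next
  case (Cons j J)
  have "row0 ((j # J) @ K) = (\<one> Ik \<boxtimes> (row0 J \<boxtimes> row0 K)) \<cdot> (\<one> Ik \<boxtimes> \<beta>) \<cdot> \<beta>"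
    by (simp add: Cons)
  also have "\<dots> = ((\<one> Ik \<boxtimes> row0 J) \<boxtimes> row0 K) \<cdot> (\<beta> \<boxtimes> \<one> Ik) \<cdot> \<beta>"
    by (simp add: a10 del: L.interchange L.interchange_extend)
  also have "\<dots> = (row0 (j # J) \<boxtimes> row0 K) \<cdot> \<beta>"
    by (subst L.interchange_extend) simp_all
  finally show ?case .
qed

lemma row2_concat:
  assumes [simp]: "\<And>j. P j \<in> Obj C" "\<And>j. Q j \<in> Obj C"
  shows "row2 (concat (map F J)) P Q =
    L.TA J (\<lambda>s. row2 (F s) P Q) \<cdot> row2 J (\<lambda>s. L.TO (F s) P) (\<lambda>s. L.TO (F s) Q)"
  by (induction J) (simp_all add: row2_append L.objects.tfold_concat)

lemma row0_concat: "row0 (concat (map F J)) = L.TA J (\<lambda>s. row0 (F s)) \<cdot> row0 J"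
  by (induction J) (simp_all add: row0_append)

text \<open>
  \<^term>\<open>mat I J P\<close> goes from the \<open>k\<close>-product over \<open>i\<close> of the \<open>l\<close>-products over \<open>j\<close> of \<open>P i j\<close> to the
  \<open>l\<close>-product over \<open>j\<close> of the \<open>k\<close>-products over \<open>i\<close>; \<^term>\<open>row2\<close> and \<^term>\<open>row0\<close> are its cases
  of two rows and of no row.
\<close>

fun mat :: "'h list \<Rightarrow> 'i list \<Rightarrow> ('h \<Rightarrow> 'i \<Rightarrow> 'o) \<Rightarrow> 'a" where
  "mat [] J P = row0 J"
| "mat (i # I) J P = row2 J (P i) (\<lambda>j. K.TO I (\<lambda>i. P i j)) \<cdot> (\<one> (L.TO J (P i)) \<otimes> mat I J P)"

lemma mat_typ [simp]:
  assumes [simp]: "\<And>i j. P i j \<in> Obj C"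
  shows "mat I J P \<in> Arr C" "Dom C (mat I J P) = K.TO I (\<lambda>i. L.TO J (P i))"
    "Cod C (mat I J P) = L.TO J (\<lambda>j. K.TO I (\<lambda>i. P i j))"
  by (induction I) auto

lemma mat_natural:
  assumes [simp]: "\<And>i j. f i j \<in> Arr C"
    "\<And>i j. Dom C (f i j) = P i j" "\<And>i j. Cod C (f i j) = Q i j"
  shows "mat I J Q \<cdot> K.TA I (\<lambda>i. L.TA J (f i)) = L.TA J (\<lambda>j. K.TA I (\<lambda>i. f i j)) \<cdot> mat I J P"
proof -
  have [simp]: "P i j \<in> Obj C" "Q i j \<in> Obj C" for i j
    using assms K.Dom_Obj K.Cod_Obj by metis+
  show ?thesis
  proof (induction I)
    case (Cons i I)
    have "mat (i # I) J Q \<cdot> K.TA (i # I) (\<lambda>i. L.TA J (f i)) =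
      row2 J (Q i) (\<lambda>j. K.TO I (\<lambda>i. Q i j)) \<cdot>
        (L.TA J (f i) \<otimes> L.TA J (\<lambda>j. K.TA I (\<lambda>i. f i j))) \<cdot> (\<one> (L.TO J (P i)) \<otimes> mat I J P)"
      by (simp add: Cons)
    also have "\<dots> = L.TA J (\<lambda>j. K.TA (i # I) (\<lambda>i. f i j)) \<cdot>
        row2 J (P i) (\<lambda>j. K.TO I (\<lambda>i. P i j)) \<cdot> (\<one> (L.TO J (P i)) \<otimes> mat I J P)"
      by (subst K.Cmp_extend[OF row2_natural]) simp_all
    finally show ?case by simp
  qed simp
qed

text \<open>This and its counterpart for columns become the unit laws of the distributive laws; they
  are also the reason why most coordinates of the transformations \<chi> are identities.\<close>

lemma mat_single_left:
  assumes [simp]: "\<And>i j. P i j \<in> Obj C"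
  shows "mat [i] J P = \<one> (L.TO J (P i))"
  by (simp add: row2_right_unit)

lemma mat_single_right:
  assumes [simp]: "\<And>i j. P i j \<in> Obj C"
  shows "mat I [j] P = \<one> (K.TO I (\<lambda>i. P i j))"
  by (induction I) (simp_all add: row2_single row0_single del: row2.simps row0.simps)

text \<open>Associativity of \<open>row2\<close> moves one row at a time to the first part; the left
  unit law covers an empty first part.\<close>

lemma mat_append:
  assumes [simp]: "\<And>i j. P i j \<in> Obj C"
  shows "mat (I @ I') J P =
    row2 J (\<lambda>j. K.TO I (\<lambda>i. P i j)) (\<lambda>j. K.TO I' (\<lambda>i. P i j)) \<cdot> (mat I J P \<otimes> mat I' J P)"
proof (induction I)
  case Nil
  have "row2 J (\<lambda>j. Ik) (\<lambda>j. K.TO I' (\<lambda>i. P i j)) \<cdot> (row0 J \<otimes> mat I' J P) =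
    (row2 J (\<lambda>j. Ik) (\<lambda>j. K.TO I' (\<lambda>i. P i j)) \<cdot> (row0 J \<otimes> \<one> (L.TO J (\<lambda>j. K.TO I' (\<lambda>i. P i j)))))
      \<cdot> (\<one> Ik \<otimes> mat I' J P)"
    by (simp del: K.ta_unit_left)
  then show ?case by (simp add: row2_left_unit del: K.Cmp_assoc')
next
  case (Cons i I)
  let ?p = "\<lambda>j. K.TO I (\<lambda>i. P i j)" and ?q = "\<lambda>j. K.TO I' (\<lambda>i. P i j)"
  have "mat ((i # I) @ I') J P = row2 J (P i) (\<lambda>j. ?p j \<odot> ?q j) \<cdot>
      (\<one> (L.TO J (P i)) \<otimes> row2 J ?p ?q) \<cdot> (\<one> (L.TO J (P i)) \<otimes> (mat I J P \<otimes> mat I' J P))"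
    by (simp add: Cons K.objects.tfold_append)
  also have "\<dots> = row2 J (\<lambda>j. P i j \<odot> ?p j) ?q \<cdot> (row2 J (P i) ?p \<otimes> \<one> (L.TO J ?q)) \<cdot>
      ((\<one> (L.TO J (P i)) \<otimes> mat I J P) \<otimes> mat I' J P)"
    by (subst K.Cmp_extend[OF row2_assoc]) (simp_all del: K.interchange K.interchange_extend)
  also have "\<dots> = row2 J (\<lambda>j. P i j \<odot> ?p j) ?q \<cdot> (mat (i # I) J P \<otimes> mat I' J P)"
    by (subst K.interchange) simp_all
  finally show ?case by simp
qed

text \<open>Interchange inside each group of rows, then between the groups. On blocks this becomes
  the multiplicativity of \<chi> in its left argument.\<close>

lemma mat_concat_left:
  assumes [simp]: "\<And>i j. P i j \<in> Obj C"
  shows "mat (concat (map F I)) J P =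
    mat I J (\<lambda>s j. K.TO (F s) (\<lambda>i. P i j)) \<cdot> K.TA I (\<lambda>s. mat (F s) J P)"
  by (induction I) (simp_all add: mat_append K.objects.tfold_concat)

text \<open>Here the groups of columns are interchanged first and the interior of each group
  afterwards, which becomes \<open>chi_mul_right\<close>. Rows are added one at a time by naturality
  of \<open>row2\<close>.\<close>

lemma mat_concat_right:
  assumes [simp]: "\<And>i j. P i j \<in> Obj C"
  shows "mat I (concat (map F J)) P =
    L.TA J (\<lambda>s. mat I (F s) P) \<cdot> mat I J (\<lambda>i s. L.TO (F s) (P i))"
proof (induction I)
  case Nil
  show ?case by (simp add: row0_concat)
next
  case (Cons i I)
  let ?p = "\<lambda>j. K.TO I (\<lambda>i. P i j)"
  have "mat (i # I) (concat (map F J)) P = L.TA J (\<lambda>s. row2 (F s) (P i) ?p) \<cdot>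
      row2 J (\<lambda>s. L.TO (F s) (P i)) (\<lambda>s. L.TO (F s) ?p) \<cdot>
      (L.TA J (\<lambda>s. \<one> (L.TO (F s) (P i))) \<otimes> L.TA J (\<lambda>s. mat I (F s) P)) \<cdot>
      (\<one> (L.TO J (\<lambda>s. L.TO (F s) (P i))) \<otimes> mat I J (\<lambda>i s. L.TO (F s) (P i)))"
    by (simp add: Cons row2_concat L.objects.tfold_concat)
  also have "\<dots> = L.TA J (\<lambda>s. row2 (F s) (P i) ?p) \<cdot>
      L.TA J (\<lambda>s. \<one> (L.TO (F s) (P i)) \<otimes> mat I (F s) P) \<cdot>
      row2 J (\<lambda>s. L.TO (F s) (P i)) (\<lambda>s. K.TO I (\<lambda>i. L.TO (F s) (P i))) \<cdot>
      (\<one> (L.TO J (\<lambda>s. L.TO (F s) (P i))) \<otimes> mat I J (\<lambda>i s. L.TO (F s) (P i)))"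
    by (subst K.Cmp_extend[OF row2_natural[where P = "\<lambda>s. L.TO (F s) (P i)"
        and Q = "\<lambda>s. K.TO I (\<lambda>i. L.TO (F s) (P i))"]]) simp_all
  finally show ?case by simp
qed

end

section \<open>The Yang--Baxter equation\<close>

locale threefold_tensor =
  m12: twofold C o1 a1 I1 o2 a2 I2 \<kappa>12 \<beta>12 \<tau>12 \<iota>12 +
  m13: twofold C o1 a1 I1 o3 a3 I3 \<kappa>13 \<beta>13 \<tau>13 \<iota>13 +
  m23: twofold C o2 a2 I2 o3 a3 I3 \<kappa>23 \<beta>23 \<tau>23 \<iota>23
  for C :: "('o, 'a, 'z) cat_scheme"
    and o1 (infixr "\<odot>\<^sub>1" 70) and a1 (infixr "\<otimes>\<^sub>1" 70) and I1
    and o2 (infixr "\<odot>\<^sub>2" 70) and a2 (infixr "\<otimes>\<^sub>2" 70) and I2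
    and o3 (infixr "\<odot>\<^sub>3" 70) and a3 (infixr "\<otimes>\<^sub>3" 70) and I3
    and \<kappa>12 \<beta>12 \<tau>12 \<iota>12 \<kappa>13 \<beta>13 \<tau>13 \<iota>13 \<kappa>23 \<beta>23 \<tau>23 \<iota>23 +
  assumes b13: "\<kappa>23 \<cdot> \<kappa>12 = \<kappa>13"
    and b14: "\<beta>23 \<cdot> \<kappa>12 = (\<kappa>12 \<otimes>\<^sub>3 \<kappa>12) \<cdot> \<beta>13"
    and b15: "\<tau>23 \<cdot> (\<kappa>13 \<otimes>\<^sub>2 \<kappa>13) \<cdot> \<beta>12 = \<kappa>13"
    and b16: "\<iota>23 I1 I1 I1 I1 \<cdot> (\<beta>13 \<otimes>\<^sub>2 \<beta>13) \<cdot> \<beta>12 = (\<beta>12 \<otimes>\<^sub>3 \<beta>12) \<cdot> \<beta>13"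
    and b17: "\<kappa>23 \<cdot> \<tau>12 = \<tau>13 \<cdot> (\<kappa>23 \<otimes>\<^sub>1 \<kappa>23)"
    and b18: "\<beta>23 \<cdot> \<tau>12 = (\<tau>12 \<otimes>\<^sub>3 \<tau>12) \<cdot> \<iota>13 I2 I2 I2 I2 \<cdot> (\<beta>23 \<otimes>\<^sub>1 \<beta>23)"
    and b19: "\<tau>23 \<cdot> (\<tau>13 \<otimes>\<^sub>2 \<tau>13) \<cdot> \<iota>12 I3 I3 I3 I3 = \<tau>13 \<cdot> (\<tau>23 \<otimes>\<^sub>1 \<tau>23)"
    and b20: "\<lbrakk>A \<in> Obj C; B \<in> Obj C; P \<in> Obj C; D \<in> Obj C;
        E \<in> Obj C; F \<in> Obj C; G \<in> Obj C; H \<in> Obj C\<rbrakk> \<Longrightarrow>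
      \<iota>23 (A \<odot>\<^sub>1 E) (B \<odot>\<^sub>1 F) (P \<odot>\<^sub>1 G) (D \<odot>\<^sub>1 H) \<cdot> (\<iota>13 A B E F \<otimes>\<^sub>2 \<iota>13 P D G H)
        \<cdot> \<iota>12 (A \<odot>\<^sub>3 B) (P \<odot>\<^sub>3 D) (E \<odot>\<^sub>3 F) (G \<odot>\<^sub>3 H) =
      (\<iota>12 A P E G \<otimes>\<^sub>3 \<iota>12 B D F H)
        \<cdot> \<iota>13 (A \<odot>\<^sub>2 P) (B \<odot>\<^sub>2 D) (E \<odot>\<^sub>2 G) (F \<odot>\<^sub>2 H) \<cdot> (\<iota>23 A B P D \<otimes>\<^sub>1 \<iota>23 E F G H)"
begin

abbreviation "TO1 \<equiv> m12.K.TO"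
abbreviation "TA1 \<equiv> m12.K.TA"
abbreviation "TO2 \<equiv> m12.L.TO"
abbreviation "TA2 \<equiv> m12.L.TA"
abbreviation "TO3 \<equiv> m13.L.TO"
abbreviation "TA3 \<equiv> m13.L.TA"

text \<open>In \<open>row_00\<close>, \<open>row_20\<close>, \<open>row_02\<close>,
  \<open>row_22\<close> the digits are the sizes in directions 2 and 1, while direction 3 is an
  arbitrary list. With that list empty the four statements are \<open>b13\<close>,
  \<open>b15\<close>, \<open>b17\<close>, \<open>b19\<close>; a further index costs
  \<open>b14\<close>, \<open>b16\<close>, \<open>b18\<close>, \<open>b20\<close>
  respectively.\<close>

lemma row_00:
  "m23.row0 K \<cdot> \<kappa>12 = TA3 K (\<lambda>k. \<kappa>12) \<cdot> m13.row0 K"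
proof (induction K)
  case (Cons k K)
  have "m23.row0 (k # K) \<cdot> \<kappa>12 = (\<one> I2 \<otimes>\<^sub>3 m23.row0 K) \<cdot> (\<kappa>12 \<otimes>\<^sub>3 \<kappa>12) \<cdot> \<beta>13"
    by (simp add: b14)
  then show ?case by (simp add: Cons)
qed (simp add: b13)

lemma row_20:
  "m23.row2 K (\<lambda>k. I1) (\<lambda>k. I1) \<cdot> (m13.row0 K \<otimes>\<^sub>2 m13.row0 K) \<cdot> \<beta>12 =
    TA3 K (\<lambda>k. \<beta>12) \<cdot> m13.row0 K"
proof (induction K)
  case (Cons k K)
  have "m23.row2 (k # K) (\<lambda>k. I1) (\<lambda>k. I1) \<cdot> (m13.row0 (k # K) \<otimes>\<^sub>2 m13.row0 (k # K)) \<cdot> \<beta>12 =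
    (\<one> (I1 \<odot>\<^sub>2 I1) \<otimes>\<^sub>3 m23.row2 K (\<lambda>k. I1) (\<lambda>k. I1)) \<cdot>
      \<iota>23 I1 (TO3 K (\<lambda>k. I1)) I1 (TO3 K (\<lambda>k. I1)) \<cdot>
      ((\<one> I1 \<otimes>\<^sub>3 m13.row0 K) \<otimes>\<^sub>2 (\<one> I1 \<otimes>\<^sub>3 m13.row0 K)) \<cdot> (\<beta>13 \<otimes>\<^sub>2 \<beta>13) \<cdot> \<beta>12"
    by simp
  \<comment> \<open>Naturality of \<open>\<iota>23\<close> moves the tails to the left, which leaves
    the left side of \<open>b16\<close> at the right end.\<close>
  also have "\<dots> = (\<one> (I1 \<odot>\<^sub>2 I1) \<otimes>\<^sub>3
      (m23.row2 K (\<lambda>k. I1) (\<lambda>k. I1) \<cdot> (m13.row0 K \<otimes>\<^sub>2 m13.row0 K)))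
      \<cdot> \<iota>23 I1 I1 I1 I1 \<cdot> (\<beta>13 \<otimes>\<^sub>2 \<beta>13) \<cdot> \<beta>12"
    by (subst m23.iota_nat_extend) simp_all
  also have "\<dots> = (\<beta>12 \<otimes>\<^sub>3 (m23.row2 K (\<lambda>k. I1) (\<lambda>k. I1) \<cdot> (m13.row0 K \<otimes>\<^sub>2 m13.row0 K) \<cdot> \<beta>12)) \<cdot> \<beta>13"
    by (subst b16) simp
  finally show ?case by (simp add: Cons)
qed (simp add: b15)

lemma row_02:
  "m23.row0 K \<cdot> \<tau>12 =
    TA3 K (\<lambda>k. \<tau>12) \<cdot> m13.row2 K (\<lambda>k. I2) (\<lambda>k. I2) \<cdot> (m23.row0 K \<otimes>\<^sub>1 m23.row0 K)"
proof (induction K)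
  case (Cons k K)
  have "m23.row0 (k # K) \<cdot> \<tau>12 = (\<tau>12 \<otimes>\<^sub>3 (m23.row0 K \<cdot> \<tau>12)) \<cdot>
      \<iota>13 I2 I2 I2 I2 \<cdot> (\<beta>23 \<otimes>\<^sub>1 \<beta>23)"
    by (simp add: b18)
  also have "\<dots> = (\<tau>12 \<otimes>\<^sub>3 (TA3 K (\<lambda>k. \<tau>12) \<cdot> m13.row2 K (\<lambda>k. I2) (\<lambda>k. I2))) \<cdot>
      ((\<one> I2 \<otimes>\<^sub>1 \<one> I2) \<otimes>\<^sub>3 (m23.row0 K \<otimes>\<^sub>1 m23.row0 K)) \<cdot> \<iota>13 I2 I2 I2 I2 \<cdot> (\<beta>23 \<otimes>\<^sub>1 \<beta>23)"
    by (simp add: Cons)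
  also have "\<dots> = (\<tau>12 \<otimes>\<^sub>3 (TA3 K (\<lambda>k. \<tau>12) \<cdot> m13.row2 K (\<lambda>k. I2) (\<lambda>k. I2))) \<cdot>
      \<iota>13 I2 (TO3 K (\<lambda>k. I2)) I2 (TO3 K (\<lambda>k. I2)) \<cdot>
      ((\<one> I2 \<otimes>\<^sub>3 m23.row0 K) \<otimes>\<^sub>1 (\<one> I2 \<otimes>\<^sub>3 m23.row0 K)) \<cdot> (\<beta>23 \<otimes>\<^sub>1 \<beta>23)"
    by (subst m13.iota_nat_extend) simp_all
  finally show ?case by simp
qed (simp add: b17)

lemma row_22:
  assumes [simp]: "\<And>k. P k \<in> Obj C" "\<And>k. Q k \<in> Obj C" "\<And>k. R k \<in> Obj C" "\<And>k. S k \<in> Obj C"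
  shows "m23.row2 K (\<lambda>k. P k \<odot>\<^sub>1 R k) (\<lambda>k. Q k \<odot>\<^sub>1 S k) \<cdot>
      (m13.row2 K P R \<otimes>\<^sub>2 m13.row2 K Q S) \<cdot> \<iota>12 (TO3 K P) (TO3 K Q) (TO3 K R) (TO3 K S) =
    TA3 K (\<lambda>k. \<iota>12 (P k) (Q k) (R k) (S k)) \<cdot>
      m13.row2 K (\<lambda>k. P k \<odot>\<^sub>2 Q k) (\<lambda>k. R k \<odot>\<^sub>2 S k) \<cdot> (m23.row2 K P Q \<otimes>\<^sub>1 m23.row2 K R S)"
proof (induction K)
  case (Cons k K)
  let ?p = "TO3 K P" and ?q = "TO3 K Q" and ?r = "TO3 K R" and ?s = "TO3 K S"
  let ?PR = "\<lambda>k. P k \<odot>\<^sub>1 R k" and ?QS = "\<lambda>k. Q k \<odot>\<^sub>1 S k"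
  let ?PQ = "\<lambda>k. P k \<odot>\<^sub>2 Q k" and ?RS = "\<lambda>k. R k \<odot>\<^sub>2 S k"
  have "m23.row2 (k # K) ?PR ?QS \<cdot> (m13.row2 (k # K) P R \<otimes>\<^sub>2 m13.row2 (k # K) Q S) \<cdot>
      \<iota>12 (TO3 (k # K) P) (TO3 (k # K) Q) (TO3 (k # K) R) (TO3 (k # K) S) =
    (\<one> (?PR k \<odot>\<^sub>2 ?QS k) \<otimes>\<^sub>3 m23.row2 K ?PR ?QS) \<cdot> \<iota>23 (?PR k) (TO3 K ?PR) (?QS k) (TO3 K ?QS) \<cdot>
      ((\<one> (?PR k) \<otimes>\<^sub>3 m13.row2 K P R) \<otimes>\<^sub>2 (\<one> (?QS k) \<otimes>\<^sub>3 m13.row2 K Q S)) \<cdot>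
      (\<iota>13 (P k) ?p (R k) ?r \<otimes>\<^sub>2 \<iota>13 (Q k) ?q (S k) ?s) \<cdot>
      \<iota>12 (P k \<odot>\<^sub>3 ?p) (Q k \<odot>\<^sub>3 ?q) (R k \<odot>\<^sub>3 ?r) (S k \<odot>\<^sub>3 ?s)"
    by simp
  also have "\<dots> = (\<one> (?PR k \<odot>\<^sub>2 ?QS k) \<otimes>\<^sub>3
      (m23.row2 K ?PR ?QS \<cdot> (m13.row2 K P R \<otimes>\<^sub>2 m13.row2 K Q S))) \<cdot>
      \<iota>23 (?PR k) (?p \<odot>\<^sub>1 ?r) (?QS k) (?q \<odot>\<^sub>1 ?s) \<cdot>
      (\<iota>13 (P k) ?p (R k) ?r \<otimes>\<^sub>2 \<iota>13 (Q k) ?q (S k) ?s) \<cdot>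
      \<iota>12 (P k \<odot>\<^sub>3 ?p) (Q k \<odot>\<^sub>3 ?q) (R k \<odot>\<^sub>3 ?r) (S k \<odot>\<^sub>3 ?s)"
    by (subst m23.iota_nat_extend) simp_all
  also have "\<dots> = (\<iota>12 (P k) (Q k) (R k) (S k) \<otimes>\<^sub>3
      (m23.row2 K ?PR ?QS \<cdot> (m13.row2 K P R \<otimes>\<^sub>2 m13.row2 K Q S) \<cdot> \<iota>12 ?p ?q ?r ?s)) \<cdot>
      \<iota>13 (?PQ k) (?p \<odot>\<^sub>2 ?q) (?RS k) (?r \<odot>\<^sub>2 ?s) \<cdot>
      (\<iota>23 (P k) ?p (Q k) ?q \<otimes>\<^sub>1 \<iota>23 (R k) ?r (S k) ?s)"
    by (subst b20) simp_all
  \<comment> \<open>The induction hypothesis acts on the tails; its rightmost factor is then carried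
    through \<open>\<iota>13\<close> by naturality.\<close>
  also have "\<dots> = (\<iota>12 (P k) (Q k) (R k) (S k) \<otimes>\<^sub>3
      (TA3 K (\<lambda>k. \<iota>12 (P k) (Q k) (R k) (S k)) \<cdot> m13.row2 K ?PQ ?RS)) \<cdot>
      ((\<one> (?PQ k) \<otimes>\<^sub>1 \<one> (?RS k)) \<otimes>\<^sub>3 (m23.row2 K P Q \<otimes>\<^sub>1 m23.row2 K R S)) \<cdot>
      \<iota>13 (?PQ k) (?p \<odot>\<^sub>2 ?q) (?RS k) (?r \<odot>\<^sub>2 ?s) \<cdot>
      (\<iota>23 (P k) ?p (Q k) ?q \<otimes>\<^sub>1 \<iota>23 (R k) ?r (S k) ?s)"
    by (simp add: Cons)
  also have "\<dots> = (\<iota>12 (P k) (Q k) (R k) (S k) \<otimes>\<^sub>3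
      (TA3 K (\<lambda>k. \<iota>12 (P k) (Q k) (R k) (S k)) \<cdot> m13.row2 K ?PQ ?RS)) \<cdot>
      \<iota>13 (?PQ k) (TO3 K ?PQ) (?RS k) (TO3 K ?RS) \<cdot>
      ((\<one> (?PQ k) \<otimes>\<^sub>3 m23.row2 K P Q) \<otimes>\<^sub>1 (\<one> (?RS k) \<otimes>\<^sub>3 m23.row2 K R S)) \<cdot>
      (\<iota>23 (P k) ?p (Q k) ?q \<otimes>\<^sub>1 \<iota>23 (R k) ?r (S k) ?s)"
    by (subst m13.iota_nat_extend) simp_all
  finally show ?case by simp
qed (simp add: b19)

text \<open>Direction 1 is empty. Induction over direction 2 starts from \<open>row_00\<close>, and
  every step is an instance of \<open>row_20\<close>.\<close>

lemma mat_0: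
  "m23.mat J K (\<lambda>j k. I1) \<cdot> TA2 J (\<lambda>j. m13.row0 K) \<cdot> m12.row0 J =
    TA3 K (\<lambda>k. m12.row0 J) \<cdot> m13.row0 K"
proof (induction J)
  case Nil
  show ?case by (simp add: row_00)
next
  case (Cons j J)
  have "m23.mat (j # J) K (\<lambda>j k. I1) \<cdot> TA2 (j # J) (\<lambda>j. m13.row0 K) \<cdot> m12.row0 (j # J) =
    m23.row2 K (\<lambda>k. I1) (\<lambda>k. TO2 J (\<lambda>j. I1)) \<cdot>
      (m13.row0 K \<otimes>\<^sub>2 (m23.mat J K (\<lambda>j k. I1) \<cdot> TA2 J (\<lambda>j. m13.row0 K) \<cdot> m12.row0 J)) \<cdot> \<beta>12"
    by simp
  also have "\<dots> = m23.row2 K (\<lambda>k. I1) (\<lambda>k. TO2 J (\<lambda>j. I1)) \<cdot>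
      (TA3 K (\<lambda>k. \<one> I1) \<otimes>\<^sub>2 TA3 K (\<lambda>k. m12.row0 J)) \<cdot> (m13.row0 K \<otimes>\<^sub>2 m13.row0 K) \<cdot> \<beta>12"
    by (simp add: Cons)
  also have "\<dots> = TA3 K (\<lambda>k. \<one> I1 \<otimes>\<^sub>2 m12.row0 J) \<cdot>
      m23.row2 K (\<lambda>k. I1) (\<lambda>k. I1) \<cdot> (m13.row0 K \<otimes>\<^sub>2 m13.row0 K) \<cdot> \<beta>12"
    by (subst m12.K.Cmp_extend[OF m23.row2_natural[where P = "\<lambda>k. I1" and Q = "\<lambda>k. I1"]]) simp_all
  finally show ?case by (simp add: row_20)
qed

text \<open>Direction 1 has size two. Induction over direction 2 starts from \<open>row_02\<close>,
  and every step is an instance of \<open>row_22\<close>.\<close>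

lemma mat_2:
  assumes [simp]: "\<And>j k. P j k \<in> Obj C" "\<And>j k. Q j k \<in> Obj C"
  shows "m23.mat J K (\<lambda>j k. P j k \<odot>\<^sub>1 Q j k) \<cdot> TA2 J (\<lambda>j. m13.row2 K (P j) (Q j)) \<cdot>
      m12.row2 J (\<lambda>j. TO3 K (P j)) (\<lambda>j. TO3 K (Q j)) =
    TA3 K (\<lambda>k. m12.row2 J (\<lambda>j. P j k) (\<lambda>j. Q j k)) \<cdot>
      m13.row2 K (\<lambda>k. TO2 J (\<lambda>j. P j k)) (\<lambda>k. TO2 J (\<lambda>j. Q j k)) \<cdot>
      (m23.mat J K P \<otimes>\<^sub>1 m23.mat J K Q)"
proof (induction J)
  case Nil
  show ?case by (simp add: row_02)
next
  case (Cons j J)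
  let ?PQ = "\<lambda>j k. P j k \<odot>\<^sub>1 Q j k"
  let ?p = "\<lambda>k. TO2 J (\<lambda>j. P j k)" and ?q = "\<lambda>k. TO2 J (\<lambda>j. Q j k)"
  let ?r = "\<lambda>k. TO2 J (\<lambda>j. ?PQ j k)"
  let ?\<iota> = "\<iota>12 (TO3 K (P j)) (TO2 J (\<lambda>j. TO3 K (P j))) (TO3 K (Q j)) (TO2 J (\<lambda>j. TO3 K (Q j)))"
  have "m23.mat (j # J) K ?PQ \<cdot> TA2 (j # J) (\<lambda>j. m13.row2 K (P j) (Q j)) \<cdot>
      m12.row2 (j # J) (\<lambda>j. TO3 K (P j)) (\<lambda>j. TO3 K (Q j)) =
    m23.row2 K (?PQ j) ?r \<cdot>
      (m13.row2 K (P j) (Q j) \<otimes>\<^sub>2 (m23.mat J K ?PQ \<cdot> TA2 J (\<lambda>j. m13.row2 K (P j) (Q j)) \<cdot>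
        m12.row2 J (\<lambda>j. TO3 K (P j)) (\<lambda>j. TO3 K (Q j)))) \<cdot> ?\<iota>"
    by simp
  \<comment> \<open>The identity factors are written as products of identities, the form in which
    naturality of \<open>row2\<close> and then of \<open>\<iota>12\<close> applies.\<close>
  also have "\<dots> = m23.row2 K (?PQ j) ?r \<cdot>
      (TA3 K (\<lambda>k. \<one> (?PQ j k)) \<otimes>\<^sub>2 TA3 K (\<lambda>k. m12.row2 J (\<lambda>j. P j k) (\<lambda>j. Q j k))) \<cdot>
      (m13.row2 K (P j) (Q j) \<otimes>\<^sub>2 m13.row2 K ?p ?q) \<cdot>
      ((\<one> (TO3 K (P j)) \<otimes>\<^sub>1 \<one> (TO3 K (Q j))) \<otimes>\<^sub>2 (m23.mat J K P \<otimes>\<^sub>1 m23.mat J K Q)) \<cdot> ?\<iota>"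
    by (simp add: Cons)
  also have "\<dots> = TA3 K (\<lambda>k. \<one> (?PQ j k) \<otimes>\<^sub>2 m12.row2 J (\<lambda>j. P j k) (\<lambda>j. Q j k)) \<cdot>
      m23.row2 K (?PQ j) (\<lambda>k. ?p k \<odot>\<^sub>1 ?q k) \<cdot>
      (m13.row2 K (P j) (Q j) \<otimes>\<^sub>2 m13.row2 K ?p ?q) \<cdot>
      ((\<one> (TO3 K (P j)) \<otimes>\<^sub>1 \<one> (TO3 K (Q j))) \<otimes>\<^sub>2 (m23.mat J K P \<otimes>\<^sub>1 m23.mat J K Q)) \<cdot> ?\<iota>"
    by (subst m12.K.Cmp_extend[OF m23.row2_natural[where P = "?PQ j" and Q = "\<lambda>k. ?p k \<odot>\<^sub>1 ?q k"]]) simp_all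
  also have "\<dots> = TA3 K (\<lambda>k. \<one> (?PQ j k) \<otimes>\<^sub>2 m12.row2 J (\<lambda>j. P j k) (\<lambda>j. Q j k)) \<cdot>
      m23.row2 K (?PQ j) (\<lambda>k. ?p k \<odot>\<^sub>1 ?q k) \<cdot>
      (m13.row2 K (P j) (Q j) \<otimes>\<^sub>2 m13.row2 K ?p ?q) \<cdot>
      \<iota>12 (TO3 K (P j)) (TO3 K ?p) (TO3 K (Q j)) (TO3 K ?q) \<cdot>
      ((\<one> (TO3 K (P j)) \<otimes>\<^sub>2 m23.mat J K P) \<otimes>\<^sub>1 (\<one> (TO3 K (Q j)) \<otimes>\<^sub>2 m23.mat J K Q))"
    by (subst m12.iota_nat) simp_all
  also have "\<dots> = TA3 K (\<lambda>k. \<one> (?PQ j k) \<otimes>\<^sub>2 m12.row2 J (\<lambda>j. P j k) (\<lambda>j. Q j k)) \<cdot>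
      (m23.row2 K (?PQ j) (\<lambda>k. ?p k \<odot>\<^sub>1 ?q k) \<cdot>
      (m13.row2 K (P j) (Q j) \<otimes>\<^sub>2 m13.row2 K ?p ?q) \<cdot>
      \<iota>12 (TO3 K (P j)) (TO3 K ?p) (TO3 K (Q j)) (TO3 K ?q)) \<cdot>
      ((\<one> (TO3 K (P j)) \<otimes>\<^sub>2 m23.mat J K P) \<otimes>\<^sub>1 (\<one> (TO3 K (Q j)) \<otimes>\<^sub>2 m23.mat J K Q))"
    by simp
  finally show ?case by (subst (asm) row_22) simp_all
qed

text \<open>Both sides reverse the nesting of the products in directions 1, 2 and 3. Induction over
  direction 1 starts from \<open>mat_0\<close>; adding a slice is \<open>mat_2\<close> for that
  slice and the 1-product of the remaining ones.\<close>

proposition yang_baxter_mat: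
  assumes [simp]: "\<And>i j k. P i j k \<in> Obj C"
  shows "m23.mat J K (\<lambda>j k. TO1 I (\<lambda>i. P i j k)) \<cdot> TA2 J (\<lambda>j. m13.mat I K (\<lambda>i. P i j)) \<cdot>
      m12.mat I J (\<lambda>i j. TO3 K (P i j)) =
    TA3 K (\<lambda>k. m12.mat I J (\<lambda>i j. P i j k)) \<cdot> m13.mat I K (\<lambda>i k. TO2 J (\<lambda>j. P i j k)) \<cdot>
      TA1 I (\<lambda>i. m23.mat J K (P i))"
proof (induction I)
  case Nil
  show ?case by (simp add: mat_0)
next
  case (Cons i I)
  let ?q = "\<lambda>j k. TO1 I (\<lambda>i. P i j k)"
  let ?r = "\<lambda>i k. TO2 J (\<lambda>j. P i j k)" and ?s = "\<lambda>k. TO2 J (\<lambda>j. ?q j k)"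
  let ?a = "m12.mat I J (\<lambda>i j. TO3 K (P i j))"
  have "m23.mat J K (\<lambda>j k. TO1 (i # I) (\<lambda>i. P i j k)) \<cdot> TA2 J (\<lambda>j. m13.mat (i # I) K (\<lambda>i. P i j)) \<cdot>
      m12.mat (i # I) J (\<lambda>i j. TO3 K (P i j)) =
    m23.mat J K (\<lambda>j k. P i j k \<odot>\<^sub>1 ?q j k) \<cdot> TA2 J (\<lambda>j. m13.row2 K (P i j) (?q j)) \<cdot>
      TA2 J (\<lambda>j. \<one> (TO3 K (P i j)) \<otimes>\<^sub>1 m13.mat I K (\<lambda>i. P i j)) \<cdot>
      m12.row2 J (\<lambda>j. TO3 K (P i j)) (\<lambda>j. TO1 I (\<lambda>i. TO3 K (P i j))) \<cdot>
      (\<one> (TO2 J (\<lambda>j. TO3 K (P i j))) \<otimes>\<^sub>1 ?a)"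
    by simp
  \<comment> \<open>Naturality of \<open>m12.row2\<close>, read from right to left, brings the
    interchanges of directions 1 and 3 in the remaining slices next to \<open>?a\<close>, where the
    induction hypothesis needs them.\<close>
  also have "\<dots> =
    m23.mat J K (\<lambda>j k. P i j k \<odot>\<^sub>1 ?q j k) \<cdot> TA2 J (\<lambda>j. m13.row2 K (P i j) (?q j)) \<cdot>
      m12.row2 J (\<lambda>j. TO3 K (P i j)) (\<lambda>j. TO3 K (?q j)) \<cdot>
      (TA2 J (\<lambda>j. \<one> (TO3 K (P i j))) \<otimes>\<^sub>1 TA2 J (\<lambda>j. m13.mat I K (\<lambda>i. P i j))) \<cdot>
      (\<one> (TO2 J (\<lambda>j. TO3 K (P i j))) \<otimes>\<^sub>1 ?a)"
    by (subst m12.K.Cmp_extend[OF m12.row2_natural[symmetric,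
        where P' = "\<lambda>j. TO3 K (P i j)" and Q' = "\<lambda>j. TO3 K (?q j)"]]) simp_all
  also have "\<dots> =
    (m23.mat J K (\<lambda>j k. P i j k \<odot>\<^sub>1 ?q j k) \<cdot> TA2 J (\<lambda>j. m13.row2 K (P i j) (?q j)) \<cdot>
      m12.row2 J (\<lambda>j. TO3 K (P i j)) (\<lambda>j. TO3 K (?q j))) \<cdot>
      (\<one> (TO2 J (\<lambda>j. TO3 K (P i j))) \<otimes>\<^sub>1 (TA2 J (\<lambda>j. m13.mat I K (\<lambda>i. P i j)) \<cdot> ?a))"
    by simp
  also have "\<dots> = TA3 K (\<lambda>k. m12.row2 J (\<lambda>j. P i j k) (\<lambda>j. ?q j k)) \<cdot> m13.row2 K (?r i) ?s \<cdot>
      (m23.mat J K (P i) \<otimes>\<^sub>1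
        (m23.mat J K ?q \<cdot> TA2 J (\<lambda>j. m13.mat I K (\<lambda>i. P i j)) \<cdot> ?a))"
    by (subst mat_2) simp_all
  also have "\<dots> = TA3 K (\<lambda>k. m12.row2 J (\<lambda>j. P i j k) (\<lambda>j. ?q j k)) \<cdot> m13.row2 K (?r i) ?s \<cdot>
      (TA3 K (\<lambda>k. \<one> (?r i k)) \<otimes>\<^sub>1 TA3 K (\<lambda>k. m12.mat I J (\<lambda>i j. P i j k))) \<cdot>
      (m23.mat J K (P i) \<otimes>\<^sub>1 (m13.mat I K ?r \<cdot> TA1 I (\<lambda>i. m23.mat J K (P i))))"
    by (simp add: Cons)
  also have "\<dots> = TA3 K (\<lambda>k. m12.row2 J (\<lambda>j. P i j k) (\<lambda>j. ?q j k)) \<cdot>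
      TA3 K (\<lambda>k. \<one> (?r i k) \<otimes>\<^sub>1 m12.mat I J (\<lambda>i j. P i j k)) \<cdot>
      m13.row2 K (?r i) (\<lambda>k. TO1 I (\<lambda>i. ?r i k)) \<cdot>
      (m23.mat J K (P i) \<otimes>\<^sub>1 (m13.mat I K ?r \<cdot> TA1 I (\<lambda>i. m23.mat J K (P i))))"
    by (subst m12.K.Cmp_extend[OF m13.row2_natural[where P = "?r i"
        and Q = "\<lambda>k. TO1 I (\<lambda>i. ?r i k)"]]) simp_all
  finally show ?case by simp
qed

end

section \<open>Lax actions of monoids and distributive laws\<close>

locale endo_action = category C + N: monoid_on E mul one
  for C :: "('o, 'a, 'z) cat_scheme" and E :: "'e set" and mul one +
  fixes UO :: "'e \<Rightarrow> 'o \<Rightarrow> 'o" and UA :: "'e \<Rightarrow> 'a \<Rightarrow> 'a"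
  assumes UO_Obj [simp]: "\<lbrakk>e \<in> E; A \<in> Obj C\<rbrakk> \<Longrightarrow> UO e A \<in> Obj C"
    and UA_Arr [simp]: "\<lbrakk>e \<in> E; f \<in> Arr C\<rbrakk> \<Longrightarrow> UA e f \<in> Arr C"
    and UA_Dom [simp]: "\<lbrakk>e \<in> E; f \<in> Arr C\<rbrakk> \<Longrightarrow> Dom C (UA e f) = UO e (Dom C f)"
    and UA_Cod [simp]: "\<lbrakk>e \<in> E; f \<in> Arr C\<rbrakk> \<Longrightarrow> Cod C (UA e f) = UO e (Cod C f)"
    and UA_Ide [simp]: "\<lbrakk>e \<in> E; A \<in> Obj C\<rbrakk> \<Longrightarrow> UA e (\<one> A) = \<one> (UO e A)"
    and UA_Cmp [simp]: "\<lbrakk>e \<in> E; f \<in> Arr C; g \<in> Arr C; Dom C g = Cod C f\<rbrakk>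
      \<Longrightarrow> UA e (g \<cdot> f) = UA e g \<cdot> UA e f"
    and UO_one [simp]: "A \<in> Obj C \<Longrightarrow> UO one A = A"
    and UA_one [simp]: "f \<in> Arr C \<Longrightarrow> UA one f = f"
begin

declare N.closed [simp] N.unit_closed [simp] N.left_unit [simp] N.right_unit [simp]

end

locale strict_action = endo_action +
  assumes UO_mul [simp]: "\<lbrakk>e \<in> E; e' \<in> E; A \<in> Obj C\<rbrakk> \<Longrightarrow> UO (mul e e') A = UO e (UO e' A)"
    and UA_mul [simp]: "\<lbrakk>e \<in> E; e' \<in> E; f \<in> Arr C\<rbrakk> \<Longrightarrow> UA (mul e e') f = UA e (UA e' f)"

text \<open>The laws of a lax functor to Cat with strict units, for the monoid \<open>E\<close> seen
  as a category with one object.\<close>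

locale lax_action = endo_action +
  fixes om :: "'d \<Rightarrow> 'd \<Rightarrow> 'a \<Rightarrow> 'b"
  assumes om_Arr [simp]: "\<lbrakk>e \<in> E; e' \<in> E; A \<in> Obj C\<rbrakk> \<Longrightarrow> om e e' A \<in> Arr C"
    and om_Dom [simp]: "\<lbrakk>e \<in> E; e' \<in> E; A \<in> Obj C\<rbrakk> \<Longrightarrow> Dom C (om e e' A) = UO e (UO e' A)"
    and om_Cod [simp]: "\<lbrakk>e \<in> E; e' \<in> E; A \<in> Obj C\<rbrakk> \<Longrightarrow> Cod C (om e e' A) = UO (mul e e') A"
    and om_natural: "\<lbrakk>e \<in> E; e' \<in> E; f \<in> Arr C\<rbrakk> \<Longrightarrow>
      om e e' (Cod C f) \<cdot> UA e (UA e' f) = UA (mul e e') f \<cdot> om e e' (Dom C f)"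
    and om_right [simp]: "\<lbrakk>e \<in> E; A \<in> Obj C\<rbrakk> \<Longrightarrow> om e one A = \<one> (UO e A)"
    and om_left [simp]: "\<lbrakk>e \<in> E; A \<in> Obj C\<rbrakk> \<Longrightarrow> om one e A = \<one> (UO e A)"
    and om_assoc: "\<lbrakk>e3 \<in> E; e2 \<in> E; e1 \<in> E; A \<in> Obj C\<rbrakk> \<Longrightarrow>
      om (mul e3 e2) e1 A \<cdot> om e3 e2 (UO e1 A) = om e3 (mul e2 e1) A \<cdot> UA e3 (om e2 e1 A)"
begin

lemma om_natural':
  "\<lbrakk>e \<in> E; e' \<in> E; f \<in> Arr C; Dom C f = A; Cod C f = B\<rbrakk> \<Longrightarrow>
    om e e' B \<cdot> UA e (UA e' f) = UA (mul e e') f \<cdot> om e e' A"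
  using om_natural by blast

primrec product :: "'d list \<Rightarrow> 'd" where
  "product [] = one"
| "product (e # es) = mul e (product es)"

lemma product_closed [simp]: "set es \<subseteq> E \<Longrightarrow> product es \<in> E"
  by (induction es) auto

lemma product_append [simp]:
  "\<lbrakk>set es \<subseteq> E; set es' \<subseteq> E\<rbrakk> \<Longrightarrow> product (es @ es') = mul (product es) (product es')"
  by (induction es) (simp_all add: N.assoc)

lemma foldr_UO_Obj [simp]: "\<lbrakk>set es \<subseteq> E; A \<in> Obj C\<rbrakk> \<Longrightarrow> foldr UO es A \<in> Obj C"
  by (induction es) auto

lemma foldr_UA_typ [simp]:
  assumes "set es \<subseteq> E" "f \<in> Arr C"
  shows "foldr UA es f \<in> Arr C" "Dom C (foldr UA es f) = foldr UO es (Dom C f)"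
    "Cod C (foldr UA es f) = foldr UO es (Cod C f)"
  using assms by (induction es) auto

primrec compositor :: "'d list \<Rightarrow> 'a \<Rightarrow> 'b" where
  "compositor [] A = \<one> A"
| "compositor (e # es) A = om e (product es) A \<cdot> UA e (compositor es A)"

lemma compositor_typ [simp]:
  assumes "set es \<subseteq> E" "A \<in> Obj C"
  shows "compositor es A \<in> Arr C" "Dom C (compositor es A) = foldr UO es A"
    "Cod C (compositor es A) = UO (product es) A"
  using assms by (induction es) auto

text \<open>General associativity: a list may be cut anywhere. Each step is \<open>om_assoc\<close>
  followed by naturality of \<open>om\<close>.\<close>

lemma compositor_append:
  assumes "set ds \<subseteq> E" and [simp]: "set es \<subseteq> E" "A \<in> Obj C"
  shows "compositor (ds @ es) A =
    om (product ds) (product es) A \<cdot> UA (product ds) (compositor es A) \<cdot> compositor ds (foldr UO es A)"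
  using assms(1)
proof (induction ds)
  case (Cons d ds)
  then have [simp]: "d \<in> E" "set ds \<subseteq> E" by auto
  have "compositor ((d # ds) @ es) A = om d (mul (product ds) (product es)) A \<cdot>
      UA d (om (product ds) (product es) A) \<cdot>
      UA d (UA (product ds) (compositor es A)) \<cdot> UA d (compositor ds (foldr UO es A))"
    using Cons.IH by simp
  also have "\<dots> = om (mul d (product ds)) (product es) A \<cdot> om d (product ds) (UO (product es) A) \<cdot>
      UA d (UA (product ds) (compositor es A)) \<cdot> UA d (compositor ds (foldr UO es A))"
    by (rule Cmp_extend[OF om_assoc[symmetric]]) simp_all
  also have "\<dots> = om (mul d (product ds)) (product es) A \<cdot> UA (mul d (product ds)) (compositor es A) \<cdot>
      om d (product ds) (foldr UO es A) \<cdot> UA d (compositor ds (foldr UO es A))"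
    by (subst Cmp_extend[OF om_natural']) (simp_all del: Cmp_assoc')
  finally show ?case by simp
qed simp

text \<open>The form needed for two normal forms, each of which has a trivial compositor.\<close>

lemma compositor_append_trivial:
  assumes [simp]: "set ds \<subseteq> E" "set es \<subseteq> E" "A \<in> Obj C"
    and es: "compositor es A = \<one> (foldr UO es A)"
    and ds: "compositor ds (foldr UO es A) = \<one> (foldr UO ds (foldr UO es A))"
  shows "compositor (ds @ es) A = om (product ds) (product es) A"
proof -
  let ?B = "foldr UO es A"
  \<comment> \<open>A compositor that is an identity has equal source and target.\<close>
  have B: "UO (product es) A = ?B"
    using compositor_typ(3)[of es A] unfolding es by simp
  moreover have "UO (product ds) ?B = foldr UO ds ?B"
    using compositor_typ(3)[of ds ?B] unfolding ds by simp
  ultimately show ?thesis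
    unfolding compositor_append[OF assms(1-3)] es ds by simp
qed

text \<open>Both orders have the same product. By lax associativity each compositor is
  \<open>om d d'\<close>, respectively \<open>om d' d\<close>, followed by a map that depends only
  on this product, and \<open>om d' d\<close> is an identity.\<close>

lemma compositor_swap:
  assumes d: "d \<in> E" "d' \<in> E" "mul d d' = mul d' d"
    and triv: "\<And>A. A \<in> Obj C \<Longrightarrow> om d' d A = \<one> (UO d' (UO d A))"
    and es: "set cs \<subseteq> E" "set es \<subseteq> E" "A \<in> Obj C"
  shows "compositor (cs @ d # d' # es) A =
    compositor (cs @ d' # d # es) A \<cdot> foldr UA cs (om d d' (foldr UO es A))"
  using es(1)
proof (induction cs)
  case Nil
  \<comment> \<open>The identity \<open>om d' d\<close> forces the action to be strict at this
    product: its source and target agree, and naturality gives the same for arrows.\<close>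
  have [simp]: "UO (mul d' d) B = UO d' (UO d B)" if "B \<in> Obj C" for B
    using om_Cod[of d' d B] triv[of B] d that by simp
  have UA: "UA (mul d' d) f = UA d' (UA d f)" if "f \<in> Arr C" for f
    using om_natural[of d' d f] triv d that by simp
  let ?e = "product es" and ?B = "foldr UO es A"
  have 1: "compositor (c # c' # es) A =
    om (mul c c') ?e A \<cdot> UA (mul c c') (compositor es A) \<cdot> om c c' ?B"
    if [simp]: "c \<in> E" "c' \<in> E" for c c'
  proof -
    have "compositor (c # c' # es) A =
        om c (mul c' ?e) A \<cdot> UA c (om c' ?e A) \<cdot> UA c (UA c' (compositor es A))"
      using es by simp
    also have "\<dots> = om (mul c c') ?e A \<cdot> om c c' (UO ?e A) \<cdot> UA c (UA c' (compositor es A))"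
      using es by (intro Cmp_extend[OF om_assoc[symmetric]]) simp_all
    also have "\<dots> = om (mul c c') ?e A \<cdot> UA (mul c c') (compositor es A) \<cdot> om c c' ?B"
      using es by (subst om_natural') simp_all
    finally show ?thesis .
  qed
  show ?case
    using d es triv by (simp add: 1 UA del: compositor.simps)
next
  case (Cons c cs)
  then have [simp]: "c \<in> E" "set cs \<subseteq> E" by auto
  have "product (cs @ d # d' # es) = product (cs @ d' # d # es)"
    using d es Cons.prems N.assoc[of d d' "product es"] N.assoc[of d' d "product es"] by simp
  moreover have "UO (mul d d') B = UO d' (UO d B)" if "B \<in> Obj C" for B
    using om_Cod[of d' d B] triv[of B] d that by simp
  ultimately show ?case
    using Cons.IH d es by simp
qed

end

lemma (in strict_action) lax: "lax_action C E mul one UO UA (\<lambda>e e' A. \<one> (UO e (UO e' A)))"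
  by unfold_locales (simp_all add: N.assoc)

text \<open>A distributive law, except for multiplicativity in \<open>E\<close>, whose form depends
  on whether \<open>U\<close> is strict or lax.\<close>

locale interchange =
  U: endo_action C E mul one UO UA + Z: strict_action C H mulH oneH ZO ZA
  for C :: "('o, 'a, 'z) cat_scheme" and E :: "'e set" and mul one UO UA
    and H :: "'h set" and mulH oneH ZO ZA +
  fixes \<chi> :: "'e \<Rightarrow> 'h \<Rightarrow> 'o \<Rightarrow> 'a"
  assumes chi_Arr [simp]: "\<lbrakk>e \<in> E; h \<in> H; A \<in> Obj C\<rbrakk> \<Longrightarrow> \<chi> e h A \<in> Arr C"
    and chi_Dom [simp]: "\<lbrakk>e \<in> E; h \<in> H; A \<in> Obj C\<rbrakk> \<Longrightarrow> Dom C (\<chi> e h A) = UO e (ZO h A)"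
    and chi_Cod [simp]: "\<lbrakk>e \<in> E; h \<in> H; A \<in> Obj C\<rbrakk> \<Longrightarrow> Cod C (\<chi> e h A) = ZO h (UO e A)"
    and chi_natural: "\<lbrakk>e \<in> E; h \<in> H; f \<in> Arr C; Dom C f = A; Cod C f = B\<rbrakk> \<Longrightarrow>
      \<chi> e h B \<cdot> UA e (ZA h f) = ZA h (UA e f) \<cdot> \<chi> e h A"
    and chi_mul_right: "\<lbrakk>e \<in> E; h \<in> H; h' \<in> H; A \<in> Obj C\<rbrakk> \<Longrightarrow>
      \<chi> e (mulH h h') A = ZA h (\<chi> e h' A) \<cdot> \<chi> e h (ZO h' A)"
    and chi_one_right [simp]: "\<lbrakk>e \<in> E; A \<in> Obj C\<rbrakk> \<Longrightarrow> \<chi> e oneH A = \<one> (UO e A)"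
    and chi_one_left [simp]: "\<lbrakk>h \<in> H; A \<in> Obj C\<rbrakk> \<Longrightarrow> \<chi> one h A = \<one> (ZO h A)"

text \<open>Only \<open>Z\<close> is strict. \<open>U\<close> must be allowed to be lax because in
  the second application it is the combined action of two colours.\<close>

locale lax_interchange =
  interchange C E mul one UO UA H mulH oneH ZO ZA \<chi> + U: lax_action C E mul one UO UA om
  for C :: "('o, 'a, 'z) cat_scheme" and E :: "'e set" and mul one UO UA
    and H :: "'h set" and mulH oneH ZO ZA \<chi> om +
  assumes chi_om: "\<lbrakk>e \<in> E; e' \<in> E; h \<in> H; A \<in> Obj C\<rbrakk> \<Longrightarrow>
      \<chi> (mul e e') h A \<cdot> om e e' (ZO h A) =
      ZA h (om e e' A) \<cdot> \<chi> e h (UO e' A) \<cdot> UA e (\<chi> e' h A)"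

definition pair_mul :: "('e \<Rightarrow> 'e \<Rightarrow> 'e) \<Rightarrow> ('h \<Rightarrow> 'h \<Rightarrow> 'h) \<Rightarrow> 'e \<times> 'h \<Rightarrow> 'e \<times> 'h \<Rightarrow> 'e \<times> 'h" where
  "pair_mul mul mulH = (\<lambda>(e, h) (e', h'). (mul e e', mulH h h'))"

definition pair_act :: "('e \<Rightarrow> 'x \<Rightarrow> 'x) \<Rightarrow> ('h \<Rightarrow> 'x \<Rightarrow> 'x) \<Rightarrow> 'e \<times> 'h \<Rightarrow> 'x \<Rightarrow> 'x" where
  "pair_act U Z = (\<lambda>(e, h) x. Z h (U e x))"

lemma pair_mul_simp [simp]: "pair_mul mul mulH (e, h) (e', h') = (mul e e', mulH h h')"
  and pair_act_simp [simp]: "pair_act U Z (e, h) x = Z h (U e x)"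
  by (simp_all add: pair_mul_def pair_act_def)

text \<open>The composite along a distributive law, as for monads: from
  \<open>Z h U e Z h' U e'\<close> the inner \<open>U e\<close> and \<open>Z h'\<close> are
  exchanged, then the two \<open>U\<close>s are composed by \<open>om\<close>. Composing the two
  \<open>Z\<close>s costs nothing.\<close>

definition (in lax_interchange) pair_om :: "'e \<times> 'h \<Rightarrow> 'e \<times> 'h \<Rightarrow> 'o \<Rightarrow> 'a" where
  "pair_om = (\<lambda>(e, h) (e', h') A. ZA (mulH h h') (om e e' A) \<cdot> ZA h (\<chi> e h' (UO e' A)))"

lemma (in lax_interchange) pair_om_simp [simp]:
  "pair_om (e, h) (e', h') A = ZA (mulH h h') (om e e' A) \<cdot> ZA h (\<chi> e h' (UO e' A))"
  by (simp add: pair_om_def)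

lemma (in lax_interchange) pair_om_natural:
  assumes [simp]: "e \<in> E" "h \<in> H" "e' \<in> E" "h' \<in> H" "f \<in> Arr C"
  shows "pair_om (e, h) (e', h') (Cod C f) \<cdot> ZA h (UA e (ZA h' (UA e' f))) =
    ZA h (ZA h' (UA (mul e e') f)) \<cdot> pair_om (e, h) (e', h') (Dom C f)"
proof -
  have 1: "ZA h (ZA h' (om e e' (Cod C f))) \<cdot> ZA h (ZA h' (UA e (UA e' f))) =
      ZA h (ZA h' (UA (mul e e') f)) \<cdot> ZA h (ZA h' (om e e' (Dom C f)))"
    by (simp add: U.om_natural flip: Z.UA_Cmp)
  have 2: "ZA h (\<chi> e h' (UO e' (Cod C f))) \<cdot> ZA h (UA e (ZA h' (UA e' f))) =
      ZA h (ZA h' (UA e (UA e' f))) \<cdot> ZA h (\<chi> e h' (UO e' (Dom C f)))"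
    by (simp add: chi_natural flip: Z.UA_Cmp)
  show ?thesis
    by (simp add: 2 U.Cmp_extend[OF 1])
qed

text \<open>Both sides move every \<open>Z\<close> in front of every \<open>U\<close> and compose
  the \<open>U\<close>s. The four equations are compatibility of \<chi> with \<open>om\<close>,
  associativity of \<open>om\<close>, naturality of \<chi> at an \<open>om\<close> together with
  splitting the composite \<open>Z\<close>, and naturality of \<chi> at another \<chi>.\<close>

lemma (in lax_interchange) pair_om_assoc:
  assumes [simp]: "e3 \<in> E" "h3 \<in> H" "e2 \<in> E" "h2 \<in> H" "e1 \<in> E" "h1 \<in> H" "A \<in> Obj C"
  shows "pair_om (mul e3 e2, mulH h3 h2) (e1, h1) A \<cdot> pair_om (e3, h3) (e2, h2) (ZO h1 (UO e1 A)) =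
    pair_om (e3, h3) (mul e2 e1, mulH h2 h1) A \<cdot> ZA h3 (UA e3 (pair_om (e2, h2) (e1, h1) A))"
proof -
  let ?A = "UO e1 A" and ?Z = "\<lambda>f. ZA h3 (ZA h2 (ZA h1 f))"
  have 1: "ZA h3 (ZA h2 (\<chi> (mul e3 e2) h1 ?A)) \<cdot> ZA h3 (ZA h2 (om e3 e2 (ZO h1 ?A))) =
      ?Z (om e3 e2 ?A) \<cdot> (ZA h3 (ZA h2 (\<chi> e3 h1 (UO e2 ?A))) \<cdot> ZA h3 (ZA h2 (UA e3 (\<chi> e2 h1 ?A))))"
    by (simp add: chi_om flip: Z.UA_Cmp)
  have 2: "?Z (om (mul e3 e2) e1 A) \<cdot> ?Z (om e3 e2 ?A) =
      ?Z (om e3 (mul e2 e1) A) \<cdot> ?Z (UA e3 (om e2 e1 A))"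
    by (simp add: U.om_assoc flip: Z.UA_Cmp)
  have 3: "ZA h3 (\<chi> e3 (mulH h2 h1) (UO (mul e2 e1) A)) \<cdot> ZA h3 (UA e3 (ZA h2 (ZA h1 (om e2 e1 A)))) =
      ?Z (UA e3 (om e2 e1 A)) \<cdot>
        (ZA h3 (ZA h2 (\<chi> e3 h1 (UO e2 ?A))) \<cdot> ZA h3 (\<chi> e3 h2 (ZO h1 (UO e2 ?A))))"
    using chi_natural[of e3 "mulH h2 h1" "om e2 e1 A", OF _ _ _ refl refl]
    by (simp add: chi_mul_right flip: Z.UA_Cmp)
  have 4: "ZA h3 (\<chi> e3 h2 (ZO h1 (UO e2 ?A))) \<cdot> ZA h3 (UA e3 (ZA h2 (\<chi> e2 h1 ?A))) =
      ZA h3 (ZA h2 (UA e3 (\<chi> e2 h1 ?A))) \<cdot> ZA h3 (\<chi> e3 h2 (UO e2 (ZO h1 ?A)))"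
    by (simp add: chi_natural flip: Z.UA_Cmp)
  have "pair_om (mul e3 e2, mulH h3 h2) (e1, h1) A \<cdot> pair_om (e3, h3) (e2, h2) (ZO h1 ?A) =
      ?Z (om (mul e3 e2) e1 A) \<cdot> ZA h3 (ZA h2 (\<chi> (mul e3 e2) h1 ?A)) \<cdot>
      ZA h3 (ZA h2 (om e3 e2 (ZO h1 ?A))) \<cdot> ZA h3 (\<chi> e3 h2 (UO e2 (ZO h1 ?A)))"
    by simp
  also have "\<dots> = ?Z (om (mul e3 e2) e1 A) \<cdot> ?Z (om e3 e2 ?A) \<cdot>
      ZA h3 (ZA h2 (\<chi> e3 h1 (UO e2 ?A))) \<cdot> ZA h3 (ZA h2 (UA e3 (\<chi> e2 h1 ?A))) \<cdot>
      ZA h3 (\<chi> e3 h2 (UO e2 (ZO h1 ?A)))"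
    by (subst U.Cmp_extend[OF 1]) simp_all
  also have "\<dots> = ?Z (om e3 (mul e2 e1) A) \<cdot> ?Z (UA e3 (om e2 e1 A)) \<cdot>
      ZA h3 (ZA h2 (\<chi> e3 h1 (UO e2 ?A))) \<cdot> ZA h3 (ZA h2 (UA e3 (\<chi> e2 h1 ?A))) \<cdot>
      ZA h3 (\<chi> e3 h2 (UO e2 (ZO h1 ?A)))"
    by (rule U.Cmp_extend[OF 2]) simp_all
  also have "\<dots> = ?Z (om e3 (mul e2 e1) A) \<cdot> ?Z (UA e3 (om e2 e1 A)) \<cdot>
      ZA h3 (ZA h2 (\<chi> e3 h1 (UO e2 ?A))) \<cdot> ZA h3 (\<chi> e3 h2 (ZO h1 (UO e2 ?A))) \<cdot>
      ZA h3 (UA e3 (ZA h2 (\<chi> e2 h1 ?A)))"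
    by (simp add: 4)
  also have "\<dots> = ?Z (om e3 (mul e2 e1) A) \<cdot> ZA h3 (\<chi> e3 (mulH h2 h1) (UO (mul e2 e1) A)) \<cdot>
      ZA h3 (UA e3 (ZA h2 (ZA h1 (om e2 e1 A)))) \<cdot> ZA h3 (UA e3 (ZA h2 (\<chi> e2 h1 ?A)))"
    by (subst U.Cmp_extend[OF 3]) simp_all
  finally show ?thesis by simp
qed

theorem (in lax_interchange) lax_pair:
  "lax_action C (E \<times> H) (pair_mul mul mulH) (one, oneH) (pair_act UO ZO) (pair_act UA ZA) pair_om"
  by unfold_locales
    (auto simp: U.N.assoc Z.N.assoc pair_om_natural pair_om_assoc simp del: pair_om_simp,
      auto)

locale strict_triple =
  xy: interchange C E mul one XO XA E mul one YO YA \<chi>12 +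
  xz: interchange C E mul one XO XA E mul one ZO ZA \<chi>13 +
  yz: interchange C E mul one YO YA E mul one ZO ZA \<chi>23 +
  X: strict_action C E mul one XO XA
  for C :: "('o, 'a, 'z) cat_scheme" and E :: "'e set" and mul one
    and XO XA YO YA ZO ZA \<chi>12 \<chi>13 \<chi>23 +
  assumes chi12_mul: "\<lbrakk>e \<in> E; e' \<in> E; h \<in> E; A \<in> Obj C\<rbrakk> \<Longrightarrow>
      \<chi>12 (mul e e') h A = \<chi>12 e h (XO e' A) \<cdot> XA e (\<chi>12 e' h A)"
    and chi13_mul: "\<lbrakk>e \<in> E; e' \<in> E; h \<in> E; A \<in> Obj C\<rbrakk> \<Longrightarrow>
      \<chi>13 (mul e e') h A = \<chi>13 e h (XO e' A) \<cdot> XA e (\<chi>13 e' h A)"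
    and chi23_mul: "\<lbrakk>e \<in> E; e' \<in> E; h \<in> E; A \<in> Obj C\<rbrakk> \<Longrightarrow>
      \<chi>23 (mul e e') h A = \<chi>23 e h (YO e' A) \<cdot> YA e (\<chi>23 e' h A)"
    and yang_baxter: "\<lbrakk>f \<in> E; g \<in> E; h \<in> E; A \<in> Obj C\<rbrakk> \<Longrightarrow>
      \<chi>23 g h (XO f A) \<cdot> YA g (\<chi>13 f h A) \<cdot> \<chi>12 f g (ZO h A) =
      ZA h (\<chi>12 f g A) \<cdot> \<chi>13 f h (YO g A) \<cdot> XA f (\<chi>23 g h A)"
begin

sublocale xy: lax_interchange C E mul one XO XA E mul one YO YA \<chi>12
  "\<lambda>e e' A. \<one> (XO e (XO e' A))"
proof -
  interpret lax_action C E mul one XO XA "\<lambda>e e' A. \<one> (XO e (XO e' A))"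
    by (rule X.lax)
  show "lax_interchange C E mul one XO XA E mul one YO YA \<chi>12 (\<lambda>e e' A. \<one> (XO e (XO e' A)))"
    by unfold_locales (simp add: chi12_mul)
qed

sublocale xy_pair: lax_action C "E \<times> E" "pair_mul mul mul" "(one, one)"
  "pair_act XO YO" "pair_act XA YA" xy.pair_om
  by (rule xy.lax_pair)

text \<open>In \<open>Y g X f Z h\<close> the map \<open>h\<close> first passes its neighbour
  \<open>f\<close> and then \<open>g\<close>.\<close>

definition \<chi>xyz where
  "\<chi>xyz = (\<lambda>(f, g) h A. \<chi>23 g h (XO f A) \<cdot> YA g (\<chi>13 f h A))"

lemma \<chi>xyz_simp [simp]: "\<chi>xyz (f, g) h A = \<chi>23 g h (XO f A) \<cdot> YA g (\<chi>13 f h A)"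
  by (simp add: \<chi>xyz_def)

lemma \<chi>xyz_natural:
  assumes [simp]: "f \<in> E" "g \<in> E" "h \<in> E" "u \<in> Arr C"
  shows "\<chi>xyz (f, g) h (Cod C u) \<cdot> YA g (XA f (ZA h u)) = ZA h (YA g (XA f u)) \<cdot> \<chi>xyz (f, g) h (Dom C u)"
proof -
  have 1: "YA g (\<chi>13 f h (Cod C u)) \<cdot> YA g (XA f (ZA h u)) = YA g (ZA h (XA f u)) \<cdot> YA g (\<chi>13 f h (Dom C u))"
    by (simp add: xz.chi_natural flip: xy.Z.UA_Cmp)
  have 2: "\<chi>23 g h (XO f (Cod C u)) \<cdot> YA g (ZA h (XA f u)) = ZA h (YA g (XA f u)) \<cdot> \<chi>23 g h (XO f (Dom C u))"
    by (simp add: yz.chi_natural)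
  show ?thesis
    by (simp add: 1 xy.U.Cmp_extend[OF 2])
qed

lemma \<chi>xyz_mul_right:
  assumes [simp]: "f \<in> E" "g \<in> E" "h \<in> E" "h' \<in> E" "A \<in> Obj C"
  shows "\<chi>xyz (f, g) (mul h h') A = ZA h (\<chi>xyz (f, g) h' A) \<cdot> \<chi>xyz (f, g) h (ZO h' A)"
proof -
  have 1: "\<chi>23 g h (ZO h' (XO f A)) \<cdot> YA g (ZA h (\<chi>13 f h' A)) =
      ZA h (YA g (\<chi>13 f h' A)) \<cdot> \<chi>23 g h (XO f (ZO h' A))"
    by (simp add: yz.chi_natural)
  show ?thesis
    by (simp add: yz.chi_mul_right xz.chi_mul_right xy.U.Cmp_extend[OF 1])
qed

text \<open>This is where Yang--Baxter enters: on one side \<open>f\<close> passes \<open>g'\<close>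
  before both pass \<open>h\<close>, on the other side afterwards. The remaining rearrangements are
  naturality.\<close>

lemma \<chi>xyz_om:
  assumes [simp]: "f \<in> E" "g \<in> E" "f' \<in> E" "g' \<in> E" "h \<in> E" "A \<in> Obj C"
  shows "\<chi>xyz (mul f f', mul g g') h A \<cdot> xy.pair_om (f, g) (f', g') (ZO h A) =
    ZA h (xy.pair_om (f, g) (f', g') A) \<cdot> \<chi>xyz (f, g) h (YO g' (XO f' A)) \<cdot>
      YA g (XA f (\<chi>xyz (f', g') h A))"
proof -
  let ?A = "XO f' A"
  have 1: "YA g (YA g' (XA f (\<chi>13 f' h A))) \<cdot> YA g (\<chi>12 f g' (XO f' (ZO h A))) =
      YA g (\<chi>12 f g' (ZO h ?A)) \<cdot> YA g (XA f (YA g' (\<chi>13 f' h A)))"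
    using xy.chi_natural[of f g' "\<chi>13 f' h A", OF _ _ _ refl refl] by (simp flip: xy.Z.UA_Cmp)
  have 2: "YA g (\<chi>23 g' h (XO f ?A)) \<cdot> (YA g (YA g' (\<chi>13 f h ?A)) \<cdot> YA g (\<chi>12 f g' (ZO h ?A))) =
      YA g (ZA h (\<chi>12 f g' ?A)) \<cdot> (YA g (\<chi>13 f h (YO g' ?A)) \<cdot> YA g (XA f (\<chi>23 g' h ?A)))"
    by (simp add: yang_baxter flip: xy.Z.UA_Cmp)
  have 3: "\<chi>23 g h (YO g' (XO f ?A)) \<cdot> YA g (ZA h (\<chi>12 f g' ?A)) =
      ZA h (YA g (\<chi>12 f g' ?A)) \<cdot> \<chi>23 g h (XO f (YO g' ?A))"
    by (simp add: yz.chi_natural)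
  have "\<chi>xyz (mul f f', mul g g') h A \<cdot> xy.pair_om (f, g) (f', g') (ZO h A) =
      \<chi>23 g h (YO g' (XO f ?A)) \<cdot> YA g (\<chi>23 g' h (XO f ?A)) \<cdot> YA g (YA g' (\<chi>13 f h ?A)) \<cdot>
      YA g (YA g' (XA f (\<chi>13 f' h A))) \<cdot> YA g (\<chi>12 f g' (XO f' (ZO h A)))"
    by (simp add: chi23_mul chi13_mul)
  also have "\<dots> = \<chi>23 g h (YO g' (XO f ?A)) \<cdot> (YA g (\<chi>23 g' h (XO f ?A)) \<cdot>
      (YA g (YA g' (\<chi>13 f h ?A)) \<cdot> YA g (\<chi>12 f g' (ZO h ?A)))) \<cdot>
      YA g (XA f (YA g' (\<chi>13 f' h A)))"
    by (simp add: 1)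
  also have "\<dots> = (\<chi>23 g h (YO g' (XO f ?A)) \<cdot> YA g (ZA h (\<chi>12 f g' ?A))) \<cdot>
      YA g (\<chi>13 f h (YO g' ?A)) \<cdot> YA g (XA f (\<chi>23 g' h ?A)) \<cdot>
      YA g (XA f (YA g' (\<chi>13 f' h A)))"
    by (subst 2) simp
  also have "\<dots> = ZA h (YA g (\<chi>12 f g' ?A)) \<cdot> \<chi>23 g h (XO f (YO g' ?A)) \<cdot>
      YA g (\<chi>13 f h (YO g' ?A)) \<cdot> YA g (XA f (\<chi>23 g' h ?A)) \<cdot>
      YA g (XA f (YA g' (\<chi>13 f' h A)))"
    by (subst 3) simp
  finally show ?thesis by simp
qed

sublocale xyz: lax_interchange C "E \<times> E" "pair_mul mul mul" "(one, one)"
  "pair_act XO YO" "pair_act XA YA" E mul one ZO ZA \<chi>xyz xy.pair_om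
  by unfold_locales
    (auto simp: \<chi>xyz_natural \<chi>xyz_mul_right \<chi>xyz_om simp del: \<chi>xyz_simp xy.pair_om_simp, auto)

sublocale xyz_pair: lax_action C "(E \<times> E) \<times> E" "pair_mul (pair_mul mul mul) mul" "((one, one), one)"
  "pair_act (pair_act XO YO) ZO" "pair_act (pair_act XA YA) ZA" xyz.pair_om
  by (rule xyz.lax_pair)

end

section \<open>Arrays and monotone maps\<close>

text \<open>
  Arrays are total: the entries outside the range of interest are irrelevant, and one category of
  arrays serves all sizes.
\<close>

type_synonym 'x array = "nat \<Rightarrow> nat \<Rightarrow> nat \<Rightarrow> 'x"

definition arrays :: "('o, 'a, 'z) cat_scheme \<Rightarrow> ('o array, 'a array) cat" where
  "arrays C = \<lparr>Obj = {A. \<forall>r q z. A r q z \<in> Obj C}, Arr = {f. \<forall>r q z. f r q z \<in> Arr C},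
     Dom = (\<lambda>f r q z. Dom C (f r q z)), Cod = (\<lambda>f r q z. Cod C (f r q z)),
     Ide = (\<lambda>A r q z. Ide C (A r q z)), Cmp = (\<lambda>g f r q z. Cmp C (g r q z) (f r q z))\<rparr>"

lemma arrays_simps [simp]:
  "A \<in> Obj (arrays C) \<longleftrightarrow> (\<forall>r q z. A r q z \<in> Obj C)"
  "f \<in> Arr (arrays C) \<longleftrightarrow> (\<forall>r q z. f r q z \<in> Arr C)"
  "Dom (arrays C) f = (\<lambda>r q z. Dom C (f r q z))"
  "Cod (arrays C) f = (\<lambda>r q z. Cod C (f r q z))"
  "Ide (arrays C) A = (\<lambda>r q z. Ide C (A r q z))"
  "Cmp (arrays C) g f = (\<lambda>r q z. Cmp C (g r q z) (f r q z))"
  by (simp_all add: arrays_def)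

lemma (in category) category_arrays: "category (arrays C)"
  by unfold_locales (auto simp: fun_eq_iff)

text \<open>A coordinate \<open>r\<close> is the edge from vertex \<open>r\<close> to vertex
  \<open>r + 1\<close> of an ordinal, and its block is the path of edges between the images of the
  two vertices.\<close>

definition block :: "(nat \<Rightarrow> nat) \<Rightarrow> nat \<Rightarrow> nat list" where
  "block f r = [f r..<f (Suc r)]"

lemma concat_block:
  assumes "mono f" "a \<le> b"
  shows "concat (map (block f) [a..<b]) = [f a..<f b]"
  using assms(2)
proof (induction b rule: dec_induct)
  case (step b)
  have "[f a..<f (Suc b)] = [f a..<f b] @ [f b..<f (Suc b)]"
    using step(1) monoD[OF assms(1)] upt_add_eq_append[of "f a" "f b" "f (Suc b) - f b"]
    by (simp add: le_Suc_eq)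
  then show ?case
    using step by (simp add: block_def)
qed simp

text \<open>Turns composition of maps into \<open>concat\<close>, the shape in which the lemmas on
  grouped rows and columns apply.\<close>

lemma block_comp:
  assumes "mono f" "mono g"
  shows "block (g \<circ> f) r = concat (map (block g) (block f r))"
  using concat_block[OF assms(2)] monoD[OF assms(1), of r "Suc r"] by (simp add: block_def)

lemma block_id: "block id r = [r]"
  by (simp add: block_def)

text \<open>The reversal accounts for the opposite category: the product of \<open>ext g\<close> and
  \<open>ext f\<close> belongs to \<open>g\<close> after \<open>f\<close>.\<close>

abbreviation (input) then_map :: "(nat \<Rightarrow> nat) \<Rightarrow> (nat \<Rightarrow> nat) \<Rightarrow> nat \<Rightarrow> nat" where
  "then_map f g \<equiv> g \<circ> f"

interpretation maps: monoid_on "Collect mono :: (nat \<Rightarrow> nat) set" then_map id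
  by unfold_locales (auto simp: mono_def)

definition act1 :: "('x \<Rightarrow> 'x \<Rightarrow> 'x) \<Rightarrow> 'x \<Rightarrow> (nat \<Rightarrow> nat) \<Rightarrow> 'x array \<Rightarrow> 'x array" where
  "act1 t e f A = (\<lambda>r q z. tfold t e (block f r) (\<lambda>i. A i q z))"

definition act2 :: "('x \<Rightarrow> 'x \<Rightarrow> 'x) \<Rightarrow> 'x \<Rightarrow> (nat \<Rightarrow> nat) \<Rightarrow> 'x array \<Rightarrow> 'x array" where
  "act2 t e f A = (\<lambda>r q z. tfold t e (block f q) (\<lambda>j. A r j z))"

definition act3 :: "('x \<Rightarrow> 'x \<Rightarrow> 'x) \<Rightarrow> 'x \<Rightarrow> (nat \<Rightarrow> nat) \<Rightarrow> 'x array \<Rightarrow> 'x array" where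
  "act3 t e f A = (\<lambda>r q z. tfold t e (block f z) (\<lambda>k. A r q k))"

lemmas act_defs = act1_def act2_def act3_def

context strict_monoidal_category
begin

lemma strict_action_arrays:
  "strict_action (arrays C) (Collect mono) then_map id (act1 to I) (act1 ta (Ide C I))"
  "strict_action (arrays C) (Collect mono) then_map id (act2 to I) (act2 ta (Ide C I))"
  "strict_action (arrays C) (Collect mono) then_map id (act3 to I) (act3 ta (Ide C I))"
proof -
  interpret A: category "arrays C" by (rule category_arrays)
  note simps = fun_eq_iff act_defs block_id block_comp objects.tfold_concat arrows.tfold_concat
  show "strict_action (arrays C) (Collect mono) then_map id (act1 to I) (act1 ta (Ide C I))"
    by unfold_locales (simp_all add: simps)
  show "strict_action (arrays C) (Collect mono) then_map id (act2 to I) (act2 ta (Ide C I))"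
    by unfold_locales (simp_all add: simps)
  show "strict_action (arrays C) (Collect mono) then_map id (act3 to I) (act3 ta (Ide C I))"
    by unfold_locales (simp_all add: simps)
qed

end

context threefold_tensor
begin

definition "array\<chi>12 f g P = (\<lambda>r q z. m12.mat (block f r) (block g q) (\<lambda>i j. P i j z))"
definition "array\<chi>13 f h P = (\<lambda>r q z. m13.mat (block f r) (block h z) (\<lambda>i k. P i q k))"
definition "array\<chi>23 g h P = (\<lambda>r q z. m23.mat (block g q) (block h z) (\<lambda>j k. P r j k))"

lemmas array\<chi>_defs = array\<chi>12_def array\<chi>13_def array\<chi>23_def

sublocale arr: strict_triple "arrays C" "Collect mono" then_map id
  "act1 o1 I1" "act1 a1 (Ide C I1)" "act2 o2 I2" "act2 a2 (Ide C I2)"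
  "act3 o3 I3" "act3 a3 (Ide C I3)" array\<chi>12 array\<chi>13 array\<chi>23
proof -
  interpret X: strict_action "arrays C" "Collect mono" then_map id "act1 o1 I1" "act1 a1 (Ide C I1)"
    by (rule m12.K.strict_action_arrays)
  interpret Y: strict_action "arrays C" "Collect mono" then_map id "act2 o2 I2" "act2 a2 (Ide C I2)"
    by (rule m12.L.strict_action_arrays)
  interpret Z: strict_action "arrays C" "Collect mono" then_map id "act3 o3 I3" "act3 a3 (Ide C I3)"
    by (rule m13.L.strict_action_arrays)
  \<comment> \<open>Entry by entry, the unit laws are the cases of one row or one column, and the
    multiplication laws are those of grouped rows and columns.\<close>
  note simps = array\<chi>_defs act_defs fun_eq_iff block_id block_comp
    m12.mat_single_left m12.mat_single_right m13.mat_single_left m13.mat_single_right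
    m23.mat_single_left m23.mat_single_right
    m12.mat_concat_left m12.mat_concat_right m13.mat_concat_left m13.mat_concat_right
    m23.mat_concat_left m23.mat_concat_right
  show "strict_triple (arrays C) (Collect mono) then_map id
    (act1 o1 I1) (act1 a1 (Ide C I1)) (act2 o2 I2) (act2 a2 (Ide C I2))
    (act3 o3 I3) (act3 a3 (Ide C I3)) array\<chi>12 array\<chi>13 array\<chi>23"
    by unfold_locales
      (auto simp: simps yang_baxter_mat
        intro!: m12.mat_natural m13.mat_natural m23.mat_natural
        simp del: m12.mat.simps m13.mat.simps m23.mat.simps)
qed

end

section \<open>The opposite simplicial category\<close>

lemma delta_op_simps [simp]:
  "x \<in> Obj delta_op" "Dom delta_op = dsrc" "Cod delta_op = dtgt"
  by (simp_all add: delta_op_def)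

lemma delta_op_ArrD:
  assumes "f \<in> Arr delta_op"
  shows "x \<le> dtgt f \<Longrightarrow> dmap f x \<le> dsrc f"
    "\<lbrakk>x \<le> y; y \<le> dtgt f\<rbrakk> \<Longrightarrow> dmap f x \<le> dmap f y"
    "dtgt f < x \<Longrightarrow> dmap f x = undefined"
  using assms mono_onD[of "{..dtgt f}" "dmap f" x y]
  by (auto simp: delta_op_def PiE_iff extensional_def)

text \<open>Continuing by a translation above the target makes the assignment functorial on the nose.\<close>

definition ext :: "dop \<Rightarrow> nat \<Rightarrow> nat" where
  "ext f x = (if x \<le> dtgt f then dmap f x else x - dtgt f + dsrc f)"

text \<open>\<open>ext\<close> forgets both ends, so these have to be compared separately; above the
  target \<open>dmap\<close> is fixed by extensionality.\<close>

lemma delta_op_eqI: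
  assumes "f \<in> Arr delta_op" "g \<in> Arr delta_op" "dsrc f = dsrc g" "dtgt f = dtgt g" "ext f = ext g"
  shows "f = g"
proof -
  have "dmap f x = dmap g x" for x
    using assms(3,4) delta_op_ArrD(3)[OF assms(1), of x] delta_op_ArrD(3)[OF assms(2), of x]
      fun_cong[OF assms(5), of x]
    by (cases "x \<le> dtgt f") (simp_all add: ext_def)
  then have "dmap f = dmap g" by blast
  with assms show ?thesis by (simp add: dop.expand)
qed

lemma mono_ext [simp]: "f \<in> Arr delta_op \<Longrightarrow> mono (ext f)"
  unfolding mono_def ext_def
  using delta_op_ArrD(1,2)[of f] by (auto intro: order_trans[where y = "dsrc f"])

lemma ext_le: "\<lbrakk>f \<in> Arr delta_op; x \<le> dtgt f\<rbrakk> \<Longrightarrow> ext f x \<le> dsrc f"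
  using delta_op_ArrD(1)[of f x] by (simp add: ext_def)

lemma ext_Ide [simp]: "ext (Ide delta_op n) = id"
  by (auto simp: ext_def delta_op_def fun_eq_iff)

lemma dsrc_Ide [simp]: "dsrc (Ide delta_op n) = n" "dtgt (Ide delta_op n) = n"
  by (simp_all add: delta_op_def)

lemma dsrc_Cmp [simp]: "dsrc (Cmp delta_op g f) = dsrc f" "dtgt (Cmp delta_op g f) = dtgt g"
  by (simp_all add: delta_op_def)

lemma ext_Cmp:
  assumes "f \<in> Arr delta_op" "g \<in> Arr delta_op" "dsrc g = dtgt f"
  shows "ext (Cmp delta_op g f) = ext f \<circ> ext g"
  using assms delta_op_ArrD(1)[of g] by (auto simp: ext_def delta_op_def compose_def fun_eq_iff)

lemma category_delta_op: "category delta_op"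
proof
  show "Ide delta_op x \<in> Arr delta_op" for x
    by (auto simp: delta_op_def mono_on_def)
  then have ide: "Ide delta_op x \<in> Arr delta_op" for x .
  show cmp: "Cmp delta_op g f \<in> Arr delta_op"
    if "f \<in> Arr delta_op" "g \<in> Arr delta_op" "Dom delta_op g = Cod delta_op f" for f g
    using that by (auto simp: delta_op_def mono_on_def compose_def PiE_iff)
  show "Dom delta_op (Ide delta_op x) = x" "Cod delta_op (Ide delta_op x) = x" for x
    by (simp_all add: delta_op_def)
  show "Cmp delta_op f (Ide delta_op (Dom delta_op f)) = f"
    "Cmp delta_op (Ide delta_op (Cod delta_op f)) f = f" if "f \<in> Arr delta_op" for f
    using that ide cmp by (auto intro!: delta_op_eqI simp: ext_Cmp)
  show "Cmp delta_op h (Cmp delta_op g f) = Cmp delta_op (Cmp delta_op h g) f"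
    if "f \<in> Arr delta_op" "g \<in> Arr delta_op" "h \<in> Arr delta_op"
      "Dom delta_op g = Cod delta_op f" "Dom delta_op h = Cod delta_op g" for f g h
    using that cmp by (auto intro!: delta_op_eqI simp: ext_Cmp)
qed auto

interpretation delta_op: category delta_op by (rule category_delta_op)

lemma category_prod_cat:
  assumes "category C" "category D"
  shows "category (prod_cat C D)"
proof -
  interpret C: category C by fact
  interpret D: category D by fact
  show ?thesis
    by unfold_locales (auto simp: prod_cat_def)
qed

section \<open>Normal forms\<close>

definition coface :: "nat \<Rightarrow> nat \<Rightarrow> nat" where
  "coface j x = (if x < j then x else x + 1)"

definition codegeneracy :: "nat \<Rightarrow> nat \<Rightarrow> nat" where
  "codegeneracy j x = (if x \<le> j then x else x - 1)"

text \<open>The size has disappeared: continued by a translation, a face or a degeneracy depends on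
  its index alone.\<close>

fun bmap :: "basic \<Rightarrow> nat \<Rightarrow> nat" where
  "bmap (Id1 n) = id"
| "bmap (Fc n j) = coface j"
| "bmap (Dg n j) = codegeneracy j"

definition wmap :: "basic list \<Rightarrow> nat \<Rightarrow> nat" where
  "wmap w = foldr (\<lambda>b \<phi>. \<phi> \<circ> bmap b) w id"

lemma wmap_simps [simp]: "wmap [] = id" "wmap (b # w) = wmap w \<circ> bmap b"
  by (simp_all add: wmap_def)

fun endpoint :: "nat \<Rightarrow> basic list \<Rightarrow> nat" where
  "endpoint n [] = n"
| "endpoint n (b # w) = btgt b"

text \<open>Unlike \<open>is_word\<close> this admits the empty word, so that an identity needs no
  letter; the source \<open>n\<close> must then be supplied.\<close>

fun path :: "nat \<Rightarrow> basic list \<Rightarrow> bool" where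
  "path n [] \<longleftrightarrow> True"
| "path n (b # w) \<longleftrightarrow> valid_basic b \<and> bsrc b = endpoint n w \<and> path n w"

lemma endpoint_hd: "w \<noteq> [] \<Longrightarrow> endpoint n w = btgt (hd w)"
  by (cases w) auto

lemma path_last: "\<lbrakk>path n w; w \<noteq> []\<rbrakk> \<Longrightarrow> bsrc (last w) = n"
  by (induction w) (auto split: if_splits)

lemma barr_Arr: "valid_basic b \<Longrightarrow> barr b \<in> Arr delta_op"
  by (cases b) (auto simp: delta_op_def mono_on_def)

lemma barr_ends [simp]: "dsrc (barr b) = bsrc b" "dtgt (barr b) = btgt b"
  by (cases b; simp add: delta_op_def)+

lemma ext_barr: "valid_basic b \<Longrightarrow> ext (barr b) = bmap b"
  by (cases b) (auto simp: ext_def coface_def codegeneracy_def fun_eq_iff)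

lemma is_word_iff_path: "is_word w \<longleftrightarrow> w \<noteq> [] \<and> path (bsrc (last w)) w"
  by (induction w rule: is_word.induct) auto

lemma word_arr_Cons: "w \<noteq> [] \<Longrightarrow> word_arr (b # w) = Cmp delta_op (barr b) (word_arr w)"
  by (simp add: word_arr_def)

lemma word_arr_path:
  assumes "is_word w"
  shows "word_arr w \<in> Arr delta_op \<and> dsrc (word_arr w) = bsrc (last w) \<and>
    dtgt (word_arr w) = btgt (hd w) \<and> ext (word_arr w) = wmap w"
  using assms
proof (induction w rule: is_word.induct)
  case (2 b)
  then show ?case by (simp add: word_arr_def barr_Arr ext_barr)
next
  case (3 c b w)
  then show ?case
    by (simp add: word_arr_Cons barr_Arr ext_barr ext_Cmp)
qed simp

section \<open>Faces and the values they omit\<close>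

lemma strict_mono_coface: "strict_mono (coface j)"
  by (auto simp: strict_mono_def coface_def)

lemma range_coface: "range (coface j) = - {j}"
proof -
  have "x \<in> range (coface j)" if "x \<noteq> j" for x
    using that by (intro image_eqI[of _ _ "if x < j then x else x - 1"]) (auto simp: coface_def)
  then show ?thesis by (auto simp: coface_def split: if_splits)
qed

primrec faces :: "nat list \<Rightarrow> nat \<Rightarrow> nat" where
  "faces [] = id"
| "faces (j # js) = faces js \<circ> coface j"

lemma strict_mono_faces: "strict_mono (faces js)"
  using strict_mono_coface by (induction js) (auto simp: strict_mono_def)

lemma faces_above: "\<forall>j\<in>set js. j \<le> x \<Longrightarrow> faces js x = x + length js"
proof (induction js arbitrary: x)
  case (Cons j js)
  then have "faces js (Suc x) = Suc x + length js" by (intro Cons.IH) auto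
  with Cons.prems show ?case by (simp add: coface_def)
qed simp

text \<open>The values omitted by \<^term>\<open>faces js\<close>, in decreasing order.\<close>

fun omitted :: "nat list \<Rightarrow> nat list" where
  "omitted [] = []"
| "omitted (j # js) = (j + length js) # omitted js"

lemma omitted_inject: "omitted js = omitted is \<Longrightarrow> js = is"
proof (induction js arbitrary: "is")
  case Nil
  then show ?case by (cases "is") auto
next
  case (Cons j js)
  then obtain i is' where "is = i # is'" by (cases "is") auto
  with Cons.prems have "omitted js = omitted is'" and *: "j + length js = i + length is'" by simp_all
  then have "js = is'" using Cons.IH by blast
  with * \<open>is = i # is'\<close> show ?case by simp
qed

text \<open>In \<open>faces js \<circ> coface j\<close> the newly omitted value is
  \<open>faces js j\<close>, and since \<open>j\<close> bounds the later indices this is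
  \<open>j + length js\<close>.\<close>

lemma set_omitted:
  assumes "sorted_wrt (\<ge>) js"
  shows "set (omitted js) = - range (faces js)"
  using assms
proof (induction js)
  case (Cons j js)
  have "- range (faces (j # js)) = - (faces js ` range (coface j))"
    by (simp add: image_comp)
  also have "\<dots> = - range (faces js) \<union> {faces js j}"
    using strict_mono_imp_inj_on[OF strict_mono_faces[of js]]
    by (auto simp: range_coface inj_on_def)
  also have "faces js j = j + length js"
    using Cons.prems by (intro faces_above) auto
  finally show ?case using Cons by simp
qed simp

text \<open>Adding the number of remaining letters turns weak decrease into strict decrease, so the
  list can be recovered from its set.\<close>

lemma sorted_omitted: "sorted_wrt (\<ge>) js \<Longrightarrow> sorted_wrt (>) (omitted js)"
proof (induction js)
  case (Cons j js)
  have "i < j + length js" if "i \<in> set (omitted js)" for i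
    using that Cons.prems by (induction js) auto
  with Cons show ?case by simp
qed simp

lemma strict_desc_unique:
  fixes xs ys :: "nat list"
  assumes "sorted_wrt (>) xs" "sorted_wrt (>) ys" "set xs = set ys"
  shows "xs = ys"
  using assms
proof (induction xs arbitrary: ys)
  case (Cons x xs)
  then obtain y ys' where ys: "ys = y # ys'" by (cases ys) auto
  have "x = y"
  proof (rule antisym)
    have "x \<in> set (y # ys')" using Cons.prems ys by auto
    then show "x \<le> y" using Cons.prems ys by auto
    have "y \<in> set (x # xs)" using Cons.prems ys by auto
    then show "y \<le> x" using Cons.prems ys by auto
  qed
  moreover have "x \<notin> set xs" "y \<notin> set ys'" using Cons.prems ys by auto
  ultimately have "set xs = set ys'" using Cons.prems(3) ys by auto
  with Cons ys \<open>x = y\<close> show ?case by auto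
qed simp

lemma faces_inject:
  assumes "sorted_wrt (\<ge>) js" "sorted_wrt (\<ge>) is" "faces js = faces is"
  shows "js = is"
  using assms set_omitted[of js] set_omitted[of "is"] sorted_omitted strict_desc_unique omitted_inject
  by metis

section \<open>Degeneracies and the steps they collapse\<close>

primrec degens :: "nat list \<Rightarrow> (nat \<Rightarrow> nat) \<Rightarrow> nat \<Rightarrow> nat" where
  "degens [] \<phi> = \<phi>"
| "degens (l # ls) \<phi> = degens ls \<phi> \<circ> codegeneracy l"

text \<open>Precomposing with \<open>codegeneracy l\<close> collapses the step at \<open>l\<close>,
  keeps the steps below \<open>l\<close> and shifts those above. As all indices in \<open>ls\<close>
  are below \<open>l\<close>, the earlier collapsed steps stay in place.\<close>

lemma set_degens:
  assumes "sorted_wrt (>) ls" "inj \<phi>"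
  shows "{y. degens ls \<phi> y = degens ls \<phi> (Suc y)} = set ls"
  using assms
proof (induction ls)
  case Nil
  then show ?case by (simp add: inj_eq)
next
  case (Cons l ls)
  let ?\<psi> = "degens ls \<phi>"
  have IH: "?\<psi> y = ?\<psi> (Suc y) \<longleftrightarrow> y \<in> set ls" for y
    using Cons by auto
  have "degens (l # ls) \<phi> y = degens (l # ls) \<phi> (Suc y) \<longleftrightarrow> y = l \<or> y \<in> set ls" for y
  proof (cases y l rule: linorder_cases)
    case less
    then show ?thesis using IH[of y] by (simp add: codegeneracy_def)
  next
    case greater
    then show ?thesis using IH[of "y - 1"] Cons.prems by (auto simp: codegeneracy_def)
  qed (simp add: codegeneracy_def)
  then show ?case by auto
qed

lemma surj_codegeneracy: "surj (codegeneracy l)"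
  by (rule surjI[of _ "coface (Suc l)"]) (simp add: codegeneracy_def coface_def)

lemma degens_inject:
  assumes "degens ls \<phi> = degens ls \<psi>"
  shows "\<phi> = \<psi>"
  using assms
proof (induction ls)
  case (Cons l ls)
  have "degens ls \<phi> x = degens ls \<psi> x" for x
  proof -
    obtain y where "x = codegeneracy l y" using surj_codegeneracy[of l] by auto
    then show ?thesis using fun_cong[OF Cons.prems, of y] by simp
  qed
  then show ?case using Cons.IH by blast
qed simp

section \<open>Uniqueness and existence of normal forms\<close>

abbreviation "Fcs \<equiv> map (case_prod Fc)"

abbreviation nf_word :: "(nat \<times> nat) list \<Rightarrow> (nat \<times> nat) list \<Rightarrow> basic list" where
  "nf_word ss ds \<equiv> map (case_prod Dg) ss @ Fcs ds"

lemma wmap_nf_word: "wmap (nf_word ss ds) = degens (map snd ss) (faces (map snd ds))"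
proof -
  have "wmap (Fcs ds) = faces (map snd ds)"
    by (induction ds) auto
  then show ?thesis by (induction ss) auto
qed

text \<open>The superscripts are recovered letter by letter from the right, starting at the common
  source \<open>n\<close>.\<close>

lemma nf_word_shape:
  assumes "path n (nf_word ss ds)" "path n (nf_word ss' ds')"
    "map snd ss = map snd ss'" "map snd ds = map snd ds'"
  shows "ss = ss' \<and> ds = ds'"
proof -
  have "ds = ds'" if "path n (Fcs ds)" "path n (map (case_prod Fc) ds')"
    "map snd ds = map snd ds'" for ds ds'
    using that
  proof (induction ds arbitrary: ds')
    case (Cons d ds)
    obtain d' ds'' where ds': "ds' = d' # ds''" using Cons.prems(3) by (cases ds') auto
    with Cons have "ds = ds''" by (simp add: split_beta)
    with Cons.prems ds' show ?case by (simp add: split_beta prod_eq_iff)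
  qed simp
  moreover have "path n (Fcs ds)" if "path n (nf_word ss ds)" for ss ds
    using that by (induction ss) auto
  ultimately have ds: "ds = ds'"
    using assms by blast
  have "ss = ss'"
    using assms(1,2,3) unfolding ds[symmetric]
  proof (induction ss arbitrary: ss')
    case (Cons s ss)
    obtain s' ss'' where ss': "ss' = s' # ss''" using Cons.prems(3) by (cases ss') auto
    with Cons have "ss = ss''" by (simp add: split_beta)
    \<comment> \<open>A degeneracy into \<open>n\<close> has source \<open>n - 1\<close>, and this
      determines \<open>n\<close> only because \<open>n\<close> is positive.\<close>
    moreover have "1 \<le> fst s" "1 \<le> fst s'" using Cons.prems ss' by (simp_all add: split_beta)
    moreover have "fst s - 1 = fst s' - 1" "snd s = snd s'"
      using Cons.prems ss' \<open>ss = ss''\<close> by (simp_all add: split_beta)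
    ultimately show ?case
      using ss' by (simp add: prod_eq_iff)
  qed simp
  with ds show ?thesis by simp
qed

text \<open>The collapsed steps determine the degeneracy indices. Degeneracies are surjective and
  can be cancelled, after which the omitted values determine the face indices.\<close>

lemma nf_word_unique:
  assumes "path n (nf_word ss ds)" "path n (nf_word ss' ds')"
    "sorted_wrt (>) (map snd ss)" "sorted_wrt (\<ge>) (map snd ds)"
    "sorted_wrt (>) (map snd ss')" "sorted_wrt (\<ge>) (map snd ds')"
    "wmap (nf_word ss ds) = wmap (nf_word ss' ds')"
  shows "ss = ss' \<and> ds = ds'"
proof -
  have inj: "inj (faces js)" for js
    using strict_mono_faces strict_mono_imp_inj_on by blast
  have eq: "degens (map snd ss) (faces (map snd ds)) = degens (map snd ss') (faces (map snd ds'))"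
    using assms(7) by (simp add: wmap_nf_word)
  then have "set (map snd ss) = set (map snd ss')"
    using set_degens[OF assms(3) inj, of "map snd ds"] set_degens[OF assms(5) inj, of "map snd ds'"]
    by simp
  then have ss: "map snd ss = map snd ss'"
    using assms(3,5) strict_desc_unique by blast
  then have "faces (map snd ds) = faces (map snd ds')"
    using eq degens_inject by metis
  then have "map snd ds = map snd ds'"
    using assms(4,6) faces_inject by blast
  with ss show ?thesis
    using assms(1,2) nf_word_shape by blast
qed

text \<open>The letter applied last accounts for the largest omitted value \<open>v\<close>.
  Inserting \<open>v\<close> into \<open>\<phi>\<close> at its place \<open>j\<close> gives
  \<open>\<psi>\<close>, which omits one value fewer and satisfies
  \<open>\<phi> = \<psi> \<circ> coface j\<close>.\<close>

lemma faces_exist: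
  assumes "strict_mono \<phi>" "\<And>x. t < x \<Longrightarrow> \<phi> x + t = x + s"
  shows "\<exists>ds. path s (Fcs ds) \<and> endpoint s (Fcs ds) = t \<and>
    sorted_wrt (\<ge>) (map snd ds) \<and> wmap (Fcs ds) = \<phi>"
  using assms
proof (induction "s - t" arbitrary: t \<phi> rule: less_induct)
  case less
  have inc: "x \<le> \<phi> x" for x
    using less.prems(1) strict_mono_imp_increasing by blast
  show ?case
  proof (cases "range \<phi> = UNIV")
    case True
    have "\<phi> x = x" for x
    proof (induction x rule: less_induct)
      case (less x)
      obtain y where "\<phi> y = x" using True by (metis surjD)
      with inc[of y] less[of y] show ?case by (cases "y = x") auto
    qed
    then have "\<phi> = id" "s = t" using less.prems(2)[of "Suc t"] by auto
    then show ?thesis by (intro exI[of _ "[]"]) simp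
  next
    case False
    have big: "x \<in> range \<phi>" if "s < x" for x
      using less.prems(2)[of "x - s + t"] that by (intro image_eqI[of _ _ "x - s + t"]) auto
    then have "- range \<phi> \<subseteq> {..s}" by (auto simp: not_less[symmetric])
    then have fin: "finite (- range \<phi>)" using finite_subset by blast
    define v where "v = Max (- range \<phi>)"
    have v: "v \<notin> range \<phi>" and v_max: "\<And>x. v < x \<Longrightarrow> x \<in> range \<phi>"
      using Max_in[OF fin] Max_ge[OF fin] False unfolding v_def by (auto simp: not_le[symmetric])
    define j where "j = (LEAST x. v < \<phi> x)"
    have j: "v < \<phi> j"
      unfolding j_def by (rule LeastI[of _ "Suc v"]) (use inc[of "Suc v"] in simp)
    have below: "\<phi> x < v" if "x < j" for x
      using not_less_Least[of x "\<lambda>x. v < \<phi> x"] that v by (auto simp: j_def not_less le_less)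
    have above: "v < \<phi> x" if "j \<le> x" for x
      using strict_mono_less_eq[OF less.prems(1)] that j by (meson less_le_trans)
    have "v \<le> s" using v big by (meson not_le)
    moreover have "\<phi> (Suc t) = Suc s" using less.prems(2)[of "Suc t"] by simp
    ultimately have "j \<le> Suc t" using below[of "Suc t"] by (cases "Suc t < j") auto
    define \<psi> where "\<psi> x = (if x < j then \<phi> x else if x = j then v else \<phi> (x - 1))" for x
    have sm: "strict_mono \<psi>"
      unfolding strict_mono_Suc_iff \<psi>_def
      using below above strict_mono_less[OF less.prems(1)] by (auto simp: not_less_eq)
    have \<psi>_big: "\<psi> x + Suc t = x + s" if "Suc t < x" for x
      using less.prems(2)[of "x - 1"] that \<open>j \<le> Suc t\<close> by (auto simp: \<psi>_def)
    have "Suc t \<le> s"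
      \<comment> \<open>A strictly increasing map never falls below the diagonal; at
        \<open>t + 2\<close> this bounds the new target by \<open>s\<close>, so the measure
        \<open>s - t\<close> drops.\<close>
      using strict_mono_imp_increasing[OF sm, of "Suc (Suc t)"] \<psi>_big[of "Suc (Suc t)"] by simp
    then have "s - Suc t < s - t" by simp
    from less.hyps[OF this sm \<psi>_big] obtain ds where ds: "path s (Fcs ds)"
      "endpoint s (Fcs ds) = Suc t"
      "sorted_wrt (\<ge>) (map snd ds)" "wmap (Fcs ds) = \<psi>"
      by auto
    have \<psi>: "\<psi> = faces (map snd ds)" using ds(4) wmap_nf_word[of "[]" ds] by simp
    have ran: "- range \<psi> \<subseteq> {..<v}"
    proof -
      have "x \<in> range \<psi>" if le: "v \<le> x" for x
      proof (cases "x = v")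
        case True
        then show ?thesis by (intro image_eqI[of _ _ j]) (simp_all add: \<psi>_def)
      next
        case False
        then obtain y where "x = \<phi> y" using le v_max[of x] by auto
        then have "j \<le> y" using below[of y] le by (meson not_le)
        then show ?thesis using \<open>x = \<phi> y\<close> by (intro image_eqI[of _ _ "Suc y"]) (auto simp: \<psi>_def)
      qed
      then show ?thesis by (auto simp: not_le[symmetric])
    qed
    \<comment> \<open>The head \<open>e\<close> of \<open>ds\<close> has the largest index. Its
      omitted value is below \<open>v\<close>, and \<open>\<psi>\<close> at \<open>snd e\<close> is
      the next value, hence at most \<open>v\<close>, which is \<open>\<psi> j\<close>.\<close>
    have ge: "snd d \<le> j" if d: "d \<in> set ds" for d
    proof -
      obtain e ds' where e: "ds = e # ds'" using d by (cases ds) auto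
      have *: "faces (map snd ds) (snd e) = snd e + length ds"
        using ds(3) e by (intro trans[OF faces_above]) auto
      have "snd e + length ds' \<in> - range \<psi>"
        using set_omitted[OF ds(3)] e unfolding \<psi> by auto
      then have "snd e + length ds' < v" using ran by blast
      moreover have "\<psi> (snd e) = Suc (snd e + length ds')" using * e unfolding \<psi> by simp
      ultimately have "\<psi> (snd e) \<le> \<psi> j" unfolding \<psi>_def by simp
      then have "snd e \<le> j" using sm by (simp add: strict_mono_less_eq)
      then show ?thesis using ds(3) e d by auto
    qed
    have "\<phi> = \<psi> \<circ> coface j" by (auto simp: fun_eq_iff \<psi>_def coface_def)
    then show ?thesis
      using ds ge \<open>j \<le> Suc t\<close> by (intro exI[of _ "(Suc t, j) # ds"]) auto
  qed
qed

text \<open>The degeneracy applied last accounts for the largest collapsed step \<open>l\<close>.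
  The remaining map \<open>\<psi>\<close> collapses only steps below \<open>l\<close>; a map that
  collapses none is strictly monotone and consists of faces.\<close>

lemma nf_word_exists:
  assumes "mono \<phi>" "\<And>x. t < x \<Longrightarrow> \<phi> x + t = x + s" "\<phi> t \<le> s"
  shows "\<exists>ss ds. path s (nf_word ss ds) \<and> endpoint s (nf_word ss ds) = t \<and>
    sorted_wrt (>) (map snd ss) \<and> sorted_wrt (\<ge>) (map snd ds) \<and> wmap (nf_word ss ds) = \<phi>"
  using assms
proof (induction t arbitrary: \<phi> rule: less_induct)
  case (less t)
  let ?S = "{y. \<phi> y = \<phi> (Suc y)}"
  show ?case
  proof (cases "?S = {}")
    case True
    then have "strict_mono \<phi>"
      unfolding strict_mono_Suc_iff using monoD[OF less.prems(1)]
      by (metis (mono_tags, lifting) empty_iff le_SucI le_eq_less_or_eq mem_Collect_eq order_refl)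
    then obtain ds where "path s (Fcs ds)" "endpoint s (Fcs ds) = t"
      "sorted_wrt (\<ge>) (map snd ds)" "wmap (Fcs ds) = \<phi>"
      using faces_exist less.prems by blast
    then show ?thesis by (intro exI[of _ "[]"] exI[of _ ds]) simp
  next
    case False
    \<comment> \<open>Above \<open>t\<close> the map is a translation, and the step at
      \<open>t\<close> is not collapsed because
      \<open>\<phi> t \<le> s < \<phi> (t + 1)\<close>.\<close>
    have small: "y < t" if "y \<in> ?S" for y
      using less.prems(2)[of y] less.prems(2)[of "Suc y"] less.prems(3) that
      by (cases y t rule: linorder_cases) auto
    then have fin: "finite ?S" by (meson finite_nat_set_iff_bounded)
    define l where "l = Max ?S"
    have l: "\<phi> l = \<phi> (Suc l)" and l_max: "\<And>y. l < y \<Longrightarrow> \<phi> y \<noteq> \<phi> (Suc y)"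
      using Max_in[OF fin False] Max_ge[OF fin] unfolding l_def by (auto simp: not_le[symmetric])
    have "l < t" using small l by simp
    \<comment> \<open>\<open>coface (Suc l)\<close> is a section of \<open>codegeneracy l\<close>,
      so \<open>\<phi>\<close> factors through the latter by \<open>\<psi>\<close>.\<close>
    define \<psi> where "\<psi> = \<phi> \<circ> coface (Suc l)"
    have "mono \<psi>"
      unfolding \<psi>_def using less.prems(1) strict_mono_mono[OF strict_mono_coface]
      by (auto simp: mono_def)
    moreover have "\<psi> x + (t - 1) = x + s" if "t - 1 < x" for x
      using less.prems(2)[of "Suc x"] that \<open>l < t\<close> by (auto simp: \<psi>_def coface_def)
    moreover have "\<psi> (t - 1) \<le> s"
      using monoD[OF less.prems(1), of "t - 1" t] less.prems(3) \<open>l < t\<close>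
      by (auto simp: \<psi>_def coface_def)
    ultimately obtain ss ds where w: "path s (nf_word ss ds)" "endpoint s (nf_word ss ds) = t - 1"
      "sorted_wrt (>) (map snd ss)" "sorted_wrt (\<ge>) (map snd ds)" "wmap (nf_word ss ds) = \<psi>"
      using less.IH[of "t - 1" \<psi>] \<open>l < t\<close> by auto
    have "inj (faces js)" for js
      using strict_mono_faces strict_mono_imp_inj_on by blast
    then have set: "set (map snd ss) = {y. \<psi> y = \<psi> (Suc y)}"
      using set_degens[OF w(3), of "faces (map snd ds)"] w(5) by (simp add: wmap_nf_word)
    have lt: "y < l" if "\<psi> y = \<psi> (Suc y)" for y
    proof (rule ccontr)
      assume "\<not> y < l"
      then show False
        using that l l_max[of "Suc y"] by (cases "y = l") (auto simp: \<psi>_def coface_def)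
    qed
    have "\<phi> x = \<psi> (codegeneracy l x)" for x
      using l by (cases x "Suc l" rule: linorder_cases) (auto simp: \<psi>_def coface_def codegeneracy_def)
    then have "\<phi> = \<psi> \<circ> codegeneracy l" by auto
    moreover have "\<forall>y\<in>set (map snd ss). y < l" using set lt by auto
    ultimately show ?thesis
      using w \<open>l < t\<close> by (intro exI[of _ "(t, l) # ss"] exI[of _ ds]) auto
  qed
qed

lemma nf_exists_unique:
  assumes f: "f \<in> Arr delta_op"
  shows "\<exists>!w. is_nf w \<and> word_arr w = f"
proof -
  \<comment> \<open>Every normal form is an \<open>nf_word\<close>, the empty one being spelled with
    an identity letter.\<close>
  have nf_cases: "\<exists>ss ds. path (dsrc f) (nf_word ss ds) \<and>
      sorted_wrt (>) (map snd ss) \<and> sorted_wrt (\<ge>) (map snd ds) \<and> wmap (nf_word ss ds) = ext f \<and>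
      w = (if nf_word ss ds = [] then [Id1 (dsrc f)] else nf_word ss ds)"
    if "is_nf w" "word_arr w = f" for w
    using that(1) unfolding is_nf_def
  proof
    assume "\<exists>n. w = [Id1 n]"
    then obtain n where "w = [Id1 n]" by blast
    then show ?thesis
      using that(2) by (intro exI[of _ "[]"]) (auto simp: word_arr_def)
  next
    assume "is_word w \<and> (\<exists>ss ds. w = nf_word ss ds \<and>
      sorted_wrt (>) (map snd ss) \<and> sorted_wrt (\<ge>) (map snd ds))"
    then show ?thesis
      using that(2) word_arr_path[of w] by (auto simp: is_word_iff_path)
  qed
  obtain ss ds where w: "path (dsrc f) (nf_word ss ds)" "endpoint (dsrc f) (nf_word ss ds) = dtgt f"
    "sorted_wrt (>) (map snd ss)" "sorted_wrt (\<ge>) (map snd ds)" "wmap (nf_word ss ds) = ext f"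
    using nf_word_exists[of "ext f" "dtgt f" "dsrc f"] f ext_le[OF f, of "dtgt f"]
    by (auto simp: ext_def)
  define w0 where "w0 = (if nf_word ss ds = [] then [Id1 (dsrc f)] else nf_word ss ds)"
  have "is_nf w0 \<and> word_arr w0 = f"
  proof (cases "nf_word ss ds = []")
    case True
    then show ?thesis
      using w f by (auto simp: w0_def is_nf_def word_arr_def intro!: delta_op_eqI)
  next
    case False
    then have word: "is_word (nf_word ss ds)" "bsrc (last (nf_word ss ds)) = dsrc f"
      "btgt (hd (nf_word ss ds)) = dtgt f"
      using w path_last[of _ "nf_word ss ds"] by (auto simp: is_word_iff_path endpoint_hd)
    then have "is_nf w0"
      using w False unfolding w0_def is_nf_def by auto
    moreover have "word_arr w0 = f"
      using word_arr_path[OF word(1)] word w(5) f False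
      unfolding w0_def by (auto intro!: delta_op_eqI)
    ultimately show ?thesis ..
  qed
  moreover have "w' = w0" if "is_nf w'" "word_arr w' = f" for w'
    using nf_cases[OF that] w nf_word_unique unfolding w0_def by metis
  ultimately show ?thesis by blast
qed

lemma nf_word_arr:
  assumes "f \<in> Arr delta_op"
  shows "is_nf (nf f)" "word_arr (nf f) = f"
  using theI'[OF nf_exists_unique[OF assms]] by (simp_all add: nf_def)

lemma is_nf_is_word: "is_nf w \<Longrightarrow> is_word w"
  by (auto simp: is_nf_def)

abbreviation proper :: "basic \<Rightarrow> bool" where
  "proper b \<equiv> \<forall>n. b \<noteq> Id1 n"

lemma nf_path:
  assumes f: "f \<in> Arr delta_op"
  shows "path (dsrc f) (filter proper (nf f))" "endpoint (dsrc f) (filter proper (nf f)) = dtgt f"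
    "wmap (filter proper (nf f)) = ext f"
proof -
  note nf = nf_word_arr[OF f] and word = word_arr_path[OF is_nf_is_word[OF nf_word_arr(1)[OF f]]]
  have "path (dsrc f) (filter proper (nf f)) \<and> endpoint (dsrc f) (filter proper (nf f)) = dtgt f \<and>
    wmap (filter proper (nf f)) = ext f"
  proof (cases "\<exists>n. nf f = [Id1 n]")
    case True
    then show ?thesis using nf word by auto
  next
    case False
    then obtain ss ds where "nf f = nf_word ss ds" "is_word (nf f)"
      using nf(1) unfolding is_nf_def by blast
    moreover from this have "\<forall>b\<in>set (nf f). proper b"
      by auto
    then have "filter proper (nf f) = nf f"
      by (intro filter_True)
    ultimately show ?thesis
      using nf word by (simp add: is_word_iff_path endpoint_hd)
  qed
  then show "path (dsrc f) (filter proper (nf f))"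
    "endpoint (dsrc f) (filter proper (nf f)) = dtgt f" "wmap (filter proper (nf f)) = ext f"
    by auto
qed

section \<open>Lists as arrays\<close>

lemma length_concat_uniform: "\<forall>v\<in>set vs. length v = p \<Longrightarrow> length (concat vs) = length vs * p"
  by (induction vs) auto

lemma nth_concat_uniform:
  "\<lbrakk>\<forall>v\<in>set vs. length v = p; i < length vs; z < p\<rbrakk> \<Longrightarrow> concat vs ! (i * p + z) = vs ! i ! z"
proof (induction vs arbitrary: i)
  case (Cons v vs)
  then show ?case
    by (cases i) (simp_all add: nth_append add.assoc)
qed simp

lemma mult_add_less: "\<lbrakk>i < n; z < p\<rbrakk> \<Longrightarrow> i * p + z < n * (p :: nat)"
proof -
  assume "i < n" "z < p"
  then have "i * p + z < Suc i * p" by simp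
  also have "\<dots> \<le> n * p" using \<open>i < n\<close> by (intro mult_le_mono1) simp
  finally show ?thesis .
qed

lemma length_blocks [simp]: "length (blocks n p xs) = n"
  by (simp add: blocks_def)

lemma blocks_uniform:
  assumes "length xs = n * p" "v \<in> set (blocks n p xs)"
  shows "length v = p" "set v \<subseteq> set xs"
proof -
  obtain i where i: "i < n" "v = take p (drop (i * p) xs)"
    using assms(2) by (auto simp: blocks_def)
  have "p + i * p \<le> n * p"
    using mult_le_mono1[of "Suc i" n p] i(1) by simp
  with i assms(1) show "length v = p" by simp
  show "set v \<subseteq> set xs"
    using i(2) set_take_subset set_drop_subset by fastforce
qed

lemma nth_blocks:
  assumes "length xs = n * p" "i < n" "z < p"
  shows "blocks n p xs ! i ! z = xs ! (i * p + z)"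
  using assms mult_add_less[of i n z p] by (simp add: blocks_def)

lemma (in monoid_on) monoid_on_blocks:
  "monoid_on {v. length v = p \<and> set v \<subseteq> S} (map2 t) (replicate p e)"
proof
  fix x y z :: "'x list"
  show "x \<in> {v. length v = p \<and> set v \<subseteq> S} \<Longrightarrow> y \<in> {v. length v = p \<and> set v \<subseteq> S} \<Longrightarrow>
      map2 t x y \<in> {v. length v = p \<and> set v \<subseteq> S}"
    by (auto simp: set_zip intro!: closed)
  show "replicate p e \<in> {v. length v = p \<and> set v \<subseteq> S}"
    by (auto simp: unit_closed)
  show "map2 t (map2 t x y) z = map2 t x (map2 t y z)"
    if "x \<in> {v. length v = p \<and> set v \<subseteq> S}" "y \<in> {v. length v = p \<and> set v \<subseteq> S}"
      "z \<in> {v. length v = p \<and> set v \<subseteq> S}"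
    using that by (intro nth_equalityI) (auto intro!: assoc simp: subset_iff)
  show "map2 t (replicate p e) x = x" "map2 t x (replicate p e) = x"
    if "x \<in> {v. length v = p \<and> set v \<subseteq> S}"
    using that by (auto intro!: nth_equalityI left_unit right_unit simp: subset_iff)
qed

lemma nth_tfold_map2:
  assumes "z < p" "\<And>j. j \<in> set J \<Longrightarrow> length (F j) = p"
  shows "length (tfold (map2 t) (replicate p e) J F) = p \<and>
    tfold (map2 t) (replicate p e) J F ! z = tfold t e J (\<lambda>j. F j ! z)"
  using assms(2) by (induction J) (auto simp: assms(1))

lemma mono_bmap: "mono (bmap b)"
  by (cases b) (auto simp: mono_def coface_def codegeneracy_def)

lemma mono_wmap: "mono (wmap w)"
  using mono_bmap by (induction w) (auto simp: mono_def)

lemma bmap_le: "\<lbrakk>valid_basic b; i \<le> btgt b\<rbrakk> \<Longrightarrow> bmap b i \<le> bsrc b"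
  by (cases b) (auto simp: coface_def codegeneracy_def)

lemma wmap_le: "\<lbrakk>path n w; i \<le> endpoint n w\<rbrakk> \<Longrightarrow> wmap w i \<le> n"
proof (induction w arbitrary: i)
  case (Cons b w)
  then show ?case using bmap_le[of b i] by auto
qed simp

lemma set_block_less:
  assumes "i < endpoint n w" "path n w" "j \<in> set (block (wmap w) i)"
  shows "j < n"
  using assms wmap_le[of n w "Suc i"] by (auto simp: block_def)

lemma block_coface:
  "block (coface j) i = (if Suc i < j then [i] else if Suc i = j then [i, Suc i] else [Suc i])"
  by (auto simp: block_def coface_def)

lemma block_codegeneracy:
  "block (codegeneracy j) i = (if i < j then [i] else if i = j then [] else [i - 1])"
  by (cases i) (auto simp: block_def codegeneracy_def)

context monoid_on
begin

text \<open>The cases of \<open>wbar\<close> differ only in the block shapes: an outer face skips an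
  end coordinate, an inner face has one block of length two, and a degeneracy has one empty block.
  The unit at the end of each \<open>tfold\<close> is absorbed by \<open>right_unit\<close>.\<close>

lemma wbar_eq:
  assumes "valid_basic b" "length ys = bsrc b" "set ys \<subseteq> S"
  shows "wbar t e b ys = map (\<lambda>i. tfold t e (block (bmap b) i) ((!) ys)) [0..<btgt b]"
proof -
  have S: "ys ! i \<in> S" if "i < length ys" for i
    using that assms(3) by auto
  show ?thesis
  proof (cases b)
    case (Id1 n)
    then show ?thesis
      using assms by (auto intro!: nth_equalityI simp: block_def S right_unit)
  next
    case (Fc n j)
    consider "j = 0" | "j = n" "0 < j" | "0 < j" "j < n" using Fc assms(1) by fastforce
    then show ?thesis
    proof cases
      case 1
      with Fc show ?thesis
        using assms by (intro nth_equalityI) (simp_all add: block_coface S right_unit nth_tl)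
    next
      case 2
      with Fc show ?thesis
        using assms by (intro nth_equalityI) (auto simp: block_coface S right_unit nth_butlast)
    next
      case 3
      with Fc show ?thesis
        using assms
        by (intro nth_equalityI) (auto simp: block_coface S right_unit nth_append min_def nth_Cons')
    qed
  next
    case (Dg n j)
    then show ?thesis
      using assms
      by (intro nth_equalityI)
        (auto simp: block_codegeneracy S right_unit nth_append min_def nth_Cons')
  qed
qed

lemma foldr_wbar_eq:
  assumes "path n w" "length ys = n" "set ys \<subseteq> S"
  shows "foldr (wbar t e) w ys = map (\<lambda>i. tfold t e (block (wmap w) i) ((!) ys)) [0..<endpoint n w]"
  using assms(1)
proof (induction w)
  case Nil
  show ?case
    using assms by (auto intro!: nth_equalityI simp: block_def subset_iff right_unit[symmetric])
next
  case (Cons b w)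
  let ?ys = "map (\<lambda>i. tfold t e (block (wmap w) i) ((!) ys)) [0..<endpoint n w]"
  have S: "ys ! j \<in> S" if "j \<in> set (block (wmap w) i)" "i < endpoint n w" for i j
    using that set_block_less[of i n w j] Cons.prems assms by auto
  have S': "set ?ys \<subseteq> S"
    using S by (auto intro!: tfold_closed)
  have less: "i' < endpoint n w" if "i < btgt b" "i' \<in> set (block (bmap b) i)" for i i'
    using that bmap_le[of b "Suc i"] Cons.prems by (auto simp: block_def)
  have "foldr (wbar t e) (b # w) ys = wbar t e b ?ys"
    using Cons by simp
  also have "\<dots> = map (\<lambda>i. tfold t e (block (bmap b) i) ((!) ?ys)) [0..<btgt b]"
    using Cons.prems S' by (intro wbar_eq) auto
  also have "\<dots> = map (\<lambda>i. tfold t e (block (wmap (b # w)) i) ((!) ys)) [0..<endpoint n (b # w)]"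
  proof (intro list.map_cong0[OF _] refl map_cong)
    show "[0..<btgt b] = [0..<endpoint n (b # w)]" by simp
    fix i assume "i \<in> set [0..<endpoint n (b # w)]"
    then have i: "i < btgt b" by simp
    have "tfold t e (block (bmap b) i) ((!) ?ys) =
        tfold t e (block (bmap b) i) (\<lambda>i'. tfold t e (block (wmap w) i') ((!) ys))"
      using less[OF i] by (intro tfold_cong) simp
    also have "\<dots> = tfold t e (concat (map (block (wmap w)) (block (bmap b) i))) ((!) ys)"
      using S less[OF i] by (intro tfold_concat[symmetric]) auto
    finally show "tfold t e (block (bmap b) i) ((!) ?ys) = tfold t e (block (wmap (b # w)) i) ((!) ys)"
      by (simp add: block_comp mono_bmap mono_wmap)
  qed
  finally show ?case .
qed

lemma wbar_pow_nth:
  assumes w: "is_word w" "bsrc (last w) = n" "btgt (hd w) = n'"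
    and xs: "length xs = n * p" "set xs \<subseteq> S"
  shows "length (wbar_pow t e p w xs) = n' * p"
    "\<lbrakk>i < n'; z < p\<rbrakk> \<Longrightarrow>
      wbar_pow t e p w xs ! (i * p + z) = tfold t e (block (wmap w) i) (\<lambda>j. xs ! (j * p + z))"
proof -
  \<comment> \<open>The \<open>p\<close>-th power is handled as one monoid of blocks and read
    coordinatewise afterwards.\<close>
  interpret B: monoid_on "{v. length v = p \<and> set v \<subseteq> S}" "map2 t" "replicate p e"
    by (rule monoid_on_blocks)
  have path: "path n w" "endpoint n w = n'"
    using w by (auto simp: is_word_iff_path endpoint_hd)
  let ?B = "blocks n p xs"
  let ?f = "\<lambda>i. tfold (map2 t) (replicate p e) (block (wmap w) i) ((!) ?B)"
  have B: "?B ! j \<in> {v. length v = p \<and> set v \<subseteq> S}" if "j < n" for j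
    using that blocks_uniform[OF xs(1), of "?B ! j"] xs(2) by auto
  have f: "foldr (wbar (map2 t) (replicate p e)) w ?B = map ?f [0..<n']"
    using blocks_uniform[OF xs(1)] xs(2) path by (subst B.foldr_wbar_eq[of n]) auto
  have mem: "?f i \<in> {v. length v = p \<and> set v \<subseteq> S}" if "i < n'" for i
    using that B set_block_less[of i n w] path by (intro B.tfold_closed) auto
  then have uni: "\<forall>v\<in>set (map ?f [0..<n']). length v = p" by auto
  show "length (wbar_pow t e p w xs) = n' * p"
    using w length_concat_uniform[OF uni] by (simp add: wbar_pow_def f)
  assume iz: "i < n'" "z < p"
  have "wbar_pow t e p w xs ! (i * p + z) = ?f i ! z"
    using w iz nth_concat_uniform[OF uni, of i z] by (simp add: wbar_pow_def f)
  also have "\<dots> = tfold t e (block (wmap w) i) (\<lambda>j. ?B ! j ! z)"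
    using nth_tfold_map2[OF iz(2), of "block (wmap w) i" "(!) ?B"] B set_block_less[of i n w] iz path
    by auto
  also have "\<dots> = tfold t e (block (wmap w) i) (\<lambda>j. xs ! (j * p + z))"
    using nth_blocks[OF xs(1) _ iz(2)] set_block_less[of i n w] iz path by (intro tfold_cong) auto
  finally show "wbar_pow t e p w xs ! (i * p + z) =
      tfold t e (block (wmap w) i) (\<lambda>j. xs ! (j * p + z))" .
qed

lemma wbar_pows_nth:
  assumes w: "is_word w" "bsrc (last w) = n" "btgt (hd w) = n'"
    and xs: "length xs = r * n * p" "set xs \<subseteq> S"
  shows "length (wbar_pows t e p r w xs) = r * n' * p"
    "\<lbrakk>x < r; i < n'; z < p\<rbrakk> \<Longrightarrow> wbar_pows t e p r w xs ! ((x * n' + i) * p + z) =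
      tfold t e (block (wmap w) i) (\<lambda>j. xs ! ((x * n + j) * p + z))"
proof -
  have path: "path n w" "endpoint n w = n'"
    using w by (auto simp: is_word_iff_path endpoint_hd)
  let ?B = "blocks r (n * p) xs"
  have xs': "length xs = r * (n * p)" using xs by simp
  have B: "length (?B ! x) = n * p" "set (?B ! x) \<subseteq> S" if "x < r" for x
    using that blocks_uniform[OF xs', of "?B ! x"] xs(2) by auto
  have uni: "\<forall>v\<in>set (map (wbar_pow t e p w) ?B). length v = n' * p"
  proof
    fix v assume "v \<in> set (map (wbar_pow t e p w) ?B)"
    then obtain u where u: "u \<in> set ?B" "v = wbar_pow t e p w u" by auto
    then show "length v = n' * p"
      using blocks_uniform[OF xs' u(1)] xs(2) wbar_pow_nth(1)[OF w] by auto
  qed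
  show "length (wbar_pows t e p r w xs) = r * n' * p"
    using w length_concat_uniform[OF uni] by (simp add: wbar_pows_def)
  assume xiz: "x < r" "i < n'" "z < p"
  have "wbar_pows t e p r w xs ! ((x * n' + i) * p + z) =
      concat (map (wbar_pow t e p w) ?B) ! (x * (n' * p) + (i * p + z))"
    using w by (simp add: wbar_pows_def algebra_simps)
  also have "\<dots> = wbar_pow t e p w (?B ! x) ! (i * p + z)"
    using nth_concat_uniform[OF uni, of x "i * p + z"] xiz mult_add_less[of i n' z p] by simp
  also have "\<dots> = tfold t e (block (wmap w) i) (\<lambda>j. ?B ! x ! (j * p + z))"
    using wbar_pow_nth(2)[OF w B(1)[OF xiz(1)] B(2)[OF xiz(1)] xiz(2,3)] .
  also have "\<dots> = tfold t e (block (wmap w) i) (\<lambda>j. xs ! ((x * n + j) * p + z))"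
  proof (intro tfold_cong)
    fix j assume "j \<in> set (block (wmap w) i)"
    then have "j < n" using set_block_less[of i n w] xiz path by auto
    then show "?B ! x ! (j * p + z) = xs ! ((x * n + j) * p + z)"
      using nth_blocks[OF xs' xiz(1), of "j * p + z"] mult_add_less[of j n z p] xiz(3)
      by (simp add: algebra_simps)
  qed
  finally show "wbar_pows t e p r w xs ! ((x * n' + i) * p + z) =
      tfold t e (block (wmap w) i) (\<lambda>j. xs ! ((x * n + j) * p + z))" .
qed

lemma wbar_pows_entry:
  assumes "is_word w" "bsrc (last w) = n" "btgt (hd w) = n'" "length xs = r * n * p" "set xs \<subseteq> S"
    and "x < r" "i < n'" "z < p" "\<And>j. j < n \<Longrightarrow> xs ! ((x * n + j) * p + z) = F j"
  shows "wbar_pows t e p r w xs ! ((x * n' + i) * p + z) = tfold t e (block (wmap w) i) F"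
proof -
  have "path n w" "endpoint n w = n'"
    using assms(1-3) by (auto simp: is_word_iff_path endpoint_hd)
  then show ?thesis
    unfolding wbar_pows_nth(2)[OF assms(1-8)]
    using set_block_less[of i n w] assms(7,9) by (intro tfold_cong) auto
qed

lemma wbar_pow_eq_pows:
  assumes "length xs = bsrc (last w) * p"
  shows "wbar_pow t e p w xs = wbar_pows t e p 1 w xs"
  using assms by (simp add: wbar_pows_def blocks_def)

end

text \<open>A relation, because a list fixes an array only inside the box of sizes
  \<open>s 1\<close>, \<open>s 2\<close>, \<open>s 3\<close>. Entries are in lexicographic order, as
  in the reduced bar construction.\<close>

definition lists_array :: "(nat \<Rightarrow> nat) \<Rightarrow> 'x list \<Rightarrow> 'x array \<Rightarrow> bool" where
  "lists_array s xs A \<longleftrightarrow> length xs = s 1 * s 2 * s 3 \<and>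
     (\<forall>r<s 1. \<forall>q<s 2. \<forall>z<s 3. xs ! ((r * s 2 + q) * s 3 + z) = A r q z)"

lemma index_cases:
  assumes "i < n * m * (p :: nat)"
  obtains r q z where "r < n" "q < m" "z < p" "i = (r * m + q) * p + z"
proof
  have "0 < p" "0 < m" using assms by (auto intro!: gr0I)
  then show "i mod p < p" "i div p mod m < m" by auto
  have "i div p < n * m" using assms by (simp add: less_mult_imp_div_less)
  then show "i div p div m < n" by (simp add: less_mult_imp_div_less)
  show "i = (i div p div m * m + i div p mod m) * p + i mod p" by simp
qed

text \<open>The means by which equations transfer: two lists agree as soon as both represent the
  same array for the same sizes.\<close>

lemma lists_array_unique:
  assumes "lists_array s xs A" "lists_array s ys A"
  shows "xs = ys"
proof (rule nth_equalityI)
  show "length xs = length ys" using assms by (simp add: lists_array_def)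
  fix i assume "i < length xs"
  then have "i < s 1 * s 2 * s 3" using assms by (simp add: lists_array_def)
  then show "xs ! i = ys ! i"
    by (rule index_cases) (use assms in \<open>auto simp: lists_array_def\<close>)
qed

lemma lists_array_set:
  assumes "lists_array s xs A" "\<And>r q z. A r q z \<in> S"
  shows "set xs \<subseteq> S"
proof
  fix x assume "x \<in> set xs"
  then obtain i where i: "i < length xs" "x = xs ! i" by (auto simp: in_set_conv_nth)
  then have "i < s 1 * s 2 * s 3" using assms by (simp add: lists_array_def)
  then show "x \<in> S"
    by (rule index_cases) (use assms i in \<open>auto simp: lists_array_def\<close>)
qed

lemma index_less: "\<lbrakk>r < n; q < m; z < p\<rbrakk> \<Longrightarrow> (r * m + q) * p + z < n * m * (p :: nat)"
  by (intro mult_add_less)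

lemma lists_array_exists:
  assumes "length xs = s 1 * s 2 * s 3" "set xs \<subseteq> S" "d \<in> S"
  obtains A where "lists_array s xs A" "\<And>r q z. A r q z \<in> S"
proof
  \<comment> \<open>The value \<open>d\<close> outside the box is arbitrary in \<open>S\<close>; it
    only keeps the array total.\<close>
  let ?A = "\<lambda>r q z. if r < s 1 \<and> q < s 2 \<and> z < s 3 then xs ! ((r * s 2 + q) * s 3 + z) else d"
  show "lists_array s xs ?A" using assms(1) by (simp add: lists_array_def)
  show "?A r q z \<in> S" for r q z
    using assms index_less[of r "s 1" q "s 2" z "s 3"] by auto
qed

lemma lists_array_map:
  assumes "lists_array s xs A"
  shows "lists_array s (map f xs) (\<lambda>r q z. f (A r q z))"
  using assms index_less[of _ "s 1" _ "s 2" _ "s 3"] by (simp add: lists_array_def)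

lemma lists_array_map2:
  assumes "lists_array s xs A" "lists_array s ys B"
  shows "lists_array s (map2 f xs ys) (\<lambda>r q z. f (A r q z) (B r q z))"
  using assms index_less[of _ "s 1" _ "s 2" _ "s 3"] by (simp add: lists_array_def)

definition act :: "(nat \<Rightarrow> 'x \<Rightarrow> 'x \<Rightarrow> 'x) \<Rightarrow> (nat \<Rightarrow> 'x) \<Rightarrow> nat \<Rightarrow> (nat \<Rightarrow> nat) \<Rightarrow> 'x array \<Rightarrow> 'x array" where
  "act t e k = (if k = 1 then act1 (t 1) (e 1) else if k = 2 then act2 (t 2) (e 2)
     else act3 (t 3) (e 3))"

text \<open>The powers place the acting direction among the others: for direction 1 the remaining
  coordinates form one inner index, for direction 3 one outer index, and direction 2 has one on each
  side.\<close>

lemma (in monoid_on) wbar_pows_act1: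
  assumes "lists_array s xs A" "\<And>r q z. A r q z \<in> S" "is_word w" "bsrc (last w) = s 1"
  shows "lists_array (s(1 := btgt (hd w))) (wbar_pows t e (s 2 * s 3) 1 w xs) (act1 t e (wmap w) A)"
proof -
  have xs: "length xs = 1 * s 1 * (s 2 * s 3)" "set xs \<subseteq> S"
    using assms(1) lists_array_set[OF assms(1,2)] by (simp_all add: lists_array_def)
  have "wbar_pows t e (s 2 * s 3) 1 w xs ! ((0 * btgt (hd w) + r) * (s 2 * s 3) + (q * s 3 + z)) = act1 t e (wmap w) A r q z"
    if "r < btgt (hd w)" "q < s 2" "z < s 3" for r q z
    unfolding act1_def using that assms(1)
    by (intro wbar_pows_entry[OF assms(3,4) refl xs])
      (use mult_add_less[of q "s 2" z "s 3"] in \<open>simp_all add: lists_array_def algebra_simps\<close>)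
  then show ?thesis
    using wbar_pows_nth(1)[OF assms(3,4) refl xs] by (simp add: lists_array_def algebra_simps)
qed

lemma (in monoid_on) wbar_pows_act2:
  assumes "lists_array s xs A" "\<And>r q z. A r q z \<in> S" "is_word w" "bsrc (last w) = s 2"
  shows "lists_array (s(2 := btgt (hd w))) (wbar_pows t e (s 3) (s 1) w xs) (act2 t e (wmap w) A)"
proof -
  have xs: "length xs = (s 1) * s 2 * (s 3)" "set xs \<subseteq> S"
    using assms(1) lists_array_set[OF assms(1,2)] by (simp_all add: lists_array_def)
  have "wbar_pows t e (s 3) (s 1) w xs ! ((r * btgt (hd w) + q) * s 3 + z) = act2 t e (wmap w) A r q z"
    if "r < s 1" "q < btgt (hd w)" "z < s 3" for r q z
    unfolding act2_def using that assms(1)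
    by (intro wbar_pows_entry[OF assms(3,4) refl xs]) (simp_all add: lists_array_def)
  then show ?thesis
    using wbar_pows_nth(1)[OF assms(3,4) refl xs] by (simp add: lists_array_def)
qed

lemma (in monoid_on) wbar_pows_act3:
  assumes "lists_array s xs A" "\<And>r q z. A r q z \<in> S" "is_word w" "bsrc (last w) = s 3"
  shows "lists_array (s(3 := btgt (hd w))) (wbar_pows t e 1 (s 1 * s 2) w xs) (act3 t e (wmap w) A)"
proof -
  have xs: "length xs = (s 1 * s 2) * s 3 * 1" "set xs \<subseteq> S"
    using assms(1) lists_array_set[OF assms(1,2)] by (simp_all add: lists_array_def)
  have "wbar_pows t e 1 (s 1 * s 2) w xs ! (((r * s 2 + q) * btgt (hd w) + z) * 1 + 0) = act3 t e (wmap w) A r q z"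
    if "r < s 1" "q < s 2" "z < btgt (hd w)" for r q z
    unfolding act3_def using that assms(1)
    by (intro wbar_pows_entry[OF assms(3,4) refl xs]) (simp_all add: lists_array_def mult_add_less)
  then show ?thesis
    using wbar_pows_nth(1)[OF assms(3,4) refl xs] by (simp add: lists_array_def)
qed

section \<open>Elements of a single colour in the combined action\<close>

definition slot :: "'e \<Rightarrow> nat \<Rightarrow> 'e \<Rightarrow> ('e \<times> 'e) \<times> 'e" where
  "slot one k f = (if k = 1 then ((f, one), one) else if k = 2 then ((one, f), one)
     else ((one, one), f))"

abbreviation colour :: "nat \<Rightarrow> bool" where
  "colour k \<equiv> k = 1 \<or> k = 2 \<or> k = 3"

context strict_triple
begin

abbreviation "actO \<equiv> pair_act (pair_act XO YO) ZO"
abbreviation "actA \<equiv> pair_act (pair_act XA YA) ZA"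
abbreviation "mul3 \<equiv> pair_mul (pair_mul mul mul) mul"

lemma slot_mem [simp]: "f \<in> E \<Longrightarrow> slot one k f \<in> (E \<times> E) \<times> E"
  by (simp add: slot_def)

lemma actO_slot:
  "\<lbrakk>f \<in> E; A \<in> Obj C\<rbrakk> \<Longrightarrow>
    actO (slot one k f) A = (if k = 1 then XO f A else if k = 2 then YO f A else ZO f A)"
  by (simp add: slot_def)

lemma actA_slot:
  "\<lbrakk>f \<in> E; u \<in> Arr C\<rbrakk> \<Longrightarrow>
    actA (slot one k f) u = (if k = 1 then XA f u else if k = 2 then YA f u else ZA f u)"
  by (simp add: slot_def)

lemma om_slot_ascending:
  assumes "f \<in> E" "g \<in> E" "A \<in> Obj C"
  shows "xyz.pair_om (slot one 1 f) (slot one 2 g) A = \<chi>12 f g A"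
    "xyz.pair_om (slot one 1 f) (slot one 3 g) A = \<chi>13 f g A"
    "xyz.pair_om (slot one 2 f) (slot one 3 g) A = \<chi>23 f g A"
  using assms by (simp_all add: slot_def)

lemma om_trivial:
  assumes "f \<in> E" "f' \<in> E" "g \<in> E" "g' \<in> E" "h \<in> E" "h' \<in> E" "A \<in> Obj C"
  shows "xyz.pair_om ((f, one), one) ((f', one), one) A = \<one> (actO ((f, one), one) (actO ((f', one), one) A))"
    "xyz.pair_om ((one, g), one) ((f', g'), one) A = \<one> (actO ((one, g), one) (actO ((f', g'), one) A))"
    "xyz.pair_om ((one, one), h) ((f', g'), h') A = \<one> (actO ((one, one), h) (actO ((f', g'), h') A))"
  using assms by simp_all

text \<open>The lower colour already acts first, as in the combined action, so every \<chi> that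
  occurs has a unit argument.\<close>

lemma om_slot_descending:
  assumes "f \<in> E" "g \<in> E" "A \<in> Obj C" "l < k" "colour k" "colour l"
  shows "xyz.pair_om (slot one k f) (slot one l g) A = \<one> (actO (slot one k f) (actO (slot one l g) A))"
  using assms by (auto simp: slot_def)

lemma slot_commute:
  assumes "f \<in> E" "g \<in> E" "k \<noteq> l" "colour k" "colour l"
  shows "mul3 (slot one k f) (slot one l g) = mul3 (slot one l g) (slot one k f)"
  using assms by (auto simp: slot_def)

lemma product_slots_mem:
  assumes "\<forall>(f, k)\<in>set L. f \<in> E"
  shows "set (map (\<lambda>(f, k). slot one k f) L) \<subseteq> (E \<times> E) \<times> E"
proof
  fix u assume "u \<in> set (map (\<lambda>(f, k). slot one k f) L)"
  then obtain f k where "(f, k) \<in> set L" and u: "u = slot one k f" by auto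
  then have "f \<in> E" using assms by auto
  then show "u \<in> (E \<times> E) \<times> E" unfolding u by (rule slot_mem)
qed

text \<open>Used for the tail of a descending list: behind a letter of colour \<open>k\<close> only
  colours up to \<open>k\<close> occur, so the product of the tail is trivial in the higher
  components.\<close>

lemma product_slots_low:
  assumes "\<forall>(f, l)\<in>set L. f \<in> E \<and> colour l"
  shows "\<forall>(f, l)\<in>set L. l \<le> 1 \<Longrightarrow>
      \<exists>x\<in>E. xyz_pair.product (map (\<lambda>(f, k). slot one k f) L) = ((x, one), one)"
    "\<forall>(f, l)\<in>set L. l \<le> 2 \<Longrightarrow>
      \<exists>x\<in>E. \<exists>y\<in>E. xyz_pair.product (map (\<lambda>(f, k). slot one k f) L) = ((x, y), one)"
  using assms
proof (induction L)
  case (Cons a L)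
  obtain f l where a: "a = (f, l)" by (cases a)
  {
    case 1
    then show ?case using Cons.IH(1) a by (auto simp: slot_def)
  next
    case 2
    then show ?case using Cons.IH(2) a by (auto simp: slot_def)
  }
qed auto

lemma compositor_descending:
  assumes "\<forall>(f, k)\<in>set L. f \<in> E \<and> colour k" "sorted_wrt (\<lambda>a b. snd b \<le> snd a) L" "A \<in> Obj C"
  shows "xyz_pair.compositor (map (\<lambda>(f, k). slot one k f) L) A =
    \<one> (foldr actO (map (\<lambda>(f, k). slot one k f) L) A)"
  using assms(1,2)
proof (induction L)
  case (Cons a L)
  obtain f k where a: "a = (f, k)" by (cases a)
  have f: "f \<in> E" "colour k" and L: "\<forall>(f, k)\<in>set L. f \<in> E \<and> colour k" "\<forall>(f, l)\<in>set L. l \<le> k"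
    using Cons.prems a by auto
  let ?L = "map (\<lambda>(f, k). slot one k f) L"
  let ?e = "xyz_pair.product ?L"
  have mem: "set ?L \<subseteq> (E \<times> E) \<times> E" "?e \<in> (E \<times> E) \<times> E"
    using product_slots_mem[of L] L(1) xyz_pair.product_closed by blast+
  have IH: "xyz_pair.compositor ?L A = \<one> (foldr actO ?L A)"
    using Cons by auto
  have B: "foldr actO ?L A \<in> Obj C"
    by (rule xyz_pair.foldr_UO_Obj[OF mem(1) assms(3)])
  have eq: "actO ?e A = foldr actO ?L A"
    using xyz_pair.compositor_typ(3)[OF mem(1) assms(3)] xy.U.Cod_Ide[OF B] unfolding IH by simp
  obtain x y z where xyz: "?e = ((x, y), z)"
    by (metis prod.collapse)
  have e: "?e = ((x, y), z)" "x \<in> E" "y \<in> E" "z \<in> E"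
    using mem(2) unfolding xyz by auto
  have "xyz_pair.compositor (slot one k f # ?L) A =
      xyz.pair_om (slot one k f) ?e A \<cdot> \<one> (actO (slot one k f) (foldr actO ?L A))"
    by (simp only: xyz_pair.compositor.simps IH xyz_pair.UA_Ide[OF slot_mem[OF f(1)] B])
  \<comment> \<open>Exchanges would be needed only with colours above \<open>k\<close>, which are
    absent from \<open>?e\<close>.\<close>
  also have "xyz.pair_om (slot one k f) ?e A = \<one> (actO (slot one k f) (actO ?e A))"
    using f(2)
  proof (elim disjE)
    assume k: "k = 1"
    then obtain x where "?e = ((x, one), one)" "x \<in> E"
      using product_slots_low(1)[OF L(1)] L(2) by auto
    then show ?thesis using om_trivial(1) f assms(3) k by (simp add: slot_def)
  next
    assume k: "k = 2"
    then obtain x y where "?e = ((x, y), one)" "x \<in> E" "y \<in> E"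
      using product_slots_low(2)[OF L(1)] L(2) by auto
    then show ?thesis using om_trivial(2) f assms(3) k by (simp add: slot_def)
  next
    assume k: "k = 3"
    then show ?thesis using om_trivial(3) f assms(3) e by (simp add: slot_def)
  qed
  finally show ?case
    using xyz_pair.UO_Obj[OF slot_mem[OF f(1)] B, of k] unfolding a eq
    by simp
qed simp

end

section \<open>Shuffles\<close>

lemma swap_step_append:
  assumes "swap_step \<Theta> \<Theta>'"
  shows "swap_step (\<Xi> @ \<Theta>) (\<Xi> @ \<Theta>')"
proof -
  obtain \<Psi> f k g l \<Lambda> where "k < l" "\<Theta> = \<Psi> @ [(f, k), (g, l)] @ \<Lambda>" "\<Theta>' = \<Psi> @ [(g, l), (f, k)] @ \<Lambda>"
    using assms unfolding swap_step_def by blast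
  then show ?thesis
    unfolding swap_step_def by (intro exI[of _ "\<Xi> @ \<Psi>"]) auto
qed

lemma swap_steps_append: "swap_step\<^sup>*\<^sup>* \<Theta> \<Theta>' \<Longrightarrow> swap_step\<^sup>*\<^sup>* (\<Xi> @ \<Theta>) (\<Xi> @ \<Theta>')"
  by (induction rule: rtranclp_induct) (auto intro: rtranclp.rtrancl_into_rtrancl swap_step_append)

lemma swap_steps_insert:
  assumes "\<forall>(c, l)\<in>set \<Xi>. k < l"
  shows "swap_step\<^sup>*\<^sup>* ((b, k) # \<Xi> @ \<Lambda>) (\<Xi> @ (b, k) # \<Lambda>)"
  using assms
proof (induction \<Xi>)
  case (Cons a \<Xi>)
  obtain c l where a: "a = (c, l)" by (cases a)
  have "swap_step ((b, k) # (c, l) # \<Xi> @ \<Lambda>) ((c, l) # (b, k) # \<Xi> @ \<Lambda>)"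
    unfolding swap_step_def using Cons.prems a by (intro exI[of _ "[]"]) auto
  moreover have "swap_step\<^sup>*\<^sup>* ([a] @ (b, k) # \<Xi> @ \<Lambda>) ([a] @ \<Xi> @ (b, k) # \<Lambda>)"
    using Cons by (intro swap_steps_append) auto
  ultimately show ?case using a by (simp add: converse_rtranclp_into_rtranclp)
qed simp

text \<open>Insertion sort: the tail is sorted first, then the head moves right past all larger
  colours.\<close>

lemma swap_steps_sorted:
  assumes "\<forall>(b, k)\<in>set \<Theta>. colour k"
  shows "swap_step\<^sup>*\<^sup>* \<Theta> (sorted_shuffle \<Theta>)"
  using assms
proof (induction \<Theta>)
  case (Cons a \<Theta>)
  obtain b k where a: "a = (b, k)" by (cases a)
  let ?S = "\<lambda>l. filter (\<lambda>(b, k). k = l) \<Theta>"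
  have "swap_step\<^sup>*\<^sup>* ([a] @ \<Theta>) ([a] @ sorted_shuffle \<Theta>)"
    using Cons by (intro swap_steps_append) auto
  also have "swap_step\<^sup>*\<^sup>* ([a] @ sorted_shuffle \<Theta>) (sorted_shuffle (a # \<Theta>))"
  proof -
    consider "k = 1" | "k = 2" | "k = 3" using Cons.prems a by auto
    then show ?thesis
    proof cases
      case 1
      then have "\<forall>(c, l)\<in>set (?S 3 @ ?S 2). k < l" by auto
      from swap_steps_insert[OF this, of b "?S 1"] 1 show ?thesis
        by (simp add: sorted_shuffle_def a)
    next
      case 2
      then have "\<forall>(c, l)\<in>set (?S 3). k < l" by auto
      from swap_steps_insert[OF this, of b "?S 2 @ ?S 1"] 2 show ?thesis
        by (simp add: sorted_shuffle_def a)
    qed (simp add: sorted_shuffle_def a)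
  qed
  finally show ?case by simp
qed (simp add: sorted_shuffle_def)

text \<open>Ensures that the choice made in \<open>phi\<close> is a normalizing path.\<close>

lemma normalizing_path_exists:
  assumes "\<forall>(b, k)\<in>set \<Theta>. colour k"
  shows "\<exists>P. normalizing_path \<Theta> P"
proof -
  have "\<exists>P. P \<noteq> [] \<and> hd P = \<Theta> \<and> last P = \<Theta>' \<and> (\<forall>i < length P - 1. swap_step (P ! i) (P ! Suc i))"
    if "swap_step\<^sup>*\<^sup>* \<Theta> \<Theta>'" for \<Theta>'
    using that
  proof (induction rule: converse_rtranclp_induct)
    case base
    show ?case by (intro exI[of _ "[\<Theta>']"]) simp
  next
    case (step \<Theta> \<Psi>)
    then obtain P where P: "P \<noteq> []" "hd P = \<Psi>" "last P = \<Theta>'"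
      "\<forall>i < length P - 1. swap_step (P ! i) (P ! Suc i)" by blast
    have "swap_step ((\<Theta> # P) ! i) ((\<Theta> # P) ! Suc i)" if "i < length (\<Theta> # P) - 1" for i
      using that P step(1) by (cases i) (auto simp: hd_conv_nth)
    then show ?case using P by (intro exI[of _ "\<Theta> # P"]) auto
  qed
  then show ?thesis
    using swap_steps_sorted[OF assms] unfolding normalizing_path_def by blast
qed

fun valid_shuffle :: "(nat \<Rightarrow> nat) \<Rightarrow> shuffle \<Rightarrow> bool" where
  "valid_shuffle s [] \<longleftrightarrow> True"
| "valid_shuffle s ((b, k) # \<Lambda>) \<longleftrightarrow>
     colour k \<and> valid_basic b \<and> bsrc b = target_at s \<Lambda> k \<and> valid_shuffle s \<Lambda>"

lemma target_at_append: "target_at s (\<Xi> @ \<Lambda>) = target_at (target_at s \<Lambda>) \<Xi>"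
proof
  show "target_at s (\<Xi> @ \<Lambda>) l = target_at (target_at s \<Lambda>) \<Xi> l" for l
    by (induction \<Xi>) auto
qed

lemma target_at_Nil: "target_at s [] = s"
  by auto

lemma target_at_Cons: "target_at s ((b, k) # \<Lambda>) = (target_at s \<Lambda>)(k := btgt b)"
  by auto

lemma valid_shuffle_append:
  "valid_shuffle s (\<Xi> @ \<Lambda>) \<longleftrightarrow> valid_shuffle (target_at s \<Lambda>) \<Xi> \<and> valid_shuffle s \<Lambda>"
  by (induction \<Xi>) (auto simp: target_at_append)

lemma valid_shuffle_colour: "valid_shuffle s \<Theta> \<Longrightarrow> \<forall>(b, k)\<in>set \<Theta>. colour k"
  by (induction \<Theta>) auto

lemma target_at_swap:
  "k \<noteq> l \<Longrightarrow> target_at s (\<Xi> @ [(g, l), (f, k)] @ \<Lambda>) = target_at s (\<Xi> @ [(f, k), (g, l)] @ \<Lambda>)"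
  by (simp add: target_at_append target_at_Cons fun_upd_twist)

lemma valid_shuffle_swap:
  assumes "valid_shuffle s (\<Xi> @ [(f, k), (g, l)] @ \<Lambda>)" "k \<noteq> l"
  shows "valid_shuffle s (\<Xi> @ [(g, l), (f, k)] @ \<Lambda>)"
  using assms target_at_swap[of k l s "[]" g f \<Lambda>]
  by (auto simp: valid_shuffle_append target_at_append)

section \<open>The functors of words and shuffles as actions on arrays\<close>

locale three_monoids =
  m1: monoid_on S "t 1" "e 1" + m2: monoid_on S "t 2" "e 2" + m3: monoid_on S "t 3" "e 3"
  for S :: "'x set" and t :: "nat \<Rightarrow> 'x \<Rightarrow> 'x \<Rightarrow> 'x" and e :: "nat \<Rightarrow> 'x"
begin

lemma act_closed: "(\<And>r q z. A r q z \<in> S) \<Longrightarrow> act t e k f A r q z \<in> S"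
  by (simp add: act_def act_defs m1.tfold_closed m2.tfold_closed m3.tfold_closed del: One_nat_def)

lemma powers:
  "(\<Prod>l\<in>{Suc 0<..3}. s l) = s 2 * s (3 :: nat)" "(\<Prod>l\<in>{2<..3}. s l) = s (3 :: nat)"
  "(\<Prod>l\<in>{1..<2}. s l) = s (1 :: nat)" "(\<Prod>l\<in>{1..<3}. s l) = s 1 * s (2 :: nat)" for s :: "nat \<Rightarrow> nat"
proof -
  have "{Suc 0<..3} = {2, 3 :: nat}" "{2<..3} = {3 :: nat}" "{1..<2} = {1 :: nat}" "{1..<3} = {1, 2 :: nat}"
    by auto
  then show "(\<Prod>l\<in>{Suc 0<..3}. s l) = s 2 * s (3 :: nat)" "(\<Prod>l\<in>{2<..3}. s l) = s (3 :: nat)"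
    "(\<Prod>l\<in>{1..<2}. s l) = s (1 :: nat)" "(\<Prod>l\<in>{1..<3}. s l) = s 1 * s (2 :: nat)"
    by auto
qed

lemma wbar_pows_act:
  assumes "lists_array s xs A" "\<And>r q z. A r q z \<in> S" "is_word w" "bsrc (last w) = s k" "colour k"
  shows "lists_array (s(k := btgt (hd w)))
    (wbar_pows (t k) (e k) (\<Prod>l\<in>{k<..3}. s l) (\<Prod>l\<in>{1..<k}. s l) w xs) (act t e k (wmap w) A)"
  using assms(5)
proof (elim disjE)
  assume "k = 1"
  then show ?thesis
    using m1.wbar_pows_act1[OF assms(1,2,3)] assms(4) powers(1)[of s] by (simp add: act_def)
next
  assume "k = 2"
  then show ?thesis
    using m2.wbar_pows_act2[OF assms(1,2,3)] assms(4) powers(2,3)[of s] by (simp add: act_def)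
next
  assume "k = 3"
  then show ?thesis
    using m3.wbar_pows_act3[OF assms(1,2,3)] assms(4) powers(4)[of s] by (simp add: act_def)
qed

abbreviation shuffle_act :: "shuffle \<Rightarrow> 'x array \<Rightarrow> 'x array" where
  "shuffle_act \<Theta> A \<equiv> foldr (\<lambda>(b, k). act t e k (bmap b)) \<Theta> A"

lemma shuffle_act_closed: "(\<And>r q z. A r q z \<in> S) \<Longrightarrow> shuffle_act \<Theta> A r q z \<in> S"
  by (induction \<Theta> arbitrary: r q z) (auto simp: act_closed)

lemma wbar_shuffle_act:
  assumes "lists_array s xs A" "\<And>r q z. A r q z \<in> S" "valid_shuffle s \<Theta>"
  shows "lists_array (target_at s \<Theta>) (wbar_shuffle t e s \<Theta> xs) (shuffle_act \<Theta> A)"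
  using assms(3)
proof (induction \<Theta>)
  case Nil
  then show ?case using assms(1) by (simp add: target_at_Nil)
next
  case (Cons a \<Theta>)
  obtain b k where a: "a = (b, k)" by (cases a)
  have "lists_array ((target_at s \<Theta>)(k := btgt (hd [b])))
      (wbar_pows (t k) (e k) (\<Prod>l\<in>{k<..3}. target_at s \<Theta> l) (\<Prod>l\<in>{1..<k}. target_at s \<Theta> l) [b]
        (wbar_shuffle t e s \<Theta> xs)) (act t e k (wmap [b]) (shuffle_act \<Theta> A))"
    using Cons a shuffle_act_closed[OF assms(2)] by (intro wbar_pows_act) auto
  then show ?case
    unfolding a target_at_Cons by (simp del: fun_upd_apply)
qed

lemma wbar3_act:
  assumes "lists_array s xs A" "\<And>r q z. A r q z \<in> S"
    "f \<in> Arr delta_op" "g \<in> Arr delta_op" "h \<in> Arr delta_op"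
    "s 1 = dsrc f" "s 2 = dsrc g" "s 3 = dsrc h"
  shows "lists_array (s(1 := dtgt f, 2 := dtgt g, 3 := dtgt h)) (wbar3 t e (f, g, h) xs)
    (act t e 3 (ext h) (act t e 2 (ext g) (act t e 1 (ext f) A)))"
proof -
  have w: "is_word (nf u)" "bsrc (last (nf u)) = dsrc u" "btgt (hd (nf u)) = dtgt u"
    "wmap (nf u) = ext u" if "u \<in> Arr delta_op" for u
    using word_arr_path[OF is_nf_is_word[OF nf_word_arr(1)[OF that]]] nf_word_arr(2)[OF that]
      is_nf_is_word[OF nf_word_arr(1)[OF that]] by auto
  let ?s1 = "s(1 := dtgt f)" and ?s2 = "s(1 := dtgt f, 2 := dtgt g)"
  let ?A1 = "act t e 1 (ext f) A" and ?A2 = "act t e 2 (ext g) (act t e 1 (ext f) A)"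
  let ?x1 = "wbar_pow (t 1) (e 1) (s 2 * s 3) (nf f) xs"
  let ?x2 = "wbar_pows (t 2) (e 2) (s 3) (dtgt f) (nf g) ?x1"
  have "?x1 = wbar_pows (t 1) (e 1) (s 2 * s 3) 1 (nf f) xs"
    using assms(1,6) w(2)[OF assms(3)] by (intro m1.wbar_pow_eq_pows) (simp add: lists_array_def)
  then have 1: "lists_array ?s1 ?x1 ?A1"
    using wbar_pows_act[OF assms(1,2) w(1)[OF assms(3)], of 1] w[OF assms(3)] assms(6) powers(1)[of s]
    by simp
  have 2: "lists_array ?s2 ?x2 ?A2"
    using wbar_pows_act[OF 1 act_closed[OF assms(2)] w(1)[OF assms(4)], of 2] w[OF assms(4)] assms(7)
      powers(2,3)[of ?s1]
    by simp
  have "lists_array (s(1 := dtgt f, 2 := dtgt g, 3 := dtgt h))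
      (wbar_pows (t 3) (e 3) 1 (dtgt f * dtgt g) (nf h) ?x2) (act t e 3 (ext h) ?A2)"
    using wbar_pows_act[OF 2 act_closed[OF act_closed[OF assms(2)]] w(1)[OF assms(5)], of 3]
      w[OF assms(5)] assms(8) powers(4)[of ?s2]
    by simp
  then show ?thesis using assms(7,8) by simp
qed

end

declare One_nat_def [simp del]

section \<open>The transformations\<close>

lemma is_Dg_simps [simp]: "\<not> is_Dg (Id1 n)" "\<not> is_Dg (Fc n j)" "is_Dg (Dg n j)"
  by (simp_all add: is_Dg_def)

text \<open>The pivot is the one place where a block fails to be a singleton, which is why it
  governs \<chi>.\<close>

lemma block_pivot:
  assumes "valid_basic b" "r < btgt b"
  shows "pivot b = Some (r + 1) \<Longrightarrow> block (bmap b) r = (if is_Dg b then [] else [r, r + 1])"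
    "pivot b \<noteq> Some (r + 1) \<Longrightarrow> \<exists>i. block (bmap b) r = [i]"
proof -
  show "block (bmap b) r = (if is_Dg b then [] else [r, r + 1])" if "pivot b = Some (r + 1)"
    using assms that by (cases b) (auto simp: block_coface block_codegeneracy split: if_splits)
  show "\<exists>i. block (bmap b) r = [i]" if "pivot b \<noteq> Some (r + 1)"
  proof (cases b)
    case (Id1 n)
    then show ?thesis by (simp add: block_id)
  next
    case (Fc n j)
    then have "Suc r \<noteq> j" using assms that by auto
    then show ?thesis using Fc by (simp add: block_coface)
  next
    case (Dg n j)
    then have "r \<noteq> j" using that by simp
    then show ?thesis using Dg by (simp add: block_codegeneracy)
  qed
qed

lemma (in twofold) mat_pair:
  assumes [simp]: "\<And>i j. P i j \<in> Obj C"
  shows "mat [i, i'] [j, j'] P = \<iota> (P i j) (P i j') (P i' j) (P i' j')"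
    "mat [i, i'] [] P = \<tau>" "mat [] [j, j'] P = \<beta>" "mat [] [] P = \<kappa>"
proof -
  have "mat [i, i'] [j, j'] P =
      row2 [j, j'] (P i) (P i') \<cdot> (\<one> (L.TO [j, j'] (P i)) \<otimes> mat [i'] [j, j'] P)"
    by (subst mat.simps) (simp del: mat.simps row2.simps)
  also have "\<dots> = row2 [j, j'] (P i) (P i')"
    unfolding mat_single_left[OF assms] by (simp del: mat.simps row2.simps)
  also have "\<dots> = \<iota> (P i j) (P i j') (P i' j) (P i' j')"
    using row2_single[of "P i" "P i'" j'] by simp
  finally show "mat [i, i'] [j, j'] P = \<iota> (P i j) (P i j') (P i' j) (P i' j')" .
  show "mat [i, i'] [] P = \<tau>" by (simp add: a5)
  show "mat [] [j, j'] P = \<beta>" using row0_single[of j'] by simp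
qed simp

text \<open>A singleton block in either direction makes the interchange an identity. Otherwise both
  blocks have length 0 or 2, and the four combinations are the four structure maps.\<close>

lemma (in twofold) mat_basic:
  assumes P [simp]: "\<And>i j. P i j \<in> Obj C"
    and "valid_basic f" "r < btgt f" "valid_basic g" "q < btgt g"
  shows "mat (block (bmap f) r) (block (bmap g) q) P =
    (if pivot f = Some (r + 1) \<and> pivot g = Some (q + 1)
     then (if is_Dg f then (if is_Dg g then \<kappa> else \<beta>)
           else (if is_Dg g then \<tau> else \<iota> (P r q) (P r (q + 1)) (P (r + 1) q) (P (r + 1) (q + 1))))
     else Ide C (K.TO (block (bmap f) r) (\<lambda>i. L.TO (block (bmap g) q) (P i))))"
proof -
  note f = block_pivot[OF assms(2,3)] and g = block_pivot[OF assms(4,5)]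
  consider "pivot f = Some (r + 1)" "pivot g = Some (q + 1)" | "pivot f \<noteq> Some (r + 1)"
    | "pivot g \<noteq> Some (q + 1)" by blast
  then show ?thesis
  proof cases
    case 1
    then show ?thesis using f(1) g(1) by (simp add: mat_pair del: mat.simps)
  next
    case 2
    then show ?thesis using f(2) by (auto simp: mat_single_left simp del: mat.simps)
  next
    case 3
    then show ?thesis using g(2) by (auto simp: mat_single_right simp del: mat.simps)
  qed
qed

lemma concat_comprehension:
  assumes "\<And>x. length (F x) = L"
  shows "length (concat (map F [1..<u + 1])) = u * L"
    "\<lbrakk>x < u; j < L\<rbrakk> \<Longrightarrow> concat (map F [1..<u + 1]) ! (x * L + j) = F (x + 1) ! j"
proof -
  have uni: "\<forall>v\<in>set (map F [1..<u + 1]). length v = L" using assms by auto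
  show "length (concat (map F [1..<u + 1])) = u * L"
    using length_concat_uniform[OF uni] by simp
  show "concat (map F [1..<u + 1]) ! (x * L + j) = F (x + 1) ! j" if "x < u" "j < L"
    using nth_concat_uniform[OF uni, of x j] that by (simp add: add.commute)
qed

text \<open>List positions count from 0 and the coordinates of the comprehension from 1, hence the
  shifts.\<close>

lemma comprehension5:
  fixes F :: "nat \<Rightarrow> nat \<Rightarrow> nat \<Rightarrow> nat \<Rightarrow> nat \<Rightarrow> 'x" and u n v m w :: nat
  defines "xs \<equiv> [F x r y q z. x \<leftarrow> [1..<u + 1], r \<leftarrow> [1..<n + 1], y \<leftarrow> [1..<v + 1],
    q \<leftarrow> [1..<m + 1], z \<leftarrow> [1..<w + 1]]"
  shows "length xs = u * n * v * m * w"
    "\<lbrakk>x < u; r < n; y < v; q < m; z < w\<rbrakk> \<Longrightarrow>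
      xs ! ((((x * n + r) * v + y) * m + q) * w + z) = F (x + 1) (r + 1) (y + 1) (q + 1) (z + 1)"
proof -
  let ?f1 = "\<lambda>x r y q. map (F x r y q) [1..<w + 1]"
  let ?f2 = "\<lambda>x r y. concat (map (?f1 x r y) [1..<m + 1])"
  let ?f3 = "\<lambda>x r. concat (map (?f2 x r) [1..<v + 1])"
  let ?f4 = "\<lambda>x. concat (map (?f3 x) [1..<n + 1])"
  have 1: "length (?f1 x r y q) = w" for x r y q by simp
  note 2 = concat_comprehension[OF 1]
  note 3 = concat_comprehension[of "?f2 x r" "m * w" for x r, OF 2(1)]
  note 4 = concat_comprehension[of "?f3 x" "v * (m * w)" for x, OF 3(1)]
  note 5 = concat_comprehension[of ?f4 "n * (v * (m * w))", OF 4(1)]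
  have xs: "xs = concat (map ?f4 [1..<u + 1])" by (simp add: xs_def)
  show "length xs = u * n * v * m * w"
    using 5(1) by (simp add: xs mult.assoc)
  assume b: "x < u" "r < n" "y < v" "q < m" "z < w"
  have i4: "q * w + z < m * w" using b by (intro mult_add_less)
  have i3: "y * (m * w) + (q * w + z) < v * (m * w)" using b i4 by (intro mult_add_less)
  have i2: "r * (v * (m * w)) + (y * (m * w) + (q * w + z)) < n * (v * (m * w))"
    using b i3 by (intro mult_add_less)
  have "(((x * n + r) * v + y) * m + q) * w + z =
      x * (n * (v * (m * w))) + (r * (v * (m * w)) + (y * (m * w) + (q * w + z)))"
    by (simp add: algebra_simps)
  then show "xs ! ((((x * n + r) * v + y) * m + q) * w + z) =
      F (x + 1) (r + 1) (y + 1) (q + 1) (z + 1)"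
    unfolding xs by (simp only: 5(2)[OF b(1) i2] 4(2)[OF b(2) i3] 3(2)[OF b(3) i4] 2(2)[OF b(4,5)])
      (use b(5) in \<open>simp add: add.commute\<close>)
qed

lemma chi_nth:
  fixes As :: "'o list"
  assumes "x < u" "r < btgt f" "y < v" "q < btgt g" "z < w"
  defines "A \<equiv> \<lambda>r q. As ! ((((x * bsrc f + r) * v + y) * bsrc g + q) * w + z)"
  shows "chi M k l u v w f g As ! ((((x * btgt f + r) * v + y) * btgt g + q) * w + z) =
    (if pivot f = Some (r + 1) \<and> pivot g = Some (q + 1)
     then (if is_Dg f then (if is_Dg g then Kappa M k l else Beta M k l)
           else (if is_Dg g then Tau M k l
                 else Iota M k l (A r q) (A r (q + 1)) (A (r + 1) q) (A (r + 1) (q + 1))))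
     else Ide M (wbar_pows (TensO M k) (Unit M k) (v * btgt g * w) u [f]
       (wbar_pows (TensO M l) (Unit M l) w (u * bsrc f * v) [g] As) !
         ((((x * btgt f + r) * v + y) * btgt g + q) * w + z)))"
  unfolding chi_def Let_def
  by (subst comprehension5(2)[OF assms(1-5)]) (simp add: position_def A_def)

text \<open>\<open>As\<close> and \<open>S\<close> isolate everything that depends on where a
  coordinate lies in the list, so one statement serves all three pairs of colours.\<close>

lemma chi_mat:
  fixes As :: "'o list" and M :: "('o, 'a, 'z) threefold_scheme"
  assumes two: "twofold M (TensO M k) (TensA M k) (Unit M k) (TensO M l) (TensA M l) (Unit M l)
      (Kappa M k l) (Beta M k l) (Tau M k l) (Iota M k l)"
    and f: "valid_basic f" and g: "valid_basic g"
    and b: "x < u" "r < btgt f" "y < v" "q < btgt g" "z < w"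
    and B: "\<And>i j. B i j \<in> Obj M"
    and As: "\<And>i j. \<lbrakk>i < bsrc f; j < bsrc g\<rbrakk> \<Longrightarrow>
      As ! ((((x * bsrc f + i) * v + y) * bsrc g + j) * w + z) = B i j"
    and S: "wbar_pows (TensO M k) (Unit M k) (v * btgt g * w) u [f]
        (wbar_pows (TensO M l) (Unit M l) w (u * bsrc f * v) [g] As) !
          ((((x * btgt f + r) * v + y) * btgt g + q) * w + z) =
      tfold (TensO M k) (Unit M k) (block (bmap f) r)
        (\<lambda>i. tfold (TensO M l) (Unit M l) (block (bmap g) q) (B i))"
  shows "chi M k l u v w f g As ! ((((x * btgt f + r) * v + y) * btgt g + q) * w + z) =
    twofold.mat M (TensO M k) (TensA M k) (Unit M k) (TensO M l) (TensA M l) (Unit M l)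
      (Kappa M k l) (Beta M k l) (Tau M k l) (Iota M k l) (block (bmap f) r) (block (bmap g) q) B"
proof -
  interpret twofold M "TensO M k" "TensA M k" "Unit M k" "TensO M l" "TensA M l" "Unit M l"
    "Kappa M k l" "Beta M k l" "Tau M k l" "Iota M k l"
    by (rule two)
  \<comment> \<open>The pivot of a face is an inner index, so both entries that are tensored lie
    inside the list.\<close>
  have bound: "i < bsrc b" "i + 1 < bsrc b"
    if "i < btgt b" "valid_basic b" "pivot b = Some (i + 1)" "\<not> is_Dg b" for i b
    using that by (cases b; auto)+
  show ?thesis
    unfolding chi_nth[OF b] S mat_basic[OF B f b(2) g b(4)]
    using As bound[OF b(2) f] bound[OF b(4) g] by auto
qed

lemma length_chi: "length (chi M k l u v w f g As) = u * btgt f * v * btgt g * w"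
  unfolding chi_def Let_def by (rule comprehension5(1))

section \<open>Shuffles and their transformations in the array model\<close>

locale threefold_bar =
  threefold_tensor M "TensO M 1" "TensA M 1" "Unit M 1" "TensO M 2" "TensA M 2" "Unit M 2"
    "TensO M 3" "TensA M 3" "Unit M 3" "Kappa M 1 2" "Beta M 1 2" "Tau M 1 2" "Iota M 1 2"
    "Kappa M 1 3" "Beta M 1 3" "Tau M 1 3" "Iota M 1 3"
    "Kappa M 2 3" "Beta M 2 3" "Tau M 2 3" "Iota M 2 3"
  for M :: "('o, 'a, 'z) threefold_scheme"
begin

sublocale obs: three_monoids "Obj M" "TensO M" "Unit M"
  by unfold_locales auto

sublocale ars: three_monoids "Arr M" "TensA M" "\<lambda>k. Ide M (Unit M k)"
  by unfold_locales auto

abbreviation "omega_maps \<equiv> arr.xyz.pair_om"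
abbreviation "elements \<equiv> map (\<lambda>(b, k). slot id k (bmap b))"
abbreviation "triples \<equiv> (Collect mono \<times> Collect mono) \<times> (Collect mono :: (nat \<Rightarrow> nat) set)"

lemma actO_act:
  "\<lbrakk>mono f; \<And>r q z. A r q z \<in> Obj M; colour k\<rbrakk> \<Longrightarrow>
    arr.actO (slot id k f) A = act (TensO M) (Unit M) k f A"
  by (subst arr.actO_slot) (auto simp: act_def)

lemma actA_act:
  "\<lbrakk>mono f; \<And>r q z. u r q z \<in> Arr M; colour k\<rbrakk> \<Longrightarrow>
    arr.actA (slot id k f) u = act (TensA M) (\<lambda>k. Ide M (Unit M k)) k f u"
  by (subst arr.actA_slot) (auto simp: act_def)

lemma foldr_actO:
  assumes "\<And>r q z. A r q z \<in> Obj M" "\<forall>(b, k)\<in>set \<Theta>. colour k"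
  shows "foldr arr.actO (elements \<Theta>) A = obs.shuffle_act \<Theta> A"
  using assms(2)
proof (induction \<Theta>)
  case (Cons a \<Theta>)
  obtain b k where a: "a = (b, k)" by (cases a)
  have "arr.actO (slot id k (bmap b)) (obs.shuffle_act \<Theta> A) = act (TensO M) (Unit M) k (bmap b) (obs.shuffle_act \<Theta> A)"
    using Cons.prems a by (intro actO_act mono_bmap obs.shuffle_act_closed assms(1)) auto
  moreover have "foldr arr.actO (elements \<Theta>) A = obs.shuffle_act \<Theta> A"
    by (rule Cons.IH) (use Cons.prems in auto)
  ultimately show ?case
    by (simp only: a list.map foldr.simps o_apply prod.case)
qed simp

lemma foldr_actA:
  assumes "\<And>r q z. u r q z \<in> Arr M" "\<forall>(b, k)\<in>set \<Theta>. colour k"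
  shows "foldr arr.actA (elements \<Theta>) u = ars.shuffle_act \<Theta> u"
  using assms(2)
proof (induction \<Theta>)
  case (Cons a \<Theta>)
  obtain b k where a: "a = (b, k)" by (cases a)
  have "arr.actA (slot id k (bmap b)) (ars.shuffle_act \<Theta> u) = act (TensA M) (\<lambda>k. Ide M (Unit M k)) k (bmap b) (ars.shuffle_act \<Theta> u)"
    using Cons.prems a by (intro actA_act mono_bmap ars.shuffle_act_closed assms(1)) auto
  moreover have "foldr arr.actA (elements \<Theta>) u = ars.shuffle_act \<Theta> u"
    by (rule Cons.IH) (use Cons.prems in auto)
  ultimately show ?case
    by (simp only: a list.map foldr.simps o_apply prod.case)
qed simp

lemma elements_mem: "set (elements \<Theta>) \<subseteq> triples"
proof
  fix e assume "e \<in> set (elements \<Theta>)"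
  then obtain b k where e: "e = slot id k (bmap b)" by auto
  show "e \<in> triples" unfolding e by (rule arr.slot_mem) (simp add: mono_bmap)
qed

lemma WS_obj_array:
  assumes "lists_array s xs A" "\<And>r q z. A r q z \<in> Obj M" "valid_shuffle s \<Theta>"
  shows "lists_array (target_at s \<Theta>) (WS_obj M s \<Theta> xs) (foldr arr.actO (elements \<Theta>) A)"
  using obs.wbar_shuffle_act[OF assms] foldr_actO[OF assms(2) valid_shuffle_colour[OF assms(3)]]
  by (simp add: WS_obj_def)

lemma WS_arr_array:
  assumes "lists_array s xs u" "\<And>r q z. u r q z \<in> Arr M" "valid_shuffle s \<Theta>"
  shows "lists_array (target_at s \<Theta>) (WS_arr M s \<Theta> xs) (foldr arr.actA (elements \<Theta>) u)"
  using ars.wbar_shuffle_act[OF assms] foldr_actA[OF assms(2) valid_shuffle_colour[OF assms(3)]]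
  by (simp add: WS_arr_def)

text \<open>The colours add up to 6, so \<open>6 - k - l\<close> is the third one. The left side of
  \<chi> applies \<open>g\<close> before \<open>f\<close>, which gives the intermediate
  sizes.\<close>

lemma chi1_array:
  assumes s: "lists_array s xs A" and A: "\<And>r q z. A r q z \<in> Obj M"
    and f: "valid_basic f" "bsrc f = s k" and g: "valid_basic g" "bsrc g = s l"
    and kl: "colour k" "colour l" "k < l"
  shows "lists_array (s(k := btgt f, l := btgt g)) (chi1 M k l (s (6 - k - l)) f g xs)
    (omega_maps (slot id k (bmap f)) (slot id l (bmap g)) A)"
proof -
  let ?s = "s(k := btgt f, l := btgt g)"
  let ?B = "act (TensO M) (Unit M) l (bmap g) A"
  let ?ys = "wbar_pows (TensO M l) (Unit M l) (\<Prod>i\<in>{l<..3}. s i) (\<Prod>i\<in>{1..<l}. s i) [g] xs"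
  have 1: "lists_array (s(l := btgt g)) ?ys ?B"
    using obs.wbar_pows_act[OF s A, of "[g]" l] f g kl by simp
  have "lists_array ((s(l := btgt g))(k := btgt f))
      (wbar_pows (TensO M k) (Unit M k) (\<Prod>i\<in>{k<..3}. (s(l := btgt g)) i)
        (\<Prod>i\<in>{1..<k}. (s(l := btgt g)) i) [f] ?ys) (act (TensO M) (Unit M) k (bmap f) ?B)"
    using obs.wbar_pows_act[OF 1 obs.act_closed[OF A], of "[f]" k] f g kl by simp
  then have S: "lists_array ?s
      (wbar_pows (TensO M k) (Unit M k) (\<Prod>i\<in>{k<..3}. (s(l := btgt g)) i)
        (\<Prod>i\<in>{1..<k}. (s(l := btgt g)) i) [f] ?ys) (act (TensO M) (Unit M) k (bmap f) ?B)"
    using kl by (simp add: fun_upd_twist)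
  have one: "{Suc 0<..3} = {2, 3 :: nat}" "{2<..3} = {3 :: nat}" "{1<..3} = {2, 3 :: nat}"
    "{1..<2} = {1 :: nat}" "{1..<3} = {1, 2 :: nat}" by auto
  \<comment> \<open>In each case the size of the third colour occupies one of the three powers of
    \<open>chi\<close> and the others are 1; the list index is padded with zeros
    accordingly.\<close>
  consider "k = 1" "l = 2" | "k = 1" "l = 3" | "k = 2" "l = 3" using kl by auto
  then show ?thesis
  proof cases
    case 1
    then have chi1: "chi1 M k l (s (6 - k - l)) f g xs = chi M 1 2 1 1 (s 3) f g xs"
      by (simp add: chi1_def)
    have om: "omega_maps (slot id k (bmap f)) (slot id l (bmap g)) A = array\<chi>12 (bmap f) (bmap g) A"
      using 1 arr.om_slot_ascending(1)[of "bmap f" "bmap g" A] A mono_bmap by simp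
    show ?thesis
      unfolding lists_array_def chi1 om length_chi
    proof (intro conjI allI impI)
      fix r q z assume "r < ?s 1" "q < ?s 2" "z < ?s 3"
      then have b: "0 < (1::nat)" "r < btgt f" "0 < (1::nat)" "q < btgt g" "z < s 3"
        using 1 by auto
      have "chi M 1 2 1 1 (s 3) f g xs ! ((((0 * btgt f + r) * 1 + 0) * btgt g + q) * s 3 + z) =
          array\<chi>12 (bmap f) (bmap g) A r q z"
        unfolding array\<chi>12_def
        using S s b f(2) g(2) 1
        by (intro chi_mat m12.twofold_axioms f(1) g(1) b A)
          (simp_all add: lists_array_def one act_def act_defs)
      then show "chi M 1 2 1 1 (s 3) f g xs ! ((r * ?s 2 + q) * ?s 3 + z) =
          array\<chi>12 (bmap f) (bmap g) A r q z"
        using 1 by simp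
    qed (use 1 in simp)
  next
    case 2
    then have chi1: "chi1 M k l (s (6 - k - l)) f g xs = chi M 1 3 1 (s 2) 1 f g xs"
      by (simp add: chi1_def)
    have om: "omega_maps (slot id k (bmap f)) (slot id l (bmap g)) A = array\<chi>13 (bmap f) (bmap g) A"
      using 2 arr.om_slot_ascending(2)[of "bmap f" "bmap g" A] A mono_bmap by simp
    show ?thesis
      unfolding lists_array_def chi1 om length_chi
    proof (intro conjI allI impI)
      fix r q z assume "r < ?s 1" "q < ?s 2" "z < ?s 3"
      then have b: "0 < (1::nat)" "r < btgt f" "q < s 2" "z < btgt g" "0 < (1::nat)"
        using 2 by auto
      have "chi M 1 3 1 (s 2) 1 f g xs ! ((((0 * btgt f + r) * s 2 + q) * btgt g + z) * 1 + 0) =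
          array\<chi>13 (bmap f) (bmap g) A r q z"
        unfolding array\<chi>13_def
        using S s b f(2) g(2) 2
        by (intro chi_mat m13.twofold_axioms f(1) g(1) b A)
          (simp_all add: lists_array_def one act_def act_defs)
      then show "chi M 1 3 1 (s 2) 1 f g xs ! ((r * ?s 2 + q) * ?s 3 + z) =
          array\<chi>13 (bmap f) (bmap g) A r q z"
        using 2 by simp
    qed (use 2 in simp)
  next
    case 3
    then have chi1: "chi1 M k l (s (6 - k - l)) f g xs = chi M 2 3 (s 1) 1 1 f g xs"
      by (simp add: chi1_def flip: One_nat_def)
    have om: "omega_maps (slot id k (bmap f)) (slot id l (bmap g)) A = array\<chi>23 (bmap f) (bmap g) A"
      using 3 arr.om_slot_ascending(3)[of "bmap f" "bmap g" A] A mono_bmap by simp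
    show ?thesis
      unfolding lists_array_def chi1 om length_chi
    proof (intro conjI allI impI)
      fix r q z assume "r < ?s 1" "q < ?s 2" "z < ?s 3"
      then have b: "r < s 1" "q < btgt f" "0 < (1::nat)" "z < btgt g" "0 < (1::nat)"
        using 3 by auto
      have "chi M 2 3 (s 1) 1 1 f g xs ! ((((r * btgt f + q) * 1 + 0) * btgt g + z) * 1 + 0) =
          array\<chi>23 (bmap f) (bmap g) A r q z"
        unfolding array\<chi>23_def
        using S s b f(2) g(2) 3
        by (intro chi_mat m23.twofold_axioms f(1) g(1) b A)
          (simp_all add: lists_array_def one act_def act_defs)
      then show "chi M 2 3 (s 1) 1 1 f g xs ! ((r * ?s 2 + q) * ?s 3 + z) =
          array\<chi>23 (bmap f) (bmap g) A r q z"
        using 3 by simp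
    qed (use 3 in simp)
  qed
qed

end

text \<open>The swapped members differ in colour, so the shuffles first differ at
  \<open>length \<Xi>\<close>, and the swap is read off correctly.\<close>

lemma phi_step_eq:
  assumes "k \<noteq> l"
  shows "phi_step M s (\<Xi> @ [(f, k), (g, l)] @ \<Lambda>) (\<Xi> @ [(g, l), (f, k)] @ \<Lambda>) xs =
    WS_arr M (target_at s ((f, k) # (g, l) # \<Lambda>)) \<Xi>
      (chi1 M k l (target_at s \<Lambda> (6 - k - l)) f g (WS_obj M s \<Lambda> xs))"
proof -
  have "(LEAST i. (\<Xi> @ [(f, k), (g, l)] @ \<Lambda>) ! i \<noteq> (\<Xi> @ [(g, l), (f, k)] @ \<Lambda>) ! i) = length \<Xi>"
  proof (rule Least_equality)
    show "length \<Xi> \<le> i" if "(\<Xi> @ [(f, k), (g, l)] @ \<Lambda>) ! i \<noteq> (\<Xi> @ [(g, l), (f, k)] @ \<Lambda>) ! i" for i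
      using that by (cases "i < length \<Xi>") (auto simp: nth_append)
  qed (use assms in simp)
  then show ?thesis
    by (simp add: phi_step_def nth_append)
qed

lemma sorted_wrt_const: "(\<And>x y. \<lbrakk>x \<in> set xs; y \<in> set xs\<rbrakk> \<Longrightarrow> R x y) \<Longrightarrow> sorted_wrt R xs"
  by (induction xs) auto

lemma sorted_shuffle_descending: "sorted_wrt (\<lambda>a b. snd b \<le> snd a) (sorted_shuffle \<Theta>)"
  unfolding sorted_shuffle_def sorted_wrt_append by (auto intro!: sorted_wrt_const)

context threefold_bar
begin

lemma foldr_actO_Obj: "(\<And>r q z. A r q z \<in> Obj M) \<Longrightarrow> foldr arr.actO (elements \<Theta>) A r q z \<in> Obj M"
  using arr.xyz_pair.foldr_UO_Obj[OF elements_mem, of A \<Theta>] by simp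

text \<open>These names seal the combined action; the proof of the lax functor laws uses only the
  laws of \<open>lax_action\<close>.\<close>

definition "Omega = omega_maps"
definition "assembly \<Theta> A = arr.xyz_pair.compositor (elements \<Theta>) A"
definition "semO = arr.actO"
definition "semA = arr.actA"

sublocale sem: lax_action "arrays M" triples arr.mul3 "((id, id), id)" semO semA Omega
  unfolding Omega_def semO_def semA_def by (rule arr.xyz_pair.lax_action_axioms)

lemma slot_triples: "slot id k (bmap b) \<in> triples"
  by (rule arr.slot_mem) (simp add: mono_bmap)

lemma Omega_Arr:
  assumes "e \<in> triples" "e' \<in> triples" "\<And>r q z. A r q z \<in> Obj M"
  shows "Omega e e' A r q z \<in> Arr M"
  using arr.xyz_pair.om_Arr[OF assms(1,2), of A] assms(3) unfolding Omega_def arrays_simps by blast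

lemma phi_step_array:
  assumes s: "lists_array s xs A" and A: "\<And>r q z. A r q z \<in> Obj M" and "k < l"
    and valid: "valid_shuffle s (\<Xi> @ [(f, k), (g, l)] @ \<Lambda>)"
  shows "lists_array (target_at s (\<Xi> @ [(f, k), (g, l)] @ \<Lambda>))
    (phi_step M s (\<Xi> @ [(f, k), (g, l)] @ \<Lambda>) (\<Xi> @ [(g, l), (f, k)] @ \<Lambda>) xs)
    (foldr arr.actA (elements \<Xi>) (Omega (slot id k (bmap f)) (slot id l (bmap g))
      (foldr arr.actO (elements \<Lambda>) A)))"
proof -
  let ?s = "target_at s \<Lambda>" and ?B = "foldr arr.actO (elements \<Lambda>) A"
  let ?s' = "target_at s ((f, k) # (g, l) # \<Lambda>)"
  have v: "valid_shuffle s \<Lambda>" "valid_basic f" "valid_basic g" "bsrc f = ?s k" "bsrc g = ?s l"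
    "colour k" "colour l" "valid_shuffle ?s' \<Xi>"
    using valid \<open>k < l\<close> by (auto simp: valid_shuffle_append)
  have B: "?B r q z \<in> Obj M" for r q z
    by (rule foldr_actO_Obj[OF A])
  have "lists_array (?s(k := btgt f, l := btgt g))
      (chi1 M k l (?s (6 - k - l)) f g (WS_obj M s \<Lambda> xs))
      (Omega (slot id k (bmap f)) (slot id l (bmap g)) ?B)"
    unfolding Omega_def using v \<open>k < l\<close> by (intro chi1_array WS_obj_array[OF s A] B) auto
  moreover have "?s(k := btgt f, l := btgt g) = ?s'"
    using \<open>k < l\<close> unfolding target_at_Cons by (simp add: fun_upd_twist)
  ultimately have chi: "lists_array ?s' (chi1 M k l (?s (6 - k - l)) f g (WS_obj M s \<Lambda> xs))
      (Omega (slot id k (bmap f)) (slot id l (bmap g)) ?B)"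
    by simp
  have eq: "target_at s (\<Xi> @ [(f, k), (g, l)] @ \<Lambda>) = target_at ?s' \<Xi>"
    by (simp add: target_at_append)
  have "k \<noteq> l" using \<open>k < l\<close> by simp
  show ?thesis
    unfolding phi_step_eq[OF \<open>k \<noteq> l\<close>] eq
    by (intro WS_arr_array chi v(8) Omega_Arr slot_triples B)
qed

lemma assembly_descending:
  assumes "\<And>r q z. A r q z \<in> Obj M" "\<forall>(b, k)\<in>set \<Theta>. colour k"
    "sorted_wrt (\<lambda>a b. snd b \<le> snd a) \<Theta>"
  shows "assembly \<Theta> A = (\<lambda>r q z. Ide M (foldr arr.actO (elements \<Theta>) A r q z))"
proof -
  let ?L = "map (\<lambda>(b, k). (bmap b, k)) \<Theta>"
  have eq: "map (\<lambda>(f, k). slot id k f) ?L = elements \<Theta>"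
    by auto
  have "\<forall>(f, k)\<in>set ?L. f \<in> Collect mono \<and> colour k"
    using assms(2) mono_bmap by auto
  moreover have "sorted_wrt (\<lambda>a b. snd b \<le> snd a) ?L"
    using assms(3) by (simp add: sorted_wrt_map split_beta)
  moreover have "A \<in> Obj (arrays M)"
    using assms(1) by simp
  ultimately have "arr.xyz_pair.compositor (map (\<lambda>(f, k). slot id k f) ?L) A =
      Ide (arrays M) (foldr arr.actO (map (\<lambda>(f, k). slot id k f) ?L) A)"
    by (rule arr.compositor_descending)
  then show ?thesis
    unfolding eq assembly_def arrays_simps .
qed

text \<open>\<open>compositor_swap\<close> with the descending order as the trivial one: elements of
  different colours commute in the product monoid, and after the swap nothing has to be
  exchanged.\<close>

lemma assembly_swap:
  assumes "\<And>r q z. A r q z \<in> Obj M" "k < l" "colour k" "colour l"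
  shows "assembly (\<Xi> @ [(f, k), (g, l)] @ \<Lambda>) A = (\<lambda>r q z.
    Cmp M (assembly (\<Xi> @ [(g, l), (f, k)] @ \<Lambda>) A r q z)
      (foldr arr.actA (elements \<Xi>) (Omega (slot id k (bmap f)) (slot id l (bmap g))
        (foldr arr.actO (elements \<Lambda>) A)) r q z))"
proof -
  let ?d = "slot id k (bmap f)" and ?d' = "slot id l (bmap g)"
  have A: "A \<in> Obj (arrays M)" using assms(1) by simp
  have mono: "bmap b \<in> Collect mono" for b
    by (simp add: mono_bmap)
  have "k \<noteq> l" using assms(2) by simp
  have "arr.xyz_pair.compositor (elements \<Xi> @ ?d # ?d' # elements \<Lambda>) A =
      Cmp (arrays M) (arr.xyz_pair.compositor (elements \<Xi> @ ?d' # ?d # elements \<Lambda>) A)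
        (foldr arr.actA (elements \<Xi>) (omega_maps ?d ?d' (foldr arr.actO (elements \<Lambda>) A)))"
    by (rule arr.xyz_pair.compositor_swap[OF slot_triples slot_triples
        arr.slot_commute[OF mono mono \<open>k \<noteq> l\<close> assms(3,4)]
        arr.om_slot_descending[OF mono mono _ assms(2,4,3)] elements_mem elements_mem A])
  then show ?thesis
    unfolding assembly_def Omega_def arrays_simps
    by (simp only: map_append list.map prod.case append.simps)
qed

text \<open>Induction from the end of the path, where the colours descend and the compositor is an
  identity; each earlier swap contributes the factor from \<open>assembly_swap\<close>. The array
  does not mention the path, so independence of the path is a by-product.\<close>

lemma phi_path_array:
  assumes "lists_array s xs A" "\<And>r q z. A r q z \<in> Obj M" "valid_shuffle s \<Theta>"
    "P \<noteq> []" "hd P = \<Theta>" "sorted_wrt (\<lambda>a b. snd b \<le> snd a) (last P)"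
    "\<forall>i < length P - 1. swap_step (P ! i) (P ! Suc i)"
  shows "lists_array (target_at s \<Theta>) (phi_path M s P xs) (assembly \<Theta> A)"
  using assms(3-)
proof (induction P arbitrary: \<Theta>)
  case (Cons \<Theta>0 P)
  then have \<Theta>0: "\<Theta>0 = \<Theta>" by simp
  show ?case
  proof (cases P)
    case Nil
    have eq: "assembly \<Theta> A = (\<lambda>r q z. Ide M (foldr arr.actO (elements \<Theta>) A r q z))"
      using Cons.prems(4) Nil \<Theta>0 by (intro assembly_descending assms(2) valid_shuffle_colour[OF Cons.prems(1)]) simp
    show ?thesis
      unfolding Nil \<Theta>0 phi_path.simps eq
      by (rule lists_array_map[OF WS_obj_array[OF assms(1,2) Cons.prems(1)]])
  next
    case (Cons \<Theta>' P')
    have step: "swap_step \<Theta> \<Theta>'"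
      using Cons.prems(5)[rule_format, of 0] \<open>P = \<Theta>' # P'\<close> \<Theta>0 by simp
    have steps: "\<forall>i < length P - 1. swap_step (P ! i) (P ! Suc i)"
    proof (intro allI impI)
      fix i assume "i < length P - 1"
      then show "swap_step (P ! i) (P ! Suc i)"
        using Cons.prems(5)[rule_format, of "Suc i"] by simp
    qed
    obtain \<Xi> f k g l \<Lambda> where kl: "k < l"
      and \<Theta>: "\<Theta> = \<Xi> @ [(f, k), (g, l)] @ \<Lambda>" and \<Theta>': "\<Theta>' = \<Xi> @ [(g, l), (f, k)] @ \<Lambda>"
      using step unfolding swap_step_def by blast
    have valid: "valid_shuffle s \<Theta>'" and tgt: "target_at s \<Theta>' = target_at s \<Theta>"
      using valid_shuffle_swap[of s \<Xi> f k g l \<Lambda>] target_at_swap[of k l s \<Xi> g f \<Lambda>] Cons.prems(1) kl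
      unfolding \<Theta> \<Theta>' by auto
    have "lists_array (target_at s \<Theta>') (phi_path M s P xs) (assembly \<Theta>' A)"
      using Cons.prems(4) valid steps \<open>P = \<Theta>' # P'\<close> by (intro Cons.IH) auto
    then have 1: "lists_array (target_at s \<Theta>) (phi_path M s P xs) (assembly \<Theta>' A)"
      unfolding tgt .
    have col: "colour k" "colour l"
      using Cons.prems(1) unfolding \<Theta> valid_shuffle_append by auto
    have 2: "lists_array (target_at s \<Theta>) (phi_step M s \<Theta> \<Theta>' xs)
        (foldr arr.actA (elements \<Xi>) (Omega (slot id k (bmap f)) (slot id l (bmap g))
          (foldr arr.actO (elements \<Lambda>) A)))"
      using phi_step_array[OF assms(1,2) kl Cons.prems(1)[unfolded \<Theta>]] unfolding \<Theta> \<Theta>' .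
    have eq: "assembly \<Theta> A = (\<lambda>r q z. Cmp M (assembly \<Theta>' A r q z)
        (foldr arr.actA (elements \<Xi>) (Omega (slot id k (bmap f)) (slot id l (bmap g))
          (foldr arr.actO (elements \<Lambda>) A)) r q z))"
      unfolding \<Theta> \<Theta>' by (rule assembly_swap[OF assms(2) kl col])
    show ?thesis
      unfolding \<Theta>0 \<open>P = \<Theta>' # P'\<close> phi_path.simps eq
      by (rule lists_array_map2[OF 1[unfolded \<open>P = \<Theta>' # P'\<close>] 2])
  qed
qed simp

lemma phi_array:
  assumes "lists_array s xs A" "\<And>r q z. A r q z \<in> Obj M" "valid_shuffle s \<Theta>"
  shows "lists_array (target_at s \<Theta>) (phi M s \<Theta> xs) (assembly \<Theta> A)"
proof -
  have "normalizing_path \<Theta> (SOME P. normalizing_path \<Theta> P)"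
    using someI_ex[OF normalizing_path_exists[OF valid_shuffle_colour[OF assms(3)]]] .
  then show ?thesis
    unfolding phi_def normalizing_path_def
    using sorted_shuffle_descending by (intro phi_path_array assms) auto
qed

section \<open>Normal forms in the array model\<close>

fun sem :: "dop \<times> dop \<times> dop \<Rightarrow> ((nat \<Rightarrow> nat) \<times> (nat \<Rightarrow> nat)) \<times> (nat \<Rightarrow> nat)" where
  "sem (f, g, h) = ((ext f, ext g), ext h)"

lemma mul_slot: "arr.mul3 (slot id k f) (slot id k g) = slot id k (g \<circ> f)"
  and slot_id: "slot id k id = ((id, id), id)"
  by (simp_all add: slot_def)

lemma product_elements:
  "arr.xyz_pair.product (elements (map (\<lambda>b. (b, k)) w)) = slot id k (wmap w)"
  by (induction w)
    (simp_all only: arr.xyz_pair.product.simps list.map prod.case wmap_simps mul_slot slot_id)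

lemma product_elements_append:
  "arr.xyz_pair.product (elements (\<Theta> @ \<Theta>')) =
    arr.mul3 (arr.xyz_pair.product (elements \<Theta>)) (arr.xyz_pair.product (elements \<Theta>'))"
  unfolding map_append by (rule arr.xyz_pair.product_append[OF elements_mem elements_mem])

lemma valid_shuffle_single:
  assumes "path (s k) w" "colour k"
  shows "valid_shuffle s (map (\<lambda>b. (b, k)) w)" "target_at s (map (\<lambda>b. (b, k)) w) = s(k := endpoint (s k) w)"
proof -
  have tgt: "target_at s (map (\<lambda>b. (b, k)) w) = s(k := endpoint (s k) w)" for w
    by (induction w) (simp_all only: list.map target_at_Cons target_at_Nil endpoint.simps
        fun_upd_triv fun_upd_upd)
  then show "target_at s (map (\<lambda>b. (b, k)) w) = s(k := endpoint (s k) w)" .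
  show "valid_shuffle s (map (\<lambda>b. (b, k)) w)"
    using assms by (induction w) (auto simp: tgt)
qed

text \<open>The third claim removes the words: the letters of the normal forms multiply to the
  triple of monotone maps they stand for.\<close>

lemma nf_shuffle_valid:
  assumes "f \<in> Arr delta_op" "g \<in> Arr delta_op" "h \<in> Arr delta_op"
    "s 1 = dsrc f" "s 2 = dsrc g" "s 3 = dsrc h"
  shows "valid_shuffle s (nf_shuffle (f, g, h))"
    "target_at s (nf_shuffle (f, g, h)) = s(1 := dtgt f, 2 := dtgt g, 3 := dtgt h)"
    "arr.xyz_pair.product (elements (nf_shuffle (f, g, h))) = sem (f, g, h)"
proof -
  let ?s1 = "s(1 := dtgt f)" and ?s2 = "s(1 := dtgt f, 2 := dtgt g)"
  note f = nf_path[OF assms(1)] and g = nf_path[OF assms(2)] and h = nf_path[OF assms(3)]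
  have 1: "valid_shuffle s (nf_seq 1 f)" "target_at s (nf_seq 1 f) = ?s1"
    using valid_shuffle_single[of s 1 "filter proper (nf f)"] f assms(4) by (simp_all add: nf_seq_def)
  have 2: "valid_shuffle ?s1 (nf_seq 2 g)" "target_at ?s1 (nf_seq 2 g) = ?s2"
    using valid_shuffle_single[of ?s1 2 "filter proper (nf g)"] g assms(5) by (simp_all add: nf_seq_def)
  have 3: "valid_shuffle ?s2 (nf_seq 3 h)"
    "target_at ?s2 (nf_seq 3 h) = s(1 := dtgt f, 2 := dtgt g, 3 := dtgt h)"
    using valid_shuffle_single[of ?s2 3 "filter proper (nf h)"] h assms(6) by (simp_all add: nf_seq_def)
  show "valid_shuffle s (nf_shuffle (f, g, h))"
    by (simp only: nf_shuffle.simps valid_shuffle_append target_at_append 1 2 3)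
  show "target_at s (nf_shuffle (f, g, h)) = s(1 := dtgt f, 2 := dtgt g, 3 := dtgt h)"
    by (simp only: nf_shuffle.simps target_at_append 1 2 3)
  have p: "arr.xyz_pair.product (elements (nf_seq k u)) = slot id k (ext u)"
    if "u \<in> Arr delta_op" for k u
    unfolding nf_seq_def product_elements nf_path(3)[OF that] ..
  have "arr.xyz_pair.product (elements (nf_shuffle (f, g, h))) =
      arr.mul3 (slot id 3 (ext h)) (arr.mul3 (slot id 2 (ext g)) (slot id 1 (ext f)))"
    by (simp only: nf_shuffle.simps product_elements_append p assms)
  also have "\<dots> = sem (f, g, h)"
    by (simp add: slot_def)
  finally show "arr.xyz_pair.product (elements (nf_shuffle (f, g, h))) = sem (f, g, h)" .
qed

lemma nf_shuffle_descending: "sorted_wrt (\<lambda>a b. snd b \<le> snd a) (nf_shuffle e)"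
  by (cases e) (auto simp: sorted_wrt_append nf_seq_def intro!: sorted_wrt_const)

lemma assembly_nf:
  assumes "\<And>r q z. A r q z \<in> Obj M" "valid_shuffle s (nf_shuffle e)"
  shows "arr.xyz_pair.compositor (elements (nf_shuffle e)) A =
    Ide (arrays M) (foldr arr.actO (elements (nf_shuffle e)) A)"
  using assembly_descending[OF assms(1) valid_shuffle_colour[OF assms(2)] nf_shuffle_descending]
  unfolding assembly_def arrays_simps .

end

section \<open>Powers of the category as boxes of arrays\<close>

definition sizes :: "nat \<times> nat \<times> nat \<Rightarrow> nat \<Rightarrow> nat" where
  "sizes d l = (if l = 1 then fst d else if l = 2 then fst (snd d) else snd (snd d))"

lemma sizes_simps [simp]: "sizes (n, m, p) 1 = n" "sizes (n, m, p) 2 = m" "sizes (n, m, p) 3 = p"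
  by (simp_all add: sizes_def)

lemma lists_array_cong:
  "\<lbrakk>lists_array s xs A; s 1 = s' 1; s 2 = s' 2; s 3 = s' 3\<rbrakk> \<Longrightarrow> lists_array s' xs A"
  by (simp add: lists_array_def)

lemma delta_op3_simps [simp]:
  "d \<in> Obj delta_op3"
  "(f, g, h) \<in> Arr delta_op3 \<longleftrightarrow> f \<in> Arr delta_op \<and> g \<in> Arr delta_op \<and> h \<in> Arr delta_op"
  "Dom delta_op3 (f, g, h) = (dsrc f, dsrc g, dsrc h)"
  "Cod delta_op3 (f, g, h) = (dtgt f, dtgt g, dtgt h)"
  "Ide delta_op3 (n, m, p) = (Ide delta_op n, Ide delta_op m, Ide delta_op p)"
  "Cmp delta_op3 (f', g', h') (f, g, h) = (Cmp delta_op f' f, Cmp delta_op g' g, Cmp delta_op h' h)"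
  by (cases d; simp add: delta_op3_def prod_cat_def)+

lemma category_delta_op3: "category delta_op3"
  unfolding delta_op3_def by (intro category_prod_cat category_delta_op)

context threefold_bar
begin

text \<open>The word-free description of \<open>omega\<close>. Since \<open>sem\<close> is
  multiplicative, values at composite arrows become comparable although their normal forms are
  unrelated.\<close>

lemma omega_array:
  assumes "e1 \<in> Arr delta_op3" "e2 \<in> Arr delta_op3" "Dom delta_op3 e2 = Cod delta_op3 e1"
    and xs: "lists_array (sizes (Dom delta_op3 e1)) xs A" and A': "A \<in> Obj (arrays M)"
  shows "lists_array (sizes (Cod delta_op3 e2)) (omega M e2 e1 xs) (Omega (sem e2) (sem e1) A)"
proof -
  have A: "A r q z \<in> Obj M" for r q z using A' by simp
  obtain f1 g1 h1 f2 g2 h2 where e1: "e1 = (f1, g1, h1)" and e2: "e2 = (f2, g2, h2)"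
    by (metis surj_pair)
  let ?s = "sources e1" and ?T1 = "nf_shuffle e1" and ?T2 = "nf_shuffle e2"
  have a: "f1 \<in> Arr delta_op" "g1 \<in> Arr delta_op" "h1 \<in> Arr delta_op"
    "f2 \<in> Arr delta_op" "g2 \<in> Arr delta_op" "h2 \<in> Arr delta_op"
    "dsrc f2 = dtgt f1" "dsrc g2 = dtgt g1" "dsrc h2 = dtgt h1"
    using assms(1-3) by (simp_all add: e1 e2)
  have s: "?s 1 = dsrc f1" "?s 2 = dsrc g1" "?s 3 = dsrc h1"
    by (simp_all add: e1)
  note n1 = nf_shuffle_valid[OF a(1-3) s, folded e1]
  let ?s1 = "?s(1 := dtgt f1, 2 := dtgt g1, 3 := dtgt h1)"
  have s1: "?s1 1 = dsrc f2" "?s1 2 = dsrc g2" "?s1 3 = dsrc h2"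
    by (simp_all add: a)
  note n2 = nf_shuffle_valid[OF a(4-6) s1, folded e2]
  have valid: "valid_shuffle ?s (?T2 @ ?T1)"
    by (simp only: valid_shuffle_append n1 n2)
  have "lists_array ?s xs A"
    using xs by (rule lists_array_cong) (simp_all add: e1)
  then have "lists_array (target_at ?s (?T2 @ ?T1)) (omega M e2 e1 xs) (assembly (?T2 @ ?T1) A)"
    unfolding omega_def by (intro phi_array A valid)
  moreover have "target_at ?s (?T2 @ ?T1) = ?s1(1 := dtgt f2, 2 := dtgt g2, 3 := dtgt h2)"
    by (simp only: target_at_append n1 n2)
  \<comment> \<open>Each half has descending colours, so its compositor is an identity and only the
    comparison of the two products remains.\<close>
  moreover have "assembly (?T2 @ ?T1) A = Omega (sem e2) (sem e1) A"
    unfolding assembly_def Omega_def map_append n1(3)[symmetric] n2(3)[symmetric]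
    by (intro arr.xyz_pair.compositor_append_trivial elements_mem
        assembly_nf[OF _ n1(1)] assembly_nf[OF _ n2(1)] A A' foldr_actO_Obj)
  ultimately have "lists_array (?s1(1 := dtgt f2, 2 := dtgt g2, 3 := dtgt h2)) (omega M e2 e1 xs)
      (Omega (sem e2) (sem e1) A)"
    by simp
  then show ?thesis
    by (rule lists_array_cong) (simp_all add: e2)
qed

lemma semO_sem:
  "semO (sem (f, g, h)) A = act (TensO M) (Unit M) 3 (ext h) (act (TensO M) (Unit M) 2 (ext g)
    (act (TensO M) (Unit M) 1 (ext f) A))"
  by (simp add: semO_def act_def)

lemma semA_sem:
  "semA (sem (f, g, h)) u = act (TensA M) (\<lambda>k. Ide M (Unit M k)) 3 (ext h)
    (act (TensA M) (\<lambda>k. Ide M (Unit M k)) 2 (ext g) (act (TensA M) (\<lambda>k. Ide M (Unit M k)) 1 (ext f) u))"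
  by (simp add: semA_def act_def)

lemma W_obj_array:
  assumes "e \<in> Arr delta_op3" "lists_array (sizes (Dom delta_op3 e)) xs A" "A \<in> Obj (arrays M)"
  shows "lists_array (sizes (Cod delta_op3 e)) (W_obj M e xs) (semO (sem e) A)"
proof -
  obtain f g h where e: "e = (f, g, h)" by (metis surj_pair)
  have "lists_array ((sizes (Dom delta_op3 e))(1 := dtgt f, 2 := dtgt g, 3 := dtgt h)) (W_obj M e xs)
      (semO (sem e) A)"
    unfolding W_obj_def e semO_sem
    using assms unfolding e by (intro obs.wbar3_act) simp_all
  then show ?thesis
    by (rule lists_array_cong) (simp_all add: e)
qed

lemma W_arr_array:
  assumes "e \<in> Arr delta_op3" "lists_array (sizes (Dom delta_op3 e)) xs u" "u \<in> Arr (arrays M)"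
  shows "lists_array (sizes (Cod delta_op3 e)) (W_arr M e xs) (semA (sem e) u)"
proof -
  obtain f g h where e: "e = (f, g, h)" by (metis surj_pair)
  have "lists_array ((sizes (Dom delta_op3 e))(1 := dtgt f, 2 := dtgt g, 3 := dtgt h)) (W_arr M e xs)
      (semA (sem e) u)"
    unfolding W_arr_def e semA_sem
    using assms unfolding e by (intro ars.wbar3_act) simp_all
  then show ?thesis
    by (rule lists_array_cong) (simp_all add: e)
qed

lemma sem_triples: "e \<in> Arr delta_op3 \<Longrightarrow> sem e \<in> triples"
  by (cases e) auto

lemma sem_Cmp:
  assumes "e1 \<in> Arr delta_op3" "e2 \<in> Arr delta_op3" "Dom delta_op3 e2 = Cod delta_op3 e1"
  shows "sem (Cmp delta_op3 e2 e1) = arr.mul3 (sem e2) (sem e1)"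
  using assms by (cases e1; cases e2) (simp add: ext_Cmp)

lemma sem_Ide: "sem (Ide delta_op3 d) = ((id, id), id)"
  by (cases d) (simp only: delta_op3_simps sem.simps ext_Ide)

lemma lists_array_Dom: "lists_array s f u \<Longrightarrow> lists_array s (map (Dom M) f) (Dom (arrays M) u)"
  and lists_array_Cod: "lists_array s f u \<Longrightarrow> lists_array s (map (Cod M) f) (Cod (arrays M) u)"
  and lists_array_Ide: "lists_array s xs A \<Longrightarrow> lists_array s (map (Ide M) xs) (Ide (arrays M) A)"
  and lists_array_Cmp: "\<lbrakk>lists_array s g v; lists_array s f u\<rbrakk> \<Longrightarrow>
    lists_array s (map2 (Cmp M) g f) (Cmp (arrays M) v u)"
  unfolding arrays_simps by (intro lists_array_map lists_array_map2; assumption)+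

lemma W_cat_Obj_array:
  assumes "xs \<in> Obj (W_cat M d)"
  obtains A where "lists_array (sizes d) xs A" "A \<in> Obj (arrays M)"
proof -
  have "length xs = sizes d 1 * sizes d 2 * sizes d 3" "set xs \<subseteq> Obj M"
    using assms by (cases d; simp add: W_cat_def pow_cat_def)+
  then show ?thesis
    by (rule lists_array_exists[where d = "Unit M 1"]) (use that in auto)
qed

lemma W_cat_Arr_array:
  assumes "xs \<in> Arr (W_cat M d)"
  obtains u where "lists_array (sizes d) xs u" "u \<in> Arr (arrays M)"
proof -
  have "length xs = sizes d 1 * sizes d 2 * sizes d 3" "set xs \<subseteq> Arr M"
    using assms by (cases d; simp add: W_cat_def pow_cat_def)+
  then show ?thesis
    by (rule lists_array_exists[where d = "Ide M (Unit M 1)"]) (use that in auto)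
qed

lemma array_W_cat_Obj:
  assumes "lists_array (sizes d) xs A" "A \<in> Obj (arrays M)"
  shows "xs \<in> Obj (W_cat M d)"
  using lists_array_set[OF assms(1), of "Obj M"] assms
  by (cases d) (auto simp: W_cat_def pow_cat_def lists_array_def)

lemma array_W_cat_Arr:
  assumes "lists_array (sizes d) f u" "u \<in> Arr (arrays M)"
  shows "f \<in> Arr (W_cat M d)"
  using lists_array_set[OF assms(1), of "Arr M"] assms
  by (cases d) (auto simp: W_cat_def pow_cat_def lists_array_def)

end

section \<open>The lax functor\<close>

lemma category_pow_cat:
  assumes "category C"
  shows "category (pow_cat C n)"
proof -
  interpret C: category C by fact
  have comp: "a \<cdot> b \<in> Arr C" if f: "set f \<subseteq> Arr C" and g: "set g \<subseteq> Arr C"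
    and eq: "map (Dom C) g = map (Cod C) f" and ab: "(a, b) \<in> set (zip g f)" for a b f g
  proof -
    obtain i where "i < length f" "i < length g" and i: "a = g ! i" "b = f ! i"
      using ab by (auto simp: in_set_zip)
    moreover from this have "Dom C a = Cod C b"
      using eq by (metis nth_map)
    moreover have "a \<in> Arr C" "b \<in> Arr C"
      using set_zip_leftD[OF ab] set_zip_rightD[OF ab] f g by auto
    ultimately show ?thesis by simp
  qed
  have match: "Dom C (g ! i) = Cod C (f ! i)" if "map (Dom C) g = map (Cod C) f" "i < length f" for f g i
    using that by (metis length_map nth_map)
  show ?thesis
    by unfold_locales
      (auto simp: pow_cat_def comp, auto simp: subset_iff match list_eq_iff_nth_eq)
qed

context threefold_bar
begin

lemma W_cat_simps [simp]:
  "Dom (W_cat M d) = map (Dom M)" "Cod (W_cat M d) = map (Cod M)" "Ide (W_cat M d) = map (Ide M)"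
  "Cmp (W_cat M d) = map2 (Cmp M)"
  by (cases d; simp add: W_cat_def pow_cat_def)+

lemma category_W_cat: "category (W_cat M d)"
  by (cases d) (simp add: W_cat_def category_pow_cat m12.K.category_axioms)

text \<open>Needed for functoriality: lists that compose must be represented by arrays that compose
  everywhere, also outside the box.\<close>

lemma composable_arrays:
  assumes "lists_array (sizes d) f u" "u \<in> Arr (arrays M)" "g \<in> Arr (W_cat M d)"
    "map (Dom M) g = map (Cod M) f"
  obtains v where "lists_array (sizes d) g v" "v \<in> Arr (arrays M)" "Dom (arrays M) v = Cod (arrays M) u"
proof -
  obtain v where v: "lists_array (sizes d) g v" "v \<in> Arr (arrays M)"
    using W_cat_Arr_array[OF assms(3)] by blast
  let ?P = "\<lambda>r q z. r < sizes d 1 \<and> q < sizes d 2 \<and> z < sizes d 3"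
  \<comment> \<open>An arbitrary filler for \<open>g\<close> need not compose with \<open>u\<close>;
    the identities on the targets of \<open>u\<close> always do.\<close>
  let ?v = "\<lambda>r q z. if ?P r q z then v r q z else Ide M (Cod M (u r q z))"
  have "Dom M (v r q z) = Cod M (u r q z)" if "?P r q z" for r q z
  proof -
    let ?i = "(r * sizes d 2 + q) * sizes d 3 + z"
    have "?i < length f" "?i < length g"
      using that index_less assms(1) v(1) by (auto simp: lists_array_def)
    then have "Dom M (g ! ?i) = Cod M (f ! ?i)"
      using assms(4) by (metis nth_map)
    then show ?thesis
      using that assms(1) v(1) by (simp add: lists_array_def)
  qed
  moreover have "lists_array (sizes d) g ?v"
    using v(1) by (simp add: lists_array_def)
  ultimately show ?thesis
    using that[of ?v] v(2) assms(2) by (auto simp: fun_eq_iff)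
qed

declare arrays_simps [simp del]

text \<open>Each functor law holds for the action on arrays, and \<open>lists_array_unique\<close>
  carries it back to lists.\<close>

lemma W_functor:
  assumes e: "e \<in> Arr delta_op3"
  shows "cat_functor (W_cat M (Dom delta_op3 e)) (W_cat M (Cod delta_op3 e)) (W_obj M e) (W_arr M e)"
proof -
  note t = sem_triples[OF e] and WO = W_obj_array[OF e] and WA = W_arr_array[OF e]
  note unique = lists_array_unique[of "sizes (Cod delta_op3 e)"]
  show ?thesis
  proof (intro cat_functor.intro cat_functor_axioms.intro category_W_cat; (unfold W_cat_simps)?)
    fix xs assume "xs \<in> Obj (W_cat M (Dom delta_op3 e))"
    then obtain A where A: "lists_array (sizes (Dom delta_op3 e)) xs A" "A \<in> Obj (arrays M)"
      by (rule W_cat_Obj_array)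
    show "W_obj M e xs \<in> Obj (W_cat M (Cod delta_op3 e))"
      by (rule array_W_cat_Obj[OF WO[OF A] sem.UO_Obj[OF t A(2)]])
    show "W_arr M e (map (Ide M) xs) = map (Ide M) (W_obj M e xs)"
      using WA[OF lists_array_Ide[OF A(1)]] A(2) lists_array_Ide[OF WO[OF A]] t
      by (intro unique) simp_all
  next
    fix f assume "f \<in> Arr (W_cat M (Dom delta_op3 e))"
    then obtain u where u: "lists_array (sizes (Dom delta_op3 e)) f u" "u \<in> Arr (arrays M)"
      by (rule W_cat_Arr_array)
    note W = WA[OF u]
    show "W_arr M e f \<in> Arr (W_cat M (Cod delta_op3 e))"
      by (rule array_W_cat_Arr[OF W sem.UA_Arr[OF t u(2)]])
    show "map (Dom M) (W_arr M e f) = W_obj M e (map (Dom M) f)"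
      using WO[OF lists_array_Dom[OF u(1)]] u(2) lists_array_Dom[OF W] t by (intro unique) simp_all
    show "map (Cod M) (W_arr M e f) = W_obj M e (map (Cod M) f)"
      using WO[OF lists_array_Cod[OF u(1)]] u(2) lists_array_Cod[OF W] t by (intro unique) simp_all
    fix g assume "g \<in> Arr (W_cat M (Dom delta_op3 e))" "map (Dom M) g = map (Cod M) f"
    then obtain v where v: "lists_array (sizes (Dom delta_op3 e)) g v" "v \<in> Arr (arrays M)"
      "Dom (arrays M) v = Cod (arrays M) u"
      by (rule composable_arrays[OF u])
    show "W_arr M e (map2 (Cmp M) g f) = map2 (Cmp M) (W_arr M e g) (W_arr M e f)"
      using WA[OF lists_array_Cmp[OF v(1) u(1)]] u(2) v(2,3) lists_array_Cmp[OF WA[OF v(1,2)] W] t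
      by (intro unique) simp_all
  qed
qed

lemma functor_comp:
  assumes "cat_functor A B F f" "cat_functor B C G g"
  shows "cat_functor A C (G \<circ> F) (g \<circ> f)"
proof -
  interpret F: cat_functor A B F f by fact
  interpret G: cat_functor B C G g by fact
  show ?thesis
    by unfold_locales
      (simp_all add: F.Fo_Obj F.Fa_Arr F.Fa_Dom F.Fa_Cod F.Fa_Ide F.Fa_Cmp
        G.Fo_Obj G.Fa_Arr G.Fa_Dom G.Fa_Cod G.Fa_Ide G.Fa_Cmp)
qed

theorem lax_functor_W: "lax_functor delta_op3 (W_cat M) (W_obj M) (W_arr M) (omega M)"
proof -
  interpret J: category delta_op3 by (rule category_delta_op3)
  note WO = W_obj_array and WA = W_arr_array and om = omega_array and t = sem_triples
  show ?thesis
  proof (intro lax_functor.intro lax_functor_axioms.intro category_delta_op3 W_functor)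
    fix d :: "nat \<times> nat \<times> nat"
    note i = J.Ide_Arr[OF delta_op3_simps(1)[of d]]
    show "W_obj M (Ide delta_op3 d) xs = xs" if "xs \<in> Obj (W_cat M d)" for xs
    proof -
      obtain A where A: "lists_array (sizes d) xs A" "A \<in> Obj (arrays M)"
        using \<open>xs \<in> Obj (W_cat M d)\<close> by (rule W_cat_Obj_array)
      show ?thesis
        using WO[OF i, of xs A] A sem.UO_one[OF A(2)]
        by (intro lists_array_unique[OF _ A(1)]) (simp add: sem_Ide)
    qed
    show "W_arr M (Ide delta_op3 d) f = f" if "f \<in> Arr (W_cat M d)" for f
    proof -
      obtain u where u: "lists_array (sizes d) f u" "u \<in> Arr (arrays M)"
        using \<open>f \<in> Arr (W_cat M d)\<close> by (rule W_cat_Arr_array)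
      show ?thesis
        using WA[OF i, of f u] u sem.UA_one[OF u(2)]
        by (intro lists_array_unique[OF _ u(1)]) (simp add: sem_Ide)
    qed
  next
    fix e1 e2 assume e: "e1 \<in> Arr delta_op3" "e2 \<in> Arr delta_op3" "Dom delta_op3 e2 = Cod delta_op3 e1"
    let ?D = "W_cat M (Dom delta_op3 e1)" and ?C = "W_cat M (Cod delta_op3 e2)"
    let ?s = "sizes (Cod delta_op3 e2)" and ?e = "Cmp delta_op3 e2 e1"
    note t1 = t[OF e(1)] and t2 = t[OF e(2)]
    have ee: "?e \<in> Arr delta_op3" "Dom delta_op3 ?e = Dom delta_op3 e1" "Cod delta_op3 ?e = Cod delta_op3 e2"
      using e by simp_all
    show "nat_transformation ?D ?C (W_obj M e2 \<circ> W_obj M e1) (W_arr M e2 \<circ> W_arr M e1)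
        (W_obj M ?e) (W_arr M ?e) (omega M e2 e1)"
    proof (intro nat_transformation.intro nat_transformation_axioms.intro)
      show "cat_functor ?D ?C (W_obj M e2 \<circ> W_obj M e1) (W_arr M e2 \<circ> W_arr M e1)"
        using functor_comp W_functor[OF e(1)] W_functor[OF e(2)] e(3) by metis
      show "cat_functor ?D ?C (W_obj M ?e) (W_arr M ?e)"
        using W_functor[OF ee(1)] ee by simp
    next
      fix xs assume "xs \<in> Obj ?D"
      then obtain A where A: "lists_array (sizes (Dom delta_op3 e1)) xs A" "A \<in> Obj (arrays M)"
        by (rule W_cat_Obj_array)
      show "omega M e2 e1 xs \<in> Arr ?C"
        by (rule array_W_cat_Arr[OF om[OF e A] sem.om_Arr[OF t2 t1 A(2)]])
      have "lists_array ?s (W_obj M e2 (W_obj M e1 xs)) (semO (sem e2) (semO (sem e1) A))"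
        using WO[OF e(2), unfolded e(3), OF WO[OF e(1) A] sem.UO_Obj[OF t1 A(2)]] .
      then show "Dom ?C (omega M e2 e1 xs) = (W_obj M e2 \<circ> W_obj M e1) xs"
        using lists_array_Dom[OF om[OF e A]] unfolding sem.om_Dom[OF t2 t1 A(2)] W_cat_simps o_apply
        by (intro lists_array_unique)
      have "lists_array ?s (W_obj M ?e xs) (semO (arr.mul3 (sem e2) (sem e1)) A)"
        using WO[OF ee(1), of xs A] A unfolding ee sem_Cmp[OF e] by blast
      then show "Cod ?C (omega M e2 e1 xs) = W_obj M ?e xs"
        using lists_array_Cod[OF om[OF e A]] unfolding sem.om_Cod[OF t2 t1 A(2)] W_cat_simps
        by (intro lists_array_unique)
    next
      fix f assume "f \<in> Arr ?D"
      then obtain u where u: "lists_array (sizes (Dom delta_op3 e1)) f u" "u \<in> Arr (arrays M)"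
        by (rule W_cat_Arr_array)
      have D: "lists_array ?s (omega M e2 e1 (map (Dom M) f)) (Omega (sem e2) (sem e1) (Dom (arrays M) u))"
        and C: "lists_array ?s (omega M e2 e1 (map (Cod M) f)) (Omega (sem e2) (sem e1) (Cod (arrays M) u))"
        using u by (auto intro!: om e lists_array_Dom lists_array_Cod)
      have W2: "lists_array ?s (W_arr M e2 (W_arr M e1 f)) (semA (sem e2) (semA (sem e1) u))"
        using WA[OF e(2), unfolded e(3), OF WA[OF e(1) u] sem.UA_Arr[OF t1 u(2)]] .
      have W: "lists_array ?s (W_arr M ?e f) (semA (arr.mul3 (sem e2) (sem e1)) u)"
        using WA[OF ee(1), of f u] u unfolding ee sem_Cmp[OF e] by blast
      show "Cmp ?C (omega M e2 e1 (Cod ?D f)) ((W_arr M e2 \<circ> W_arr M e1) f) =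
          Cmp ?C (W_arr M ?e f) (omega M e2 e1 (Dom ?D f))"
        unfolding W_cat_simps o_apply
        by (rule lists_array_unique[OF
              lists_array_Cmp[OF C W2, unfolded sem.om_natural[OF t2 t1 u(2)]] lists_array_Cmp[OF W D]])
    qed
  next
    fix e xs assume e: "e \<in> Arr delta_op3" and "xs \<in> Obj (W_cat M (Dom delta_op3 e))"
    from this(2) obtain A where A: "lists_array (sizes (Dom delta_op3 e)) xs A" "A \<in> Obj (arrays M)"
      by (rule W_cat_Obj_array)
    note W = lists_array_Ide[OF WO[OF e A]]
    show "omega M e (Ide delta_op3 (Dom delta_op3 e)) xs = Ide (W_cat M (Cod delta_op3 e)) (W_obj M e xs)"
      using om[of "Ide delta_op3 (Dom delta_op3 e)" e xs A] e A sem.om_right[OF t[OF e] A(2)]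
      unfolding W_cat_simps by (intro lists_array_unique[OF _ W]) (simp add: sem_Ide)
    show "omega M (Ide delta_op3 (Cod delta_op3 e)) e xs = Ide (W_cat M (Cod delta_op3 e)) (W_obj M e xs)"
      using om[of e "Ide delta_op3 (Cod delta_op3 e)" xs A] e A sem.om_left[OF t[OF e] A(2)]
      unfolding W_cat_simps by (intro lists_array_unique[OF _ W]) (simp add: sem_Ide)
  next
    fix e1 e2 e3 xs
    assume e: "e1 \<in> Arr delta_op3" "e2 \<in> Arr delta_op3" "e3 \<in> Arr delta_op3"
      "Dom delta_op3 e2 = Cod delta_op3 e1" "Dom delta_op3 e3 = Cod delta_op3 e2"
      and "xs \<in> Obj (W_cat M (Dom delta_op3 e1))"
    from this(6) obtain A where A: "lists_array (sizes (Dom delta_op3 e1)) xs A" "A \<in> Obj (arrays M)"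
      by (rule W_cat_Obj_array)
    note t1 = t[OF e(1)] and t2 = t[OF e(2)] and t3 = t[OF e(3)]
    let ?s = "sizes (Cod delta_op3 e3)" and ?e21 = "Cmp delta_op3 e2 e1" and ?e32 = "Cmp delta_op3 e3 e2"
    have e21: "?e21 \<in> Arr delta_op3" "Dom delta_op3 ?e21 = Dom delta_op3 e1" "Cod delta_op3 ?e21 = Cod delta_op3 e2"
      and e32: "?e32 \<in> Arr delta_op3" "Dom delta_op3 ?e32 = Cod delta_op3 e1" "Cod delta_op3 ?e32 = Cod delta_op3 e3"
      using e by simp_all
    have 1: "lists_array ?s (omega M ?e32 e1 xs) (Omega (arr.mul3 (sem e3) (sem e2)) (sem e1) A)"
      using om[OF e(1) e32(1,2) A] unfolding e32(3) sem_Cmp[OF e(2,3,5)] .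
    have 2: "lists_array ?s (omega M e3 e2 (W_obj M e1 xs)) (Omega (sem e3) (sem e2) (semO (sem e1) A))"
      using om[OF e(2,3,5), unfolded e(4), OF WO[OF e(1) A] sem.UO_Obj[OF t1 A(2)]] .
    have 3: "lists_array ?s (omega M e3 ?e21 xs) (Omega (sem e3) (arr.mul3 (sem e2) (sem e1)) A)"
      using om[OF e21(1) e(3), unfolded e21 sem_Cmp[OF e(1,2,4)], OF e(5) A] .
    have 4: "lists_array ?s (W_arr M e3 (omega M e2 e1 xs)) (semA (sem e3) (Omega (sem e2) (sem e1) A))"
      using WA[OF e(3), unfolded e(5), OF om[OF e(1,2,4) A] sem.om_Arr[OF t2 t1 A(2)]] .
    show "Cmp (W_cat M (Cod delta_op3 e3)) (omega M ?e32 e1 xs) (omega M e3 e2 (W_obj M e1 xs)) =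
        Cmp (W_cat M (Cod delta_op3 e3)) (omega M e3 ?e21 xs) (W_arr M e3 (omega M e2 e1 xs))"
      \<comment> \<open>Both composites represent the same array by \<open>sem.om_assoc\<close>, for
        the same sizes.\<close>
      unfolding W_cat_simps
      by (rule lists_array_unique[OF
            lists_array_Cmp[OF 1 2, unfolded sem.om_assoc[OF t3 t2 t1 A(2)]] lists_array_Cmp[OF 3 4]])
  qed
qed

end

lemma threefold_bar:
  fixes M :: "('o, 'a, 'z) threefold_scheme"
  assumes "threefold_strict_monoidal_category M"
  shows "threefold_bar M"
proof -
  interpret T: threefold_strict_monoidal_category M by fact
  have mon: "strict_monoidal_category M (TensO M k) (TensA M k) (Unit M k)" if "1 \<le> k" "k \<le> 3" for k
    using T.strict_monoidal[OF that] .
  have two: "twofold M (TensO M k) (TensA M k) (Unit M k) (TensO M l) (TensA M l) (Unit M l)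
      (Kappa M k l) (Beta M k l) (Tau M k l) (Iota M k l)" if kl: "1 \<le> k" "k < l" "l \<le> 3" for k l
  proof (intro twofold.intro twofold_axioms.intro)
    show "strict_monoidal_category M (TensO M k) (TensA M k) (Unit M k)"
      "strict_monoidal_category M (TensO M l) (TensA M l) (Unit M l)"
      using kl by (auto intro: mon)
    show "Cmp M (Iota M k l (Cod M f) (Cod M g) (Cod M h) (Cod M j))
        (TensA M k (TensA M l f g) (TensA M l h j)) =
      Cmp M (TensA M l (TensA M k f h) (TensA M k g j)) (Iota M k l (Dom M f) (Dom M g) (Dom M h) (Dom M j))"
      if "f \<in> Arr M" "g \<in> Arr M" "h \<in> Arr M" "j \<in> Arr M" for f g h j
      using T.iota_natural[OF kl] that by blast
  qed (use T.kappa_hom[OF kl] T.beta_hom[OF kl] T.tau_hom[OF kl] T.iota_hom[OF kl] T.ax1[OF kl]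
      T.ax2[OF kl] T.ax3[OF kl] T.ax4[OF kl] T.ax5[OF kl] T.ax6[OF kl] T.ax7[OF kl] T.ax8[OF kl]
      T.ax9[OF kl] T.ax10[OF kl] T.ax11[OF kl] T.ax12[OF kl] in auto)
  show ?thesis
    by (intro threefold_bar.intro threefold_tensor.intro threefold_tensor_axioms.intro two
        T.ax13 T.ax14 T.ax15 T.ax16 T.ax17 T.ax18 T.ax19 T.ax20) simp_all
qed

theorem theorem6p5:
  fixes M :: "('o, 'a, 'z) threefold_scheme"
  assumes "threefold_strict_monoidal_category M"
  shows "lax_functor delta_op3 (W_cat M) (W_obj M) (W_arr M) (omega M)"
  by (rule threefold_bar.lax_functor_W[OF threefold_bar[OF assms]])

end
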